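(* Let $\beta=\beta_0=0.50057$. For all integers $n\ge 1$ and all $A\subset\{0,1\}^n$ with $|A|\ge\frac12$, \[ \mathbf{E}\,h_A^{\beta}\ \ge\ \max\Big(J(|A|),\ (1-|A|)\big(\log_2(1/(1-|A|))\big)^{\beta}\Big). \]
   Context: The Hamming cube $\{0,1\}^n$ is viewed as a graph in which two vertices are joined by an edge iff they differ in exactly one coordinate. For $A\subset\{0,1\}^n$ and $x\in A$, $h_A(x)$ is the number of edges connecting $x$ with the complement of $A$; $h_A(x)=0$ if $x\notin A$. For $f:\{0,1\}^n\to\mathbb{R}$, $\mathbf{E}f=2^{-n}\sum_{x}f(x)$, and $|A|=\mathbf{E}\mathbf{1}_A=2^{-n}\#A$. The expression $(1-|A|)(\log_2(1/(1-|A|)))^\beta$ is read as $0$ when $|A|=1$. $J:[\frac12,1]\to[0,\infty)$ is the unique function that is smooth on $(\frac12,1)$, continuous at the endpoints, and satisfies $J''J=-2$ on $(\frac12,1)$, $J(\frac12)=\frac12$, $J(1)=0$. Explicitly, with $\varphi(t)=(2\pi)^{-1/2}e^{-t^2/2}$, $\Phi(t)=\int_{-\infty}^t\varphi$, and the Gaussian isoperimetric profile $I(x)=\varphi(\Phi^{-1}(x))$ for $x\in(0,1)$, $I(0)=I(1)=0$, one has $J(x)=\sqrt2\,w_0\,I((1-x)/w_0)$, where $w_0\in(0,1)$ is the unique value for which $J(\frac12)=\frac12$ (numerically $w_0\in[0.895,0.896]$). *)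

theory Defs
  imports "HOL-Probability.Probability"
begin

section \<open>The Hamming cube\<close>

definition cube :: "nat \<Rightarrow> bool list set" where
  "cube n = {x. length x = n}"

definition cube_adj :: "nat \<Rightarrow> bool list \<Rightarrow> bool list \<Rightarrow> bool" where
  "cube_adj n x y \<longleftrightarrow> x \<in> cube n \<and> y \<in> cube n \<and> card {i. i < n \<and> x ! i \<noteq> y ! i} = 1"

text \<open>The cube is a simple graph, so the edges joining \<open>x\<close> to the complement of \<open>A\<close> are
  counted by the neighbours of \<open>x\<close> in that complement.\<close>

definition boundary_deg :: "nat \<Rightarrow> bool list set \<Rightarrow> bool list \<Rightarrow> nat" where
  "boundary_deg n A x = (if x \<in> A then card {y \<in> cube n - A. cube_adj n x y} else 0)"

definition cube_mean :: "nat \<Rightarrow> (bool list \<Rightarrow> real) \<Rightarrow> real" where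
  "cube_mean n f = (\<Sum>x\<in>cube n. f x) / 2 ^ n"

definition cube_density :: "nat \<Rightarrow> bool list set \<Rightarrow> real" where
  "cube_density n A = cube_mean n (indicator A)"


section \<open>The profile \<open>J\<close>\<close>

text \<open>Functions on \<open>[1/2, 1]\<close> are represented extensionally (\<open>undefined\<close> outside the interval),
  so that uniqueness on the interval is uniqueness in HOL.\<close>

definition is_profile :: "(real \<Rightarrow> real) \<Rightarrow> bool" where
  "is_profile J \<longleftrightarrow>
     J \<in> {1/2..1} \<rightarrow>\<^sub>E {0..} \<and>
     continuous_on {1/2..1} J \<and>
     (\<forall>k. \<forall>x\<in>{1/2<..<1}. (deriv ^^ k) J differentiable (at x)) \<and>
     (\<forall>x\<in>{1/2<..<1}. (deriv ^^ 2) J x * J x = -2) \<and>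
     J (1/2) = 1/2 \<and> J 1 = 0"

definition profile_J :: "real \<Rightarrow> real" where
  "profile_J = (THE J. is_profile J)"


section \<open>Existence and uniqueness of \<open>J\<close>\<close>

text \<open>Smoothness follows from the equation itself: if \<open>f' = g\<close> and \<open>g' = - 2 / f\<close>, then the ring
  generated by \<open>f\<close>, \<open>g\<close>, \<open>1 / f\<close> and the constants is closed under differentiation.\<close>

inductive_set ode_terms :: "(real \<Rightarrow> real) \<Rightarrow> (real \<Rightarrow> real) \<Rightarrow> (real \<Rightarrow> real) set"
  for f g :: "real \<Rightarrow> real" where
  "f \<in> ode_terms f g"
| "g \<in> ode_terms f g"
| "(\<lambda>x. inverse (f x)) \<in> ode_terms f g"
| "(\<lambda>x. c) \<in> ode_terms f g"
| "p \<in> ode_terms f g \<Longrightarrow> q \<in> ode_terms f g \<Longrightarrow> (\<lambda>x. p x + q x) \<in> ode_terms f g"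
| "p \<in> ode_terms f g \<Longrightarrow> q \<in> ode_terms f g \<Longrightarrow> (\<lambda>x. p x * q x) \<in> ode_terms f g"

lemma ode_terms_deriv:
  assumes f: "\<And>x. x \<in> U \<Longrightarrow> (f has_real_derivative g x) (at x)"
    and g: "\<And>x. x \<in> U \<Longrightarrow> (g has_real_derivative - 2 / f x) (at x)"
    and nz: "\<And>x. x \<in> U \<Longrightarrow> f x \<noteq> 0"
    and "h \<in> ode_terms f g"
  shows "\<exists>h'\<in>ode_terms f g. \<forall>x\<in>U. (h has_real_derivative h' x) (at x)"
  using assms(4)
proof induction
  case 1
  show ?case by (rule bexI[OF _ ode_terms.intros(2)]) (simp add: f)
next
  case 2
  show ?case
    by (rule bexI[OF _ ode_terms.intros(6)[OF ode_terms.intros(4)[of "-2"] ode_terms.intros(3)]])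
       (use g in \<open>simp add: divide_inverse\<close>)
next
  case 3
  have "((\<lambda>x. inverse (f x)) has_real_derivative -1 * (g x * (inverse (f x) * inverse (f x)))) (at x)"
    if "x \<in> U" for x
    using DERIV_inverse_fun[OF f[OF that] nz[OF that]]
    by (simp add: power2_eq_square mult_ac)
  then show ?case
    by (intro bexI[OF _ ode_terms.intros(6)[OF ode_terms.intros(4)[of "-1"] ode_terms.intros(6)[OF ode_terms.intros(2)
          ode_terms.intros(6)[OF ode_terms.intros(3) ode_terms.intros(3)]]]] ballI)
next
  case (4 c)
  show ?case by (rule bexI[OF _ ode_terms.intros(4)[of 0]]) simp
next
  case (5 p q)
  from 5(3) obtain p' where p: "p' \<in> ode_terms f g" "\<forall>x\<in>U. (p has_real_derivative p' x) (at x)"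
    by (rule bexE)
  from 5(4) obtain q' where q: "q' \<in> ode_terms f g" "\<forall>x\<in>U. (q has_real_derivative q' x) (at x)"
    by (rule bexE)
  show ?case
    by (rule bexI[OF _ ode_terms.intros(5)[OF p(1) q(1)]]) (use p(2) q(2) in \<open>simp add: DERIV_add\<close>)
next
  case (6 p q)
  from 6(3) obtain p' where p: "p' \<in> ode_terms f g" "\<forall>x\<in>U. (p has_real_derivative p' x) (at x)"
    by (rule bexE)
  from 6(4) obtain q' where q: "q' \<in> ode_terms f g" "\<forall>x\<in>U. (q has_real_derivative q' x) (at x)"
    by (rule bexE)
  show ?case
    by (rule bexI[OF _ ode_terms.intros(5)[OF ode_terms.intros(6)[OF p(1) 6(2)] ode_terms.intros(6)[OF q(1) 6(1)]]])
       (use p(2) q(2) in \<open>simp add: DERIV_mult\<close>)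
qed

lemma ode_smooth:
  assumes U: "open U"
    and f: "\<And>x. x \<in> U \<Longrightarrow> (f has_real_derivative g x) (at x)"
    and g: "\<And>x. x \<in> U \<Longrightarrow> (g has_real_derivative - 2 / f x) (at x)"
    and nz: "\<And>x. x \<in> U \<Longrightarrow> f x \<noteq> 0"
    and x: "x \<in> U"
  shows "(deriv ^^ k) f differentiable (at x)"
proof -
  have D: "\<exists>p\<in>ode_terms f g. \<forall>x\<in>U. (deriv ^^ k) f x = p x" for k
  proof (induction k)
    case 0
    show ?case using ode_terms.intros(1) by auto
  next
    case (Suc k)
    then obtain p where p: "p \<in> ode_terms f g" and "\<forall>x\<in>U. (deriv ^^ k) f x = p x" by (rule bexE)
    then have pk: "\<And>x. x \<in> U \<Longrightarrow> (deriv ^^ k) f x = p x" by simp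
    from ode_terms_deriv[OF f g nz p]
    obtain p' where p'0: "p' \<in> ode_terms f g" and "\<forall>x\<in>U. (p has_real_derivative p' x) (at x)"
      by (rule bexE)
    then have p': "\<And>x. x \<in> U \<Longrightarrow> (p has_real_derivative p' x) (at x)" by simp
    have "(deriv ^^ Suc k) f x = p' x" if "x \<in> U" for x
    proof -
      have "((deriv ^^ k) f has_real_derivative p' x) (at x)"
        by (rule has_field_derivative_transform_within_open[OF p'[OF that] U that])
           (simp add: pk)
      then show ?thesis by (simp add: DERIV_imp_deriv)
    qed
    then show ?case by (intro bexI[OF _ p'0]) simp
  qed
  from D[of k] obtain p where p: "p \<in> ode_terms f g" and "\<forall>x\<in>U. (deriv ^^ k) f x = p x" by (rule bexE)
  then have pk: "\<And>x. x \<in> U \<Longrightarrow> (deriv ^^ k) f x = p x" by simp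
  from ode_terms_deriv[OF f g nz p]
  obtain p' where "\<forall>x\<in>U. (p has_real_derivative p' x) (at x)" by (rule bexE)
  then have p': "\<And>x. x \<in> U \<Longrightarrow> (p has_real_derivative p' x) (at x)" by simp
  have "((deriv ^^ k) f has_real_derivative p' x) (at x)"
    by (rule has_field_derivative_transform_within_open[OF p'[OF x] U x]) (simp add: pk)
  then show ?thesis by (auto simp: real_differentiable_def)
qed

lemma is_profile_derivs:
  assumes "is_profile J" "1/2 < x" "x < 1"
  shows "J x > 0" "(J has_real_derivative deriv J x) (at x)"
    "(deriv J has_real_derivative - 2 / J x) (at x)"
proof -
  have x: "x \<in> {1/2<..<1}" "x \<in> {1/2..1}" using assms by auto
  have ode: "deriv (deriv J) x * J x = -2"
    using assms(1) x unfolding is_profile_def by (auto simp: numeral_2_eq_2)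
  have "J x \<ge> 0" using assms(1) x unfolding is_profile_def by (auto simp: PiE_iff)
  moreover have "J x \<noteq> 0" using ode by auto
  ultimately show "J x > 0" by simp
  have d: "(deriv ^^ k) J differentiable (at x)" for k
    using assms(1) x(1) unfolding is_profile_def by blast
  show "(J has_real_derivative deriv J x) (at x)"
    using d[of 0] by (simp add: DERIV_deriv_iff_real_differentiable)
  have "(deriv J has_real_derivative deriv (deriv J) x) (at x)"
    using d[of 1] by (simp add: DERIV_deriv_iff_real_differentiable)
  also have "deriv (deriv J) x = - 2 / J x" using ode \<open>J x > 0\<close> by (simp add: field_simps)
  finally show "(deriv J has_real_derivative - 2 / J x) (at x)" .
qed

text \<open>Uniqueness by the maximum principle: where \<open>J - K\<close> is positive, it is strictly convex.\<close>

lemma is_profile_le: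
  assumes "is_profile J" "is_profile K" "x \<in> {1/2..1}"
  shows "J x \<le> K x"
proof (rule ccontr)
  assume "\<not> J x \<le> K x"
  define D where "D = (\<lambda>x. J x - K x)"
  have "continuous_on {1/2..1} D"
    unfolding D_def using assms by (intro continuous_on_diff) (auto simp: is_profile_def)
  then obtain c where c: "c \<in> {1/2..1}" "\<And>y. y \<in> {1/2..1} \<Longrightarrow> D y \<le> D c"
    using continuous_attains_sup[of "{1/2..1}" D] assms(3) by auto
  have Dc: "D c > 0" using c(2)[OF assms(3)] \<open>\<not> J x \<le> K x\<close> by (simp add: D_def)
  have "D (1/2) = 0" "D 1 = 0" using assms(1,2) by (auto simp: D_def is_profile_def)
  with Dc have "c \<noteq> 1/2" "c \<noteq> 1" by (metis less_irrefl)+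
  with c(1) have c': "1/2 < c" "c < 1" by (auto simp only: less_le atLeastAtMost_iff)
  note j = is_profile_derivs[OF assms(1)] and k = is_profile_derivs[OF assms(2)]
  define E where "E = (\<lambda>x. deriv J x - deriv K x)"
  have dD: "(D has_real_derivative E y) (at y)" if "1/2 < y" "y < 1" for y
    unfolding D_def E_def using j(2)[OF that] k(2)[OF that] by (rule DERIV_diff)
  have dE: "(E has_real_derivative - 2 / J c - - 2 / K c) (at c)"
    unfolding E_def using j(3)[OF c'] k(3)[OF c'] by (rule DERIV_diff)
  have "J c > K c" "K c > 0" using Dc k(1)[OF c'] by (auto simp: D_def)
  then have pos: "- 2 / J c - - 2 / K c > 0" by (simp add: field_simps)
  have "E c = 0"
    using DERIV_local_max[OF dD[OF c'], of "min (c - 1/2) (1 - c)"] c' c(2)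
    by (force simp: abs_if min_def split: if_splits)
  obtain d where d: "d > 0" "\<And>h. 0 < h \<Longrightarrow> h < d \<Longrightarrow> E c < E (c + h)"
    using DERIV_pos_inc_right[OF dE pos] by blast
  define h where "h = min (d/2) ((1 - c)/2)"
  have h: "0 < h" "h < d" "c + h < 1" using d(1) c' by (auto simp: h_def min_def field_simps)
  have "D c < D (c + h)"
  proof (rule DERIV_pos_imp_increasing_open[of c "c + h" D])
    show "\<exists>y. (D has_real_derivative y) (at z) \<and> 0 < y" if "c < z" "z < c + h" for z
      using dD[of z] d(2)[of "z - c"] that c' h \<open>E c = 0\<close> by auto
    show "continuous_on {c..c + h} D"
      using c' h by (intro continuous_at_imp_continuous_on ballI DERIV_isCont[OF dD]) auto
  qed (use h in auto)
  moreover have "D (c + h) \<le> D c" using c(2)[of "c + h"] c' h by auto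
  ultimately show False by simp
qed

lemma is_profile_unique:
  assumes "is_profile J" "is_profile K"
  shows "J = K"
proof
  fix x
  show "J x = K x"
  proof (cases "x \<in> {1/2..1}")
    case True
    then show ?thesis using is_profile_le assms by (meson antisym)
  next
    case False
    then show ?thesis using assms by (auto simp: is_profile_def PiE_iff extensional_def)
  qed
qed

text \<open>Existence through the Gaussian profile: \<open>J x = sqrt 2 * w * I ((1 - x) / w)\<close> with
  \<open>w = 1 / (2 * gauss_cdf t)\<close>, where \<open>t\<close> is chosen so that \<open>J (1/2) = 1/2\<close>.\<close>

definition gauss_cdf :: "real \<Rightarrow> real" where
  "gauss_cdf t = cdf std_normal_distribution t"


lemma std_normal_measure:
  assumes "A \<in> sets borel"
  shows "measure std_normal_distribution A = (LINT y:A|lborel. std_normal_density y)"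
proof -
  interpret real_distribution std_normal_distribution by (rule real_dist_normal_dist)
  have "measure std_normal_distribution A = (LINT y|std_normal_distribution. indicator A y)"
    using assms by simp
  also have "\<dots> = (LINT y|lborel. std_normal_density y *\<^sub>R indicator A y)"
    using assms by (intro integral_density) auto
  finally show ?thesis unfolding set_lebesgue_integral_def by (simp add: mult.commute)
qed

lemma gauss_cdf_deriv: "(gauss_cdf has_real_derivative std_normal_density t) (at t)"
proof -
  interpret real_distribution std_normal_distribution by (rule real_dist_normal_dist)
  let ?a = "t - 1"
  have cont: "continuous_on S std_normal_density" for S
    unfolding normal_density_def by (intro continuous_intros) auto
  have eq: "gauss_cdf x = gauss_cdf ?a + integral {?a..x} std_normal_density" if "?a < x" for x
  proof -
    have int: "set_integrable lborel {?a..x} std_normal_density"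
      by (intro borel_integrable_atLeastAtMost' cont)
    have "gauss_cdf x - gauss_cdf ?a = measure std_normal_distribution {?a<..x}"
      unfolding gauss_cdf_def using that by (rule cdf_diff_eq)
    also have "\<dots> = (LINT y:{?a<..x}|lborel. std_normal_density y)"
      by (rule std_normal_measure) auto
    also have "\<dots> = (LINT y:{?a..x}|lborel. std_normal_density y)"
      unfolding set_lebesgue_integral_def
      by (intro integral_cong_AE AE_I[where N="{?a}"]) (auto split: split_indicator)
    also have "\<dots> = integral {?a..x} std_normal_density"
      using int by (rule set_borel_integral_eq_integral)
    finally show ?thesis by simp
  qed
  have "((\<lambda>x. gauss_cdf ?a + integral {?a..x} std_normal_density) has_real_derivative
      0 + std_normal_density t) (at t within {?a..t+1})"
    by (intro DERIV_add DERIV_const integral_has_real_derivative cont) auto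
  then have "((\<lambda>x. gauss_cdf ?a + integral {?a..x} std_normal_density) has_real_derivative
      std_normal_density t) (at t)"
    by (simp add: at_within_Icc_at)
  then show ?thesis
    by (rule has_field_derivative_transform_within_open[of _ _ _ "{?a<..<t+1}"])
       (auto simp: eq)
qed

lemma gauss_cdf_0: "gauss_cdf 0 = 1/2"
proof -
  interpret real_distribution std_normal_distribution by (rule real_dist_normal_dist)
  have "gauss_cdf 0 = (LINT y:{..0}|lborel. std_normal_density y)"
    unfolding gauss_cdf_def cdf_def by (rule std_normal_measure) auto
  also have "\<dots> = (LINT y:{0<..}|lborel. std_normal_density y)"
    unfolding set_lebesgue_integral_def
    by (subst lborel_integral_real_affine[where c = "-1" and t = 0], simp, simp,
        intro integral_cong_AE AE_I[where N="{0}"])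
       (auto split: split_indicator simp: normal_density_def)
  also have "\<dots> = measure std_normal_distribution {0<..}"
    by (rule std_normal_measure[symmetric]) auto
  also have "{0<..} = space std_normal_distribution - {..0::real}" by auto
  also have "measure std_normal_distribution \<dots> = 1 - measure std_normal_distribution {..0}"
    by (intro prob_compl) auto
  also have "\<dots> = 1 - gauss_cdf 0" by (simp add: gauss_cdf_def cdf_def)
  finally show ?thesis by simp
qed

lemma gauss_cdf_at_bot: "(gauss_cdf \<longlongrightarrow> 0) at_bot"
proof -
  interpret real_distribution std_normal_distribution by (rule real_dist_normal_dist)
  show ?thesis unfolding gauss_cdf_def by (rule cdf_lim_at_bot)
qed

lemma gauss_cdf_strict_mono: "s < t \<Longrightarrow> gauss_cdf s < gauss_cdf t"
  by (rule DERIV_pos_imp_increasing)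
     (blast intro: gauss_cdf_deriv normal_density_pos[OF zero_less_one])+

lemma gauss_cdf_pos: "gauss_cdf t > 0"
proof -
  interpret real_distribution std_normal_distribution by (rule real_dist_normal_dist)
  have "0 \<le> gauss_cdf (t - 1)" unfolding gauss_cdf_def by (rule cdf_nonneg)
  also have "\<dots> < gauss_cdf t" by (rule gauss_cdf_strict_mono) simp
  finally show ?thesis .
qed

lemma std_normal_density_at_bot: "(std_normal_density \<longlongrightarrow> 0) at_bot"
  unfolding std_normal_density_def by real_asymp

lemma std_normal_density_at_top: "(std_normal_density \<longlongrightarrow> 0) at_top"
  unfolding std_normal_density_def by real_asymp

lemma std_normal_density_deriv:
  "(std_normal_density has_real_derivative - t * std_normal_density t) (at t)"
proof -
  have "((\<lambda>t. 1 / sqrt (2 * pi) * exp (- t\<^sup>2 / 2)) has_real_derivative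
      1 / sqrt (2 * pi) * (exp (- t\<^sup>2 / 2) * (- t))) (at t)"
    by (intro DERIV_cmult DERIV_fun_exp) (auto intro!: derivative_eq_intros)
  then show ?thesis unfolding std_normal_density_def by (simp add: mult_ac)
qed

lemma profile_w_ex: "\<exists>t. std_normal_density t = gauss_cdf t / sqrt 2"
proof -
  have "\<forall>\<^sub>F t in at_top. std_normal_density t < 1 / (2 * sqrt 2)"
    using std_normal_density_at_top by (rule order_tendstoD) simp
  then obtain b where b: "b > 0" "std_normal_density b < 1 / (2 * sqrt 2)"
    unfolding eventually_at_top_linorder by (metis gt_ex max.cobounded1 max_less_iff_conj max.cobounded2 dual_order.strict_trans1)
  have "gauss_cdf b > 1/2" using gauss_cdf_strict_mono[OF b(1)] gauss_cdf_0 by simp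
  then have "gauss_cdf b / sqrt 2 > 1/2 / sqrt 2" by (intro divide_strict_right_mono) auto
  with b(2) have 1: "std_normal_density b - gauss_cdf b / sqrt 2 \<le> 0" by simp
  have "sqrt (2 * pi) < sqrt 8" using pi_less_4 by (intro real_sqrt_less_mono) auto
  also have "sqrt 8 = sqrt (4 * 2)" by simp
  also have "\<dots> = 2 * sqrt 2" by (subst real_sqrt_mult) simp
  finally have "1 / (2 * sqrt 2) < 1 / sqrt (2 * pi)" by (intro divide_strict_left_mono) auto
  then have 2: "0 \<le> std_normal_density 0 - gauss_cdf 0 / sqrt 2"
    by (simp add: std_normal_density_def gauss_cdf_0)
  have "\<exists>x. 0 \<le> x \<and> x \<le> b \<and> std_normal_density x - gauss_cdf x / sqrt 2 = 0"
    using 1 2 b(1)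
    by (intro IVT2 allI impI DERIV_isCont[OF DERIV_diff[OF std_normal_density_deriv DERIV_cdivide[OF gauss_cdf_deriv]]])
       auto
  then show ?thesis by auto
qed

lemma gauss_cdf_inv:
  obtains T where "\<And>t. T (gauss_cdf t) = t"
    "\<And>y b. 0 < y \<Longrightarrow> y < gauss_cdf b \<Longrightarrow> gauss_cdf (T y) = y \<and> T y < b"
proof
  have inj: "inj gauss_cdf"
    by (rule linorder_injI) (use gauss_cdf_strict_mono in force)
  show *: "inv gauss_cdf (gauss_cdf t) = t" for t using inj by simp
  fix y b assume y: "0 < y" "y < gauss_cdf b"
  have "\<forall>\<^sub>F t in at_bot. gauss_cdf t < y \<and> t \<le> b"
    using order_tendstoD(2)[OF gauss_cdf_at_bot y(1)] eventually_le_at_bot by (rule eventually_conj)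
  then obtain a where a: "gauss_cdf a < y" "a \<le> b"
    by (auto simp: eventually_at_bot_linorder)
  have "\<exists>t. a \<le> t \<and> t \<le> b \<and> gauss_cdf t = y"
    using a y by (intro IVT allI impI DERIV_isCont[OF gauss_cdf_deriv]) auto
  then obtain t where "t \<le> b" "gauss_cdf t = y" by blast
  with y * show "gauss_cdf (inv gauss_cdf y) = y \<and> inv gauss_cdf y < b"
    by (auto simp: less_le)
qed


lemma is_profile_exists: "\<exists>J. is_profile J"
proof -
  obtain t0 where t0: "std_normal_density t0 = gauss_cdf t0 / sqrt 2" using profile_w_ex by blast
  define s where "s = gauss_cdf t0"
  have s: "s > 0" unfolding s_def by (rule gauss_cdf_pos)
  obtain T where T: "\<And>t. T (gauss_cdf t) = t"
    "\<And>y b. 0 < y \<Longrightarrow> y < gauss_cdf b \<Longrightarrow> gauss_cdf (T y) = y \<and> T y < b"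
    using gauss_cdf_inv by blast
  define \<tau> where "\<tau> x = T (2 * s * (1 - x))" for x
  define f where "f x = std_normal_density (\<tau> x) / (sqrt 2 * s)" for x
  define J where "J = restrict (\<lambda>x. if x = 1 then 0 else f x) {1/2..1}"
  have dT: "(T has_real_derivative inverse (std_normal_density t)) (at (gauss_cdf t))" for t
  proof (rule DERIV_inverse_function[where f = gauss_cdf and a = 0 and b = "gauss_cdf (t + 1)"])
    show "(gauss_cdf has_real_derivative std_normal_density t) (at (T (gauss_cdf t)))"
      by (simp add: T(1) gauss_cdf_deriv)
    show "std_normal_density t \<noteq> 0" using normal_density_pos[of 1 0 t] by simp
    show "isCont T (gauss_cdf t)"
      by (rule isCont_inverse_function[where d = 1]) (auto simp: T(1) DERIV_isCont[OF gauss_cdf_deriv])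
  qed (use gauss_cdf_pos gauss_cdf_strict_mono T(2) in auto)
  have \<tau>: "gauss_cdf (\<tau> x) = 2 * s * (1 - x)" if "1/2 \<le> x" "x < 1" for x
  proof (cases "x = 1/2")
    case True
    have e: "2 * s * (1 - x) = gauss_cdf t0" unfolding True s_def by simp
    show ?thesis unfolding \<tau>_def e by (simp add: T(1))
  next
    case False
    have "2 * s * (1 - x) < s * 1" using that False s by (simp add: field_simps)
    with that s show ?thesis unfolding \<tau>_def by (subst T(2)[of _ t0, THEN conjunct1]) (auto simp: s_def)
  qed
  have f_pos: "f x > 0" for x
    unfolding f_def using s normal_density_pos[of 1 0] by simp
  have d\<tau>: "(\<tau> has_real_derivative - 2 * s / std_normal_density (\<tau> x)) (at x)"
    if "1/2 \<le> x" "x < 1" for x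
  proof -
    have "(T has_real_derivative inverse (std_normal_density (\<tau> x))) (at (2 * s * (1 - x)))"
      using dT[of "\<tau> x"] by (simp only: \<tau>[OF that])
    then have "((\<lambda>x. T (2 * s * (1 - x))) has_real_derivative
        inverse (std_normal_density (\<tau> x)) * (- 2 * s)) (at x)"
      by (rule DERIV_chain2) (auto intro!: derivative_eq_intros)
    then show ?thesis unfolding \<tau>_def[abs_def] by (simp add: divide_inverse mult.commute)
  qed
  have df: "(f has_real_derivative sqrt 2 * \<tau> x) (at x)" if "1/2 \<le> x" "x < 1" for x
  proof -
    have pos: "std_normal_density (\<tau> x) > 0" using normal_density_pos[of 1 0] by simp
    have "(f has_real_derivative
        (- \<tau> x * std_normal_density (\<tau> x)) * (- 2 * s / std_normal_density (\<tau> x)) / (sqrt 2 * s)) (at x)"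
      unfolding f_def[abs_def]
      by (intro DERIV_cdivide DERIV_chain2[OF std_normal_density_deriv] d\<tau> that)
    also have "(- \<tau> x * std_normal_density (\<tau> x)) * (- 2 * s / std_normal_density (\<tau> x)) / (sqrt 2 * s)
        = (sqrt 2 * sqrt 2) * \<tau> x / sqrt 2"
      using pos s by (simp add: field_simps)
    also have "\<dots> = sqrt 2 * \<tau> x" by (simp del: real_sqrt_mult_self)
    finally show ?thesis .
  qed
  have dg: "((\<lambda>x. sqrt 2 * \<tau> x) has_real_derivative - 2 / f x) (at x)" if "1/2 \<le> x" "x < 1" for x
    using DERIV_cmult[OF d\<tau>[OF that], of "sqrt 2"] by (simp add: f_def mult_ac)
  have Jf: "J x = f x" if "1/2 \<le> x" "x < 1" for x using that by (simp add: J_def)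
  let ?U = "{1/2<..<1::real}"
  have dJ: "(J has_real_derivative sqrt 2 * \<tau> x) (at x)" if "x \<in> ?U" for x
    by (rule has_field_derivative_transform_within_open[OF df, of _ ?U]) (use that in \<open>auto simp: Jf\<close>)
  have dg': "((\<lambda>x. sqrt 2 * \<tau> x) has_real_derivative - 2 / J x) (at x)" if "x \<in> ?U" for x
    using dg[of x] that by (simp add: Jf)
  have "is_profile J"
    unfolding is_profile_def
  proof (intro conjI allI ballI)
    show "J \<in> {1/2..1} \<rightarrow>\<^sub>E {0..}"
      using f_pos by (auto simp: J_def less_imp_le)
    show "J (1/2) = 1/2"
    proof -
      have "T s = t0" by (simp add: s_def T(1))
      then have "J (1/2) = std_normal_density t0 / (sqrt 2 * s)" by (simp add: Jf f_def \<tau>_def)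
      also have "\<dots> = 1/2" unfolding t0 s_def[symmetric] using s by (simp add: field_simps)
      finally show ?thesis .
    qed
    show "J 1 = 0" by (simp add: J_def)
    show "(deriv ^^ k) J differentiable (at x)" if "x \<in> ?U" for k x
      using ode_smooth[of ?U J "\<lambda>x. sqrt 2 * \<tau> x" x k] dJ dg' f_pos that
      by (force simp: Jf less_imp_neq[symmetric])
    show "(deriv ^^ 2) J x * J x = - 2" if x: "x \<in> ?U" for x
    proof -
      have "(deriv J has_real_derivative - 2 / J x) (at x)"
        by (rule has_field_derivative_transform_within_open[OF dg'[OF x] _ x])
           (auto simp: DERIV_imp_deriv[OF dJ])
      then have "deriv (deriv J) x = - 2 / J x" by (rule DERIV_imp_deriv)
      moreover have "J x \<noteq> 0" using f_pos[of x] x by (simp add: Jf)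
      ultimately show ?thesis by (simp add: numeral_2_eq_2)
    qed
    show "continuous_on {1/2..1} J"
      unfolding continuous_on_eq_continuous_within
    proof
      fix x :: real assume x: "x \<in> {1/2..1}"
      show "continuous (at x within {1/2..1}) J"
      proof (cases "x = 1")
        case False
        with x have x': "1/2 \<le> x" "x < 1" by auto
        have "(f \<longlongrightarrow> f x) (at x within {1/2..1})"
          using DERIV_isCont[OF df[OF x']] by (auto simp: isCont_def intro: tendsto_within_subset)
        moreover have "\<forall>\<^sub>F y in at x within {1/2..1}. y < 1"
          using x' by (intro order_tendstoD(2)[of "\<lambda>y. y"]) auto
        then have "\<forall>\<^sub>F y in at x within {1/2..1}. f y = J y"
          unfolding eventually_at_filter by (rule eventually_mono) (auto simp: Jf)
        ultimately have "(J \<longlongrightarrow> f x) (at x within {1/2..1})"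
          by (rule Lim_transform_eventually)
        then show ?thesis by (simp add: continuous_within Jf[OF x'])
      next
        case True
        have "(J \<longlongrightarrow> 0) (at 1 within {1/2..1})"
        proof (rule tendstoI)
          fix e :: real assume "e > 0"
          then have "\<forall>\<^sub>F t in at_bot. std_normal_density t < e * (sqrt 2 * s)"
            using s by (intro order_tendstoD(2)[OF std_normal_density_at_bot]) auto
          then obtain b where b: "\<And>t. t \<le> b \<Longrightarrow> std_normal_density t < e * (sqrt 2 * s)"
            by (auto simp: eventually_at_bot_linorder)
          have "((\<lambda>y. 2 * s * (1 - y)) \<longlongrightarrow> 2 * s * (1 - 1)) (at 1 within {1/2..1})"
            by (intro tendsto_intros)
          then have "\<forall>\<^sub>F y in at 1 within {1/2..1}. 2 * s * (1 - y) < gauss_cdf b"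
            by (rule order_tendstoD(2)) (simp add: gauss_cdf_pos)
          moreover have "\<forall>\<^sub>F y in at 1 within {1/2..1::real}. y \<in> {1/2..1} \<and> y \<noteq> 1"
            by (simp add: eventually_at_filter)
          ultimately show "\<forall>\<^sub>F y in at 1 within {1/2..1}. dist (J y) 0 < e"
          proof eventually_elim
            case (elim y)
            then have y: "1/2 \<le> y" "y < 1" by auto
            have "\<tau> y < b" unfolding \<tau>_def using y elim s by (intro T(2)[THEN conjunct2]) auto
            then have "f y < e" unfolding f_def using b[of "\<tau> y"] s by (simp add: divide_less_eq)
            then show ?case using f_pos[of y] by (simp add: Jf[OF y])
          qed
        qed
        then show ?thesis using True by (simp add: continuous_within J_def)
      qed
    qed
  qed
  then show ?thesis by (rule exI[of is_profile])
qed

lemma is_profile_ex1: "\<exists>!J. is_profile J"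
  using is_profile_exists is_profile_unique by blast

lemma is_profile_profile_J: "is_profile profile_J"
  unfolding profile_J_def using is_profile_ex1 by (rule theI')

end

theory Submission
  imports Defs
begin

text \<open>The proof is an induction on the dimension with a Bellman function \<open>B\<close> on \<open>[0, 1]\<close>. Cut the cube
along a coordinate into halves in which \<open>A\<close> has densities \<open>x \<le> y\<close>. The denser half contains
vertices of \<open>A\<close> of mass at least \<open>y - x\<close> whose neighbour across the cut is missing; their boundary
degree grows by one. Minkowski's inequality for the \<open>p\<close>-norm, \<open>p = 1 / \<beta>\<close>, and the integrality of
the degree give two lower bounds for the effect of this, and the induction closes as soon as
\<open>2 B ((x + y) / 2) \<le> B x + max (pnorm p (B y) (y - x)) (y - x + (2 powr \<beta> - 1) * B y)\<close>
(\<open>two_point\<close>, \<open>boundary_mean_ge_two_point\<close>).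

On \<open>[1/2, 1]\<close> the function \<open>B\<close> is \<open>J\<close>, on \<open>[0, 1/2]\<close> it is the parabola \<open>9/5 * x - 8/5 * x\<^sup>2\<close>. The
parabola is free to choose: it has to vanish at \<open>0\<close>, equal \<open>1/2\<close> at \<open>1/2\<close>, have a slope below
\<open>J' (1/2)\<close> there (so that the corner is convex) and be curved so little that \<open>B'' * B\<close> stays well
above \<open>-2\<close>. All computations use the rescaling \<open>prof w = 2 * J ((1 + w) / 2)\<close>, for which still
\<open>prof'' * prof = -2\<close>.

For \<open>\<beta> = 1/2\<close> the infinitesimal form of the two-point inequality is exactly \<open>J'' * J \<ge> -2\<close>. Where
\<open>J\<close> decreases, this is also enough globally: the defect increases with \<open>y\<close>
as soon as \<open>J' \<le> 0\<close> at the midpoint (\<open>sqrt_gap_mono\<close>). On the short interval where \<open>J\<close> increases,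
the inequality with exponent \<open>1/2\<close> fails by terms of third order, and there the surplus of
\<open>pnorm p\<close>, \<open>p < 2\<close>, over the Euclidean norm is needed (\<open>rescaled_near\<close>). There the value
\<open>0.50057\<close> leaves a relative margin below \<open>1 / 10000\<close>, which forces a Taylor expansion
of order six and the slope \<open>J' (1/2)\<close> up to \<open>2 / 10000\<close> (\<open>slope_le\<close>, \<open>slope_near_0\<close>). The slope comes
from the conserved energy \<open>prof * exp (prof'\<^sup>2 / 4)\<close>, which makes the Gaussian distribution function
of \<open>prof' / sqrt 2\<close> an affine function (\<open>gauss_cdf_slope\<close>). When one of the points lies on the parabola there
is room to spare, and the inequality reduces to polynomial estimates (\<open>two_point_arch\<close>).

The second bound \<open>(1 - x) * (log 2 (1 / (1 - x))) powr \<beta>\<close> exceeds \<open>J\<close> only for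
astronomically small \<open>1 - x\<close>, since \<open>J\<close> behaves like \<open>2 * (1 - x) * sqrt (ln (1 / (1 - x)))\<close>. It
satisfies a two-point inequality of its own for small \<open>1 - x\<close> (\<open>subcube_prof_two_point\<close>) and lies below
\<open>J\<close> for all other \<open>x \<ge> 1/2\<close> by the maximum principle (\<open>subcube_prof_le_prof\<close>). Hence the maximum of
the two functions is again a Bellman function (\<open>two_point_bellman\<close>).\<close>

section \<open>Two-dimensional p-norms\<close>

definition pnorm :: "real \<Rightarrow> real \<Rightarrow> real \<Rightarrow> real" where
  "pnorm p a b = (a powr p + b powr p) powr (1 / p)"

lemma powr_convex_nonneg:
  fixes p x y l :: real
  assumes "p \<ge> 1" "x \<ge> 0" "y \<ge> 0" "0 \<le> l" "l \<le> 1"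
  shows "(l * x + (1 - l) * y) powr p \<le> l * x powr p + (1 - l) * y powr p"
proof (cases "x = 0 \<or> y = 0")
  case True
  have "l powr p \<le> l" "(1 - l) powr p \<le> 1 - l"
    using assms powr_mono'[of 1 p l] powr_mono'[of 1 p "1 - l"] by auto
  with True assms show ?thesis
    by (auto simp: powr_mult intro!: mult_right_mono)
next
  case False
  with assms have "x > 0" "y > 0" by auto
  then show ?thesis
    using convex_onD[OF powr_convex[OF assms(1)], of "1 - l" x y] assms by simp
qed

lemma pnorm_nonneg: "pnorm p a b \<ge> 0"
  by (simp add: pnorm_def)

lemma pnorm_powr:
  assumes "p > 0"
  shows "pnorm p a b powr p = a powr p + b powr p"
  using assms by (simp add: pnorm_def powr_powr)

lemma pnorm_0_right: "p > 0 \<Longrightarrow> a \<ge> 0 \<Longrightarrow> pnorm p a 0 = a"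
  by (simp add: pnorm_def powr_powr)

lemma pnorm_0_left: "p > 0 \<Longrightarrow> b \<ge> 0 \<Longrightarrow> pnorm p 0 b = b"
  by (simp add: pnorm_def powr_powr)

lemma pnorm_mono:
  assumes "p > 0" "0 \<le> a" "a \<le> a'" "0 \<le> b" "b \<le> b'"
  shows "pnorm p a b \<le> pnorm p a' b'"
  unfolding pnorm_def using assms by (intro powr_mono2 add_mono) auto

lemma pnorm_scale:
  assumes "p > 0" "c \<ge> 0" "a \<ge> 0" "b \<ge> 0"
  shows "pnorm p (c * a) (c * b) = c * pnorm p a b"
proof -
  have "(c * a) powr p + (c * b) powr p = c powr p * (a powr p + b powr p)"
    using assms by (simp add: powr_mult distrib_left)
  then show ?thesis
    using assms by (simp add: pnorm_def powr_mult powr_powr)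
qed

text \<open>Minkowski's inequality in the plane, by convexity of \<open>x powr p\<close> applied to the two vectors scaled
to unit norm.\<close>

lemma pnorm_triangle:
  assumes p: "p \<ge> 1" and nn: "0 \<le> a" "0 \<le> b" "0 \<le> c" "0 \<le> d"
  shows "pnorm p (a + c) (b + d) \<le> pnorm p a b + pnorm p c d"
proof (cases "pnorm p a b = 0 \<or> pnorm p c d = 0")
  case True
  have z: "x = 0 \<and> y = 0" if "pnorm p x y = 0" for x y
  proof -
    have "x powr p + y powr p = 0" using that by (simp add: pnorm_def)
    moreover have "x powr p \<ge> 0" "y powr p \<ge> 0" by auto
    ultimately have "x powr p = 0" "y powr p = 0" by linarith+
    then show ?thesis by simp
  qed
  from True show ?thesis
  proof
    assume "pnorm p a b = 0"
    with z[of a b] show ?thesis by simp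
  next
    assume "pnorm p c d = 0"
    with z[of c d] show ?thesis by simp
  qed
next
  case False
  define A C where "A = pnorm p a b" and "C = pnorm p c d"
  have pos: "A > 0" "C > 0" using False pnorm_nonneg[of p] by (auto simp: A_def C_def less_le)
  define l where "l = A / (A + C)"
  have l: "0 \<le> l" "l \<le> 1" "1 - l = C / (A + C)" using pos by (auto simp: l_def field_simps)
  have conv: "((x + y) / (A + C)) powr p \<le> l * (x / A) powr p + (1 - l) * (y / C) powr p"
    if "x \<ge> 0" "y \<ge> 0" for x y
  proof -
    have "(x + y) / (A + C) = l * (x / A) + (1 - l) * (y / C)"
      using pos unfolding l(3) unfolding l_def by (simp add: add_divide_distrib)
    then show ?thesis using powr_convex_nonneg[OF p, of "x / A" "y / C" l] that pos l by simp
  qed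
  have one: "(x / X) powr p + (y / X) powr p = 1"
    if "X = pnorm p x y" "X > 0" "x \<ge> 0" "y \<ge> 0" for x y X
  proof -
    have "X powr p = x powr p + y powr p" unfolding that(1) by (rule pnorm_powr) (use p in auto)
    moreover have "X powr p > 0" using that by auto
    ultimately show ?thesis using that
      by (simp add: powr_divide add_divide_distrib[symmetric])
  qed
  have "((a + c) / (A + C)) powr p + ((b + d) / (A + C)) powr p
      \<le> l * ((a / A) powr p + (b / A) powr p) + (1 - l) * ((c / C) powr p + (d / C) powr p)"
    using conv[of a c] conv[of b d] nn by (simp add: distrib_left)
  also have "\<dots> = 1"
    using one[OF A_def pos(1)] one[OF C_def pos(2)] nn by simp
  finally have *: "pnorm p ((a + c) / (A + C)) ((b + d) / (A + C)) \<le> 1"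
    unfolding pnorm_def using p by (intro powr_le1) auto
  have "pnorm p (a + c) (b + d) = (A + C) * pnorm p ((a + c) / (A + C)) ((b + d) / (A + C))"
    using pnorm_scale[of p "A + C" "(a + c) / (A + C)" "(b + d) / (A + C)"] pos nn p by simp
  also have "\<dots> \<le> (A + C) * 1" using * pos by (intro mult_left_mono) auto
  finally show ?thesis by (simp add: A_def C_def)
qed

lemma pnorm_sum_le:
  assumes "p \<ge> 1" "finite X" "\<And>x. x \<in> X \<Longrightarrow> u x \<ge> 0" "\<And>x. x \<in> X \<Longrightarrow> v x \<ge> 0"
  shows "pnorm p (sum u X) (sum v X) \<le> (\<Sum>x\<in>X. pnorm p (u x) (v x))"
  using assms(2-)
proof (induction X rule: finite_induct)
  case empty
  then show ?case by (simp add: pnorm_def)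
next
  case (insert x X)
  have "pnorm p (u x + sum u X) (v x + sum v X) \<le> pnorm p (u x) (v x) + pnorm p (sum u X) (sum v X)"
    using insert by (intro pnorm_triangle assms(1) sum_nonneg) auto
  with insert show ?case by simp
qed

text \<open>The function \<open>pnorm p u 1\<close> is convex in \<open>u\<close>, so beyond \<open>u = 1\<close> it lies above the line through its
values at \<open>0\<close> and \<open>1\<close>. With \<open>u = h powr \<beta>\<close> for a positive integer \<open>h\<close> the norm is \<open>(h + 1) powr \<beta>\<close>.\<close>

lemma pnorm_ge_chord:
  assumes "p \<ge> 1" "u \<ge> 1"
  shows "1 + (2 powr (1 / p) - 1) * u \<le> pnorm p u 1"
proof -
  have "pnorm p 1 1 = pnorm p (1 / u * u + 0) (1 / u * 1 + (1 - 1 / u))" using assms by simp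
  also have "\<dots> \<le> pnorm p (1 / u * u) (1 / u * 1) + pnorm p 0 (1 - 1 / u)"
    using assms by (intro pnorm_triangle) auto
  also have "\<dots> = 1 / u * pnorm p u 1 + (1 - 1 / u)"
    using assms by (subst pnorm_scale) (auto simp: pnorm_0_left)
  finally have "u * 2 powr (1 / p) \<le> u * (1 / u * pnorm p u 1 + (1 - 1 / u))"
    using assms by (intro mult_left_mono) (auto simp: pnorm_def)
  also have "\<dots> = pnorm p u 1 + u - 1" using assms by (simp add: field_simps)
  finally show ?thesis by (simp add: algebra_simps)
qed

section \<open>Induction over the dimension of the cube\<close>

lemma finite_cube: "finite (cube n)"
  using finite_lists_length_eq[of "UNIV :: bool set" n] by (simp add: cube_def)

lemma card_cube: "card (cube n) = 2 ^ n"
  using card_lists_length_eq[of "UNIV :: bool set" n] by (simp add: cube_def)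

lemma cube_Suc: "cube (Suc n) = (#) b ` cube n \<union> (#) (\<not> b) ` cube n"
  by (force simp: cube_def length_Suc_conv image_iff)

lemma cube_mean_Suc:
  "cube_mean (Suc n) f = (cube_mean n (\<lambda>x. f (b # x)) + cube_mean n (\<lambda>x. f ((\<not> b) # x))) / 2"
proof -
  have "(\<Sum>x\<in>cube (Suc n). f x) = (\<Sum>x\<in>(#) b ` cube n. f x) + (\<Sum>x\<in>(#) (\<not> b) ` cube n. f x)"
    unfolding cube_Suc[of n b] by (intro sum.union_disjoint) (auto simp: finite_cube)
  then show ?thesis
    by (simp add: cube_mean_def sum.reindex o_def add_divide_distrib)
qed

definition half :: "bool \<Rightarrow> bool list set \<Rightarrow> bool list set" where
  "half b A = {x. b # x \<in> A}"

lemma half_subset: "A \<subseteq> cube (Suc n) \<Longrightarrow> half b A \<subseteq> cube n"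
  by (auto simp: half_def cube_def)

lemma cube_density_nonneg: "cube_density n A \<ge> 0"
  by (auto simp: cube_density_def cube_mean_def intro!: divide_nonneg_nonneg sum_nonneg)

lemma cube_density_le_1: "cube_density n A \<le> 1"
proof -
  have "(\<Sum>x\<in>cube n. indicator A x) \<le> (\<Sum>x\<in>cube n. 1::real)"
    by (intro sum_mono) (auto simp: indicator_def)
  then show ?thesis by (simp add: cube_density_def cube_mean_def card_cube divide_le_eq)
qed

lemma cube_density_Suc:
  "cube_density (Suc n) A = (cube_density n (half b A) + cube_density n (half (\<not> b) A)) / 2"
proof -
  have "indicator A (c # x) = (indicator (half c A) x :: real)" for c x by (simp add: half_def indicator_def)
  then show ?thesis unfolding cube_density_def by (subst cube_mean_Suc[of n _ b]) simp
qed

lemma cube_adj_Cons: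
  "cube_adj (Suc n) (b # x) (c # y) \<longleftrightarrow>
     (if b = c then cube_adj n x y else x \<in> cube n \<and> y = x)"
proof -
  have e: "{i. i < Suc n \<and> (b # x) ! i \<noteq> (c # y) ! i} =
      (if b = c then {} else {0}) \<union> Suc ` {i. i < n \<and> x ! i \<noteq> y ! i}"
    by (auto simp: nth_Cons' image_iff) (metis Suc_less_eq Suc_pred not_gr0)+
  have "card {i. i < Suc n \<and> (b # x) ! i \<noteq> (c # y) ! i} =
      (if b = c then 0 else 1) + card {i. i < n \<and> x ! i \<noteq> y ! i}"
    unfolding e by (subst card_Un_disjoint) (auto simp: card_image)
  moreover have "{i. i < n \<and> x ! i \<noteq> y ! i} = {} \<longleftrightarrow> x = y" if "length x = n" "length y = n"
    using that by (auto intro: nth_equalityI)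
  ultimately show ?thesis by (auto simp: cube_adj_def cube_def)
qed

text \<open>A vertex has one neighbour across the cut; all others lie in its own half.\<close>

lemma boundary_deg_Cons:
  assumes x: "x \<in> half b A" and A: "A \<subseteq> cube (Suc n)"
  shows "boundary_deg (Suc n) A (b # x) =
    boundary_deg n (half b A) x + (if x \<in> half (\<not> b) A then 0 else 1)"
proof -
  have xc: "x \<in> cube n" using half_subset[OF A] x by auto
  have e: "{y \<in> cube (Suc n) - A. cube_adj (Suc n) (b # x) y} =
      (#) b ` {y \<in> cube n - half b A. cube_adj n x y} \<union> (if x \<in> half (\<not> b) A then {} else {(\<not> b) # x})"
    using xc by (auto simp: cube_Suc[of n b] cube_adj_Cons half_def)
  have "card {y \<in> cube (Suc n) - A. cube_adj (Suc n) (b # x) y} =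
      card {y \<in> cube n - half b A. cube_adj n x y} + (if x \<in> half (\<not> b) A then 0 else 1)"
    unfolding e by (subst card_Un_disjoint) (auto simp: card_image finite_cube)
  with x show ?thesis by (simp add: boundary_deg_def half_def)
qed

definition boundary_mean :: "real \<Rightarrow> nat \<Rightarrow> bool list set \<Rightarrow> real" where
  "boundary_mean \<beta> n A = cube_mean n (\<lambda>x. real (boundary_deg n A x) powr \<beta>)"

lemma boundary_mean_nonneg: "boundary_mean \<beta> n A \<ge> 0"
  by (auto simp: boundary_mean_def cube_mean_def intro!: divide_nonneg_nonneg sum_nonneg)

lemma cube_mean_mono: "(\<And>x. x \<in> cube n \<Longrightarrow> f x \<le> g x) \<Longrightarrow> cube_mean n f \<le> cube_mean n g"
  unfolding cube_mean_def by (intro divide_right_mono sum_mono) auto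

lemma cube_mean_lin:
  "cube_mean n (\<lambda>x. a * f x + b * g x) = a * cube_mean n f + b * cube_mean n g"
  by (simp add: cube_mean_def sum.distrib sum_distrib_left add_divide_distrib)

lemma pnorm_cube_mean_le:
  assumes "p \<ge> 1" "\<And>x. u x \<ge> 0" "\<And>x. v x \<ge> 0"
  shows "pnorm p (cube_mean n u) (cube_mean n v) \<le> cube_mean n (\<lambda>x. pnorm p (u x) (v x))"
proof -
  have "pnorm p (cube_mean n u) (cube_mean n v) = 
      pnorm p (1 / 2 ^ n * sum u (cube n)) (1 / 2 ^ n * sum v (cube n))"
    by (simp add: cube_mean_def)
  also have "\<dots> = 1 / 2 ^ n * pnorm p (sum u (cube n)) (sum v (cube n))"
    using assms by (intro pnorm_scale) (auto intro!: sum_nonneg)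
  also have "\<dots> \<le> 1 / 2 ^ n * (\<Sum>x\<in>cube n. pnorm p (u x) (v x))"
    using assms by (intro mult_left_mono pnorm_sum_le finite_cube) auto
  finally show ?thesis by (simp add: cube_mean_def)
qed

lemma cube_density_diff:
  "cube_density n A - cube_density n C \<le> cube_density n (A - C)"
proof -
  have "cube_density n A \<le> cube_mean n (\<lambda>x. 1 * indicator C x + 1 * indicator (A - C) x)"
    unfolding cube_density_def by (intro cube_mean_mono) (auto simp: indicator_def)
  then show ?thesis unfolding cube_mean_lin by (simp add: cube_density_def)
qed

text \<open>The two arguments of \<open>max\<close> stem from the triangle inequality, which is sharp when the boundary
degrees are spread evenly, and from the chord, which is sharp when they take the values
\<open>0\<close> and \<open>1\<close> only.\<close>

definition two_point :: "real \<Rightarrow> (real \<Rightarrow> real) \<Rightarrow> real \<Rightarrow> real \<Rightarrow> bool" where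
  "two_point \<beta> B x y \<longleftrightarrow> 2 * B ((x + y) / 2) \<le>
     B x + max (pnorm (1 / \<beta>) (B y) (y - x)) (y - x + (2 powr \<beta> - 1) * B y)"

text \<open>In the denser half the summand \<open>h powr \<beta>\<close> becomes \<open>pnorm (1 / \<beta>) (h powr \<beta>) 1\<close> on the vertices
whose partner is missing and stays the same elsewhere; in the other half it can only grow.\<close>

lemma boundary_mean_Suc_ge:
  assumes \<beta>: "0 < \<beta>" "\<beta> \<le> 1" and A: "A \<subseteq> cube (Suc n)"
    and le: "cube_density n (half (\<not> b) A) \<le> cube_density n (half b A)"
  shows "2 * boundary_mean \<beta> (Suc n) A \<ge> boundary_mean \<beta> n (half (\<not> b) A) +
    max (pnorm (1 / \<beta>) (boundary_mean \<beta> n (half b A)) (cube_density n (half b A) - cube_density n (half (\<not> b) A)))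
        (cube_density n (half b A) - cube_density n (half (\<not> b) A) + (2 powr \<beta> - 1) * boundary_mean \<beta> n (half b A))"
proof -
  let ?U = "half b A" and ?V = "half (\<not> b) A"
  let ?D = "?U - ?V"
  let ?h = "\<lambda>x. real (boundary_deg n ?U x) powr \<beta>"
  let ?f = "\<lambda>x. real (boundary_deg (Suc n) A x) powr \<beta>"
  have p: "1 / \<beta> \<ge> 1" using \<beta> by simp
  have b2: "2 powr \<beta> \<le> 2" "2 powr \<beta> \<ge> 1"
    using powr_mono[of \<beta> 1 2] \<beta> by (auto simp: ge_one_powr_ge_zero)
  have step: "?f (b # x) = pnorm (1 / \<beta>) (?h x) (indicator ?D x)" for x
  proof (cases "x \<in> ?U")
    case True
    with boundary_deg_Cons[OF True A] \<beta> show ?thesis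
      by (auto simp: pnorm_def powr_powr indicator_def add.commute)
  next
    case False
    then show ?thesis using \<beta> by (simp add: boundary_deg_def half_def pnorm_def)
  qed
  have V: "boundary_mean \<beta> n ?V \<le> cube_mean n (\<lambda>x. ?f ((\<not> b) # x))"
    unfolding boundary_mean_def
  proof (rule cube_mean_mono)
    fix x
    show "real (boundary_deg n ?V x) powr \<beta> \<le> ?f ((\<not> b) # x)"
      using boundary_deg_Cons[of x "\<not> b" A n] A \<beta>
      by (cases "x \<in> ?V") (auto intro!: powr_mono2 simp: boundary_deg_def)
  qed
  have d: "cube_density n ?U - cube_density n ?V \<le> cube_mean n (indicator ?D)"
    using cube_density_diff[of n ?U ?V] by (simp add: cube_density_def)
  have 1: "pnorm (1 / \<beta>) (boundary_mean \<beta> n ?U) (cube_density n ?U - cube_density n ?V)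
      \<le> cube_mean n (\<lambda>x. ?f (b # x))"
  proof -
    have "pnorm (1 / \<beta>) (boundary_mean \<beta> n ?U) (cube_density n ?U - cube_density n ?V)
        \<le> pnorm (1 / \<beta>) (cube_mean n ?h) (cube_mean n (indicator ?D))"
      using d le \<beta> boundary_mean_nonneg[of \<beta> n ?U] by (intro pnorm_mono) (auto simp: boundary_mean_def)
    also have "\<dots> \<le> cube_mean n (\<lambda>x. pnorm (1 / \<beta>) (?h x) (indicator ?D x))"
      by (intro pnorm_cube_mean_le p) auto
    finally show ?thesis by (simp add: step)
  qed
  have 2: "cube_density n ?U - cube_density n ?V + (2 powr \<beta> - 1) * boundary_mean \<beta> n ?U
      \<le> cube_mean n (\<lambda>x. ?f (b # x))"
  proof -
    have "1 * cube_mean n (indicator ?D) + (2 powr \<beta> - 1) * boundary_mean \<beta> n ?U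
        \<le> cube_mean n (\<lambda>x. ?f (b # x))"
      unfolding boundary_mean_def cube_mean_lin[symmetric]
    proof (rule cube_mean_mono)
      fix x
      have "?h x = 0 \<or> ?h x \<ge> 1" using \<beta> by (cases "boundary_deg n ?U x") (auto simp: ge_one_powr_ge_zero)
      moreover have "(2 powr \<beta> - 1) * ?h x \<le> 1 * ?h x" using b2 by (intro mult_right_mono) auto
      ultimately show "1 * indicator ?D x + (2 powr \<beta> - 1) * ?h x \<le> ?f (b # x)"
        unfolding step using pnorm_ge_chord[OF p, of "?h x"] pnorm_0_left[of "1 / \<beta>" 1] \<beta>
        by (auto simp: indicator_def pnorm_0_right simp del: powr_eq_0_iff)
    qed
    with d show ?thesis by simp
  qed
  have "2 * boundary_mean \<beta> (Suc n) A = cube_mean n (\<lambda>x. ?f (b # x)) + cube_mean n (\<lambda>x. ?f ((\<not> b) # x))"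
    unfolding boundary_mean_def by (subst cube_mean_Suc[of n _ b]) simp
  with V 1 2 show ?thesis by simp
qed

theorem boundary_mean_ge_two_point:
  assumes \<beta>: "0 < \<beta>" "\<beta> \<le> 1"
    and B: "B 0 = 0" "B 1 = 0" "\<And>x. 0 \<le> x \<Longrightarrow> x \<le> 1 \<Longrightarrow> B x \<ge> 0"
    and tp: "\<And>x y. 0 \<le> x \<Longrightarrow> x \<le> y \<Longrightarrow> y \<le> 1 \<Longrightarrow> two_point \<beta> B x y"
    and A: "A \<subseteq> cube n"
  shows "B (cube_density n A) \<le> boundary_mean \<beta> n A"
  using A
proof (induction n arbitrary: A)
  case 0
  then have "cube_density 0 A = 0 \<or> cube_density 0 A = 1"
    by (auto simp: cube_density_def cube_mean_def cube_def indicator_def)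
  with B boundary_mean_nonneg[of \<beta> 0 A] show ?case by auto
next
  case (Suc n)
  obtain b where le: "cube_density n (half (\<not> b) A) \<le> cube_density n (half b A)"
  proof (cases "cube_density n (half False A) \<le> cube_density n (half True A)")
    case True
    then show thesis using that[of True] by simp
  next
    case False
    then show thesis using that[of False] by simp
  qed
  define x y where "x = cube_density n (half (\<not> b) A)" and "y = cube_density n (half b A)"
  have xy: "0 \<le> x" "x \<le> y" "y \<le> 1" using le by (auto simp: x_def y_def cube_density_nonneg cube_density_le_1)
  have ih: "B x \<le> boundary_mean \<beta> n (half (\<not> b) A)" "B y \<le> boundary_mean \<beta> n (half b A)"
    using Suc half_subset by (auto simp: x_def y_def)
  have "2 powr \<beta> \<ge> 1" using \<beta> by (auto simp: ge_one_powr_ge_zero)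
  have "2 * B (cube_density (Suc n) A) = 2 * B ((x + y) / 2)"
    by (subst cube_density_Suc[of n A b]) (simp add: x_def y_def add.commute)
  also have "\<dots> \<le> B x + max (pnorm (1 / \<beta>) (B y) (y - x)) (y - x + (2 powr \<beta> - 1) * B y)"
    using tp[OF xy] by (simp add: two_point_def)
  also have "\<dots> \<le> boundary_mean \<beta> n (half (\<not> b) A) + max (pnorm (1 / \<beta>) (boundary_mean \<beta> n (half b A)) (y - x))
      (y - x + (2 powr \<beta> - 1) * boundary_mean \<beta> n (half b A))"
    using ih B(3)[of y] xy \<beta> \<open>2 powr \<beta> \<ge> 1\<close>
    by (intro add_mono max.mono pnorm_mono mult_left_mono) auto
  also have "\<dots> \<le> 2 * boundary_mean \<beta> (Suc n) A"
    using boundary_mean_Suc_ge[OF \<beta> Suc.prems le] by (simp add: x_def y_def)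
  finally show ?case by simp
qed

section \<open>The rescaled profile, its energy and its slope\<close>

lemma increment_le:
  fixes f h :: "real \<Rightarrow> real"
  assumes "a \<le> b" "continuous_on {a..b} f" "continuous_on {a..b} h"
    and "\<And>x. a < x \<Longrightarrow> x < b \<Longrightarrow> (f has_real_derivative f' x) (at x)"
    and "\<And>x. a < x \<Longrightarrow> x < b \<Longrightarrow> (h has_real_derivative h' x) (at x)"
    and "\<And>x. a < x \<Longrightarrow> x < b \<Longrightarrow> f' x \<le> h' x"
  shows "f b - f a \<le> h b - h a"
proof -
  have "(\<lambda>x. h x - f x) a \<le> (\<lambda>x. h x - f x) b"
  proof (rule DERIV_nonneg_imp_increasing_open[OF assms(1)])
    show "\<exists>y. ((\<lambda>x. h x - f x) has_real_derivative y) (at x) \<and> y \<ge> 0" if "a < x" "x < b" for x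
      using assms(4-6)[OF that] by (intro exI[of _ "h' x - f' x"]) (auto intro: DERIV_diff)
  qed (intro continuous_on_diff assms)
  then show ?thesis by simp
qed

text \<open>The affine change of variables maps \<open>[1/2, 1]\<close> to \<open>[0, 1]\<close> and normalizes the left value to
\<open>1\<close>; the equation \<open>f'' * f = -2\<close> is invariant under it.\<close>

definition prof :: "real \<Rightarrow> real" where
  "prof w = 2 * profile_J ((1 + w) / 2)"

text \<open>This is the derivative of \<open>prof\<close> on \<open>(0, 1)\<close>. Nothing is claimed at \<open>0\<close>, where only continuity of
\<open>J\<close> is given, so statements about the initial slope are made in the limit.\<close>

definition slope :: "real \<Rightarrow> real" where
  "slope w = deriv profile_J ((1 + w) / 2)"

lemma profile_J_half: "profile_J (1/2) = 1/2" and profile_J_1: "profile_J 1 = 0"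
  using is_profile_profile_J by (auto simp: is_profile_def)

lemma prof_0 [simp]: "prof 0 = 1" and prof_1 [simp]: "prof 1 = 0"
  by (simp_all add: prof_def profile_J_half profile_J_1)

lemma prof_nonneg: "0 \<le> w \<Longrightarrow> w \<le> 1 \<Longrightarrow> prof w \<ge> 0"
  using is_profile_profile_J unfolding is_profile_def prof_def
  by (auto simp: PiE_iff)

lemma prof_pos:
  assumes "0 \<le> w" "w < 1" shows "prof w > 0"
proof (cases "w = 0")
  case False
  then show ?thesis
    unfolding prof_def using assms is_profile_derivs(1)[OF is_profile_profile_J, of "(1 + w) / 2"]
    by simp
qed simp

lemma prof_cont: "continuous_on {0..1} prof"
  unfolding prof_def[abs_def]
proof (rule continuous_on_mult_left, rule continuous_on_compose2[of "{1/2..1}" profile_J _ "\<lambda>w. (1 + w) / 2"])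
  show "continuous_on {1/2..1} profile_J" using is_profile_profile_J by (simp add: is_profile_def)
  show "continuous_on {0..1} (\<lambda>w::real. (1 + w) / 2)" by (intro continuous_intros) auto
qed auto

lemma prof_deriv:
  assumes "0 < w" "w < 1" shows "(prof has_real_derivative slope w) (at w)"
proof -
  have "((\<lambda>w. (1 + w) / 2) has_real_derivative 1 / 2) (at w)"
    by (auto intro!: derivative_eq_intros)
  then have "((\<lambda>w. 2 * profile_J ((1 + w) / 2)) has_real_derivative 2 * (slope w * (1 / 2))) (at w)"
    unfolding slope_def using assms
    by (intro DERIV_cmult DERIV_chain2[of profile_J] is_profile_derivs(2)[OF is_profile_profile_J]) auto
  then show ?thesis by (simp add: prof_def[abs_def])
qed

lemma slope_deriv:
  assumes "0 < w" "w < 1" shows "(slope has_real_derivative - 2 / prof w) (at w)"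
proof -
  have "((\<lambda>w. (1 + w) / 2) has_real_derivative 1 / 2) (at w)"
    by (auto intro!: derivative_eq_intros)
  then have "((\<lambda>w. deriv profile_J ((1 + w) / 2)) has_real_derivative
      - 2 / profile_J ((1 + w) / 2) * (1 / 2)) (at w)"
    using assms
    by (intro DERIV_chain2[of "deriv profile_J"] is_profile_derivs(3)[OF is_profile_profile_J]) auto
  then show ?thesis by (simp add: prof_def[abs_def] slope_def[abs_def])
qed

lemma slope_cont: "0 < a \<Longrightarrow> b < 1 \<Longrightarrow> continuous_on {a..b} slope"
  by (intro continuous_at_imp_continuous_on ballI DERIV_isCont[OF slope_deriv]) auto

lemma prof_cont_sub: "0 \<le> a \<Longrightarrow> b \<le> 1 \<Longrightarrow> continuous_on {a..b} prof"
  by (rule continuous_on_subset[OF prof_cont]) auto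

lemma slope_strict_decreasing:
  assumes "0 < a" "a < b" "b < 1" shows "slope b < slope a"
proof (rule DERIV_neg_imp_decreasing[OF assms(2)])
  show "\<exists>y. (slope has_real_derivative y) (at x) \<and> y < 0" if "a \<le> x" "x \<le> b" for x
    using slope_deriv[of x] prof_pos[of x] assms that
    by (intro exI[of _ "- 2 / prof x"]) auto
qed

lemma slope_decreasing:
  assumes "0 < a" "a \<le> b" "b < 1" shows "slope b \<le> slope a"
  using slope_strict_decreasing[of a b] assms by (cases "a = b") auto

lemma prof_le_tangent:
  assumes "0 < a" "a \<le> b" "b \<le> 1"
  shows "prof b \<le> prof a + slope a * (b - a)"
proof -
  have "prof b - prof a \<le> slope a * b - slope a * a"
  proof (rule increment_le[where f' = slope and h' = "\<lambda>_. slope a"])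
    show "((*) (slope a) has_real_derivative slope a) (at x)" for x
      by (auto intro!: derivative_eq_intros)
  qed (use assms slope_decreasing[of a] in \<open>auto intro!: prof_cont_sub prof_deriv continuous_intros\<close>)
  then show ?thesis by (simp add: algebra_simps)
qed

lemma prof_mvt:
  assumes "0 \<le> a" "a < b" "b \<le> 1"
  shows "\<exists>z. a < z \<and> z < b \<and> prof b - prof a = (b - a) * slope z"
proof -
  have "prof differentiable (at x)" if "a < x" "x < b" for x
    unfolding real_differentiable_def using prof_deriv[of x] assms that by auto
  then obtain l z where z: "a < z" "z < b" "(prof has_real_derivative l) (at z)" "prof b - prof a = (b - a) * l"
    using MVT[OF assms(2) prof_cont_sub[OF assms(1,3)]] by blast
  have "l = slope z" by (rule DERIV_unique[OF z(3) prof_deriv]) (use z assms in auto)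
  with z show ?thesis by blast
qed

text \<open>Concavity in the form used below: a line that is below \<open>prof\<close> at the ends of an interval is below
it throughout.\<close>

lemma prof_ge_chord:
  assumes ab: "0 \<le> a" "a \<le> x" "x \<le> b" "b \<le> 1" and S: "S a \<le> prof a" "S b \<le> prof b"
    and lin: "\<And>t. S t = u + v * t"
  shows "S x \<le> prof x"
proof (rule ccontr)
  assume n: "\<not> S x \<le> prof x"
  have ne: "x \<noteq> a" "x \<noteq> b" using n S by auto
  with ab have ax: "a < x" "x < b" by auto
  obtain z1 where z1: "a < z1" "z1 < x" "prof x - prof a = (x - a) * slope z1"
    using prof_mvt[of a x] ax ab by auto
  obtain z2 where z2: "x < z2" "z2 < b" "prof b - prof x = (b - x) * slope z2"
    using prof_mvt[of x b] ax ab by auto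
  have "(x - a) * slope z1 < (x - a) * v" using z1(3) n S unfolding lin by (simp add: algebra_simps)
  then have "slope z1 < v" using ax by simp
  moreover have "(b - x) * slope z2 > (b - x) * v" using z2(3) n S unfolding lin by (simp add: algebra_simps)
  then have "slope z2 > v" using ax by simp
  ultimately show False using slope_strict_decreasing[of z1 z2] z1 z2 ab by simp
qed

lemma prof_ge_1_minus: "0 \<le> w \<Longrightarrow> w \<le> 1 \<Longrightarrow> prof w \<ge> 1 - w"
  using prof_ge_chord[of 0 w 1 "\<lambda>t. 1 - t" 1 "-1"] by simp

text \<open>The equation \<open>f'' = -2 / f\<close> is that of a particle in a logarithmic potential; this is the
exponential of its energy \<open>ln f + f'\<^sup>2 / 4\<close>.\<close>

definition energy :: real where
  "energy = prof (1/2) * exp ((slope (1/2))\<^sup>2 / 4)"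

lemma prof_energy:
  assumes "0 < w" "w < 1"
  shows "prof w * exp ((slope w)\<^sup>2 / 4) = energy"
  unfolding energy_def
proof (rule DERIV_isconst3[of 0 1 _ _ "\<lambda>x. prof x * exp ((slope x)\<^sup>2 / 4)"])
  fix x :: real assume x: "x \<in> {0<..<1}"
  then have x': "0 < x" "x < 1" by auto
  have "((\<lambda>x. prof x * exp ((slope x)\<^sup>2 / 4)) has_real_derivative
      slope x * exp ((slope x)\<^sup>2 / 4) + exp ((slope x)\<^sup>2 / 4) * (2 * slope x * (- 2 / prof x) / 4) * prof x) (at x)"
    by (auto intro!: derivative_eq_intros prof_deriv[OF x'] slope_deriv[OF x'])
  also have "slope x * exp ((slope x)\<^sup>2 / 4) + exp ((slope x)\<^sup>2 / 4) * (2 * slope x * (- 2 / prof x) / 4) * prof x = 0"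
    using prof_pos[of x] x' by (simp add: field_simps)
  finally show "((\<lambda>x. prof x * exp ((slope x)\<^sup>2 / 4)) has_real_derivative 0) (at x)" .
qed (use assms in auto)

lemma energy_pos: "energy > 0"
  using prof_pos[of "1/2"] by (simp add: energy_def)

lemma prof_eq_energy:
  assumes "0 < w" "w < 1"
  shows "prof w = energy * exp (- ((slope w)\<^sup>2 / 4))"
  using prof_energy[OF assms] by (simp add: exp_minus field_simps)

text \<open>As \<open>prof\<close> tends to \<open>0\<close>, conservation of energy forces \<open>slope\<^sup>2\<close> to infinity.\<close>

lemma slope_at_1: "filterlim slope at_bot (at_left 1)"
proof (subst filterlim_at_bot, intro allI)
  fix Z :: real
  define M where "M = max (- Z) 1"
  have M: "M > 0" "- M \<le> Z" by (auto simp: M_def)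
  have lim: "(prof \<longlongrightarrow> prof 1) (at_left 1)"
    using continuous_on_Icc_at_leftD[OF prof_cont] by simp
  have "\<forall>\<^sub>F w in at_left 1. prof w < energy * exp (- (M\<^sup>2 / 4))"
    by (rule order_tendstoD(2)[OF lim]) (simp add: energy_pos)
  moreover have "\<forall>\<^sub>F w in at_left 1. prof w < prof (1/2)"
    by (rule order_tendstoD(2)[OF lim]) (simp add: prof_pos)
  moreover have "\<forall>\<^sub>F w in at_left (1::real). w \<in> {1/2<..<1}"
    by (rule eventually_at_leftI[of "1/2"]) auto
  ultimately show "\<forall>\<^sub>F w in at_left 1. slope w \<le> Z"
  proof eventually_elim
    case (elim w)
    then have w: "0 < w" "w < 1" "1/2 < w" by auto
    have "exp (- ((slope w)\<^sup>2 / 4)) < exp (- (M\<^sup>2 / 4))"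
      using elim(1) energy_pos unfolding prof_eq_energy[OF w(1,2)] by simp
    then have "M\<^sup>2 < (slope w)\<^sup>2" by simp
    then have "M\<^sup>2 < \<bar>slope w\<bar>\<^sup>2" by simp
    then have "M < \<bar>slope w\<bar>" by (rule power2_less_imp_less) (rule abs_ge_zero)
    moreover have "slope w \<le> 0"
    proof (rule ccontr)
      assume "\<not> slope w \<le> 0"
      have "0 - 0 \<le> prof w - prof (1/2)"
      proof (rule increment_le[where f = "\<lambda>_. 0" and h = prof and f' = "\<lambda>_. 0" and h' = slope])
        fix x assume "1/2 < x" "x < w"
        then show "0 \<le> slope x" using \<open>\<not> slope w \<le> 0\<close> slope_decreasing[of x w] w by simp
      qed (use w in \<open>auto intro!: prof_cont_sub prof_deriv\<close>)
      with elim(2) show False by simp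
    qed
    ultimately show ?case using M by simp
  qed
qed

text \<open>By the energy identity the Gaussian density at \<open>slope / sqrt 2\<close> is proportional to \<open>prof\<close>, while
\<open>slope\<close> has derivative \<open>-2 / prof\<close>. The factors cancel, the left-hand side has constant derivative,
and its limit at \<open>1\<close> is \<open>0\<close>.\<close>

lemma gauss_cdf_slope:
  assumes "0 < w" "w < 1"
  shows "gauss_cdf (slope w / sqrt 2) = (1 - w) / (energy * sqrt pi)"
proof -
  define F where "F = (\<lambda>w. gauss_cdf (slope w / sqrt 2) - (1 - w) / (energy * sqrt pi))"
  have d: "(F has_real_derivative 0) (at x)" if x: "x \<in> {0<..<1}" for x
  proof -
    have x': "0 < x" "x < 1" using x by auto
    have 1: "((\<lambda>x. slope x / sqrt 2) has_real_derivative - 2 / prof x / sqrt 2) (at x)"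
      by (intro DERIV_cdivide slope_deriv x')
    have 2: "((\<lambda>x. (1 - x) / (energy * sqrt pi)) has_real_derivative (0 - 1) / (energy * sqrt pi)) (at x)"
      by (intro DERIV_cdivide DERIV_diff DERIV_ident DERIV_const)
    have "(F has_real_derivative
        std_normal_density (slope x / sqrt 2) * (- 2 / prof x / sqrt 2) + 1 / (energy * sqrt pi)) (at x)"
      unfolding F_def using DERIV_diff[OF DERIV_chain2[OF gauss_cdf_deriv 1] 2] by simp
    also have "std_normal_density (slope x / sqrt 2) = 1 / (sqrt 2 * sqrt pi) * (prof x / energy)"
      unfolding std_normal_density_def prof_eq_energy[OF x'] using energy_pos
      by (simp add: power_divide real_sqrt_mult)
    also have "1 / (sqrt 2 * sqrt pi) * (prof x / energy) * (- 2 / prof x / sqrt 2) =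
        - (2 / (sqrt 2 * sqrt 2)) / (energy * sqrt pi)"
      using prof_pos[of x] x' energy_pos by (simp add: field_simps del: real_sqrt_mult_self)
    finally show ?thesis by simp
  qed
  have const: "F x = F w" if "x \<in> {0<..<1}" for x
    by (rule DERIV_isconst3[of 0 1]) (use d assms that in auto)
  have "filterlim (\<lambda>x. (1 / sqrt 2) * slope x) at_bot (at_left 1)"
    by (rule filterlim_tendsto_pos_mult_at_bot[OF tendsto_const _ slope_at_1]) simp
  then have "((\<lambda>x. gauss_cdf ((1 / sqrt 2) * slope x)) \<longlongrightarrow> 0) (at_left 1)"
    by (rule filterlim_compose[OF gauss_cdf_at_bot])
  moreover have "((\<lambda>x. (1 - x) / (energy * sqrt pi)) \<longlongrightarrow> (1 - 1) / (energy * sqrt pi)) (at_left 1)"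
    by (intro tendsto_intros) (simp add: energy_pos[THEN less_imp_neq, symmetric])
  ultimately have "(F \<longlongrightarrow> 0 - (1 - 1) / (energy * sqrt pi)) (at_left 1)"
    unfolding F_def by (intro tendsto_diff) simp_all
  moreover have "\<forall>\<^sub>F x in at_left 1. F x = F w"
    by (rule eventually_at_leftI[of 0]) (use const in auto)
  ultimately have "((\<lambda>_. F w) \<longlongrightarrow> 0) (at_left (1::real))"
    by (simp add: tendsto_cong)
  then have "F w = 0" by (simp add: tendsto_const_iff)
  then show ?thesis by (simp add: F_def)
qed

section \<open>Comparison with subsolutions and the initial slope\<close>

text \<open>Maximum principle: at a positive maximum of \<open>S - prof\<close> the difference would have positive second
derivative, because \<open>- 2 / S > - 2 / prof\<close> where \<open>S > prof\<close>.\<close>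

lemma prof_ge_subsolution:
  assumes ab: "0 \<le> a" "b \<le> 1" and cont: "continuous_on {a..b} S"
    and ends: "S a \<le> prof a" "S b \<le> prof b"
    and S1: "\<And>t. a < t \<Longrightarrow> t < b \<Longrightarrow> (S has_real_derivative S' t) (at t)"
    and S2: "\<And>t. a < t \<Longrightarrow> t < b \<Longrightarrow> (S' has_real_derivative S'' t) (at t)"
    and sub: "\<And>t. a < t \<Longrightarrow> t < b \<Longrightarrow> 0 < S t \<Longrightarrow> - 2 \<le> S t * S'' t"
    and x: "a \<le> x" "x \<le> b"
  shows "S x \<le> prof x"
proof (rule ccontr)
  assume neg: "\<not> S x \<le> prof x"
  define D where "D = (\<lambda>t. S t - prof t)"
  have "continuous_on {a..b} D"
    unfolding D_def by (intro continuous_on_diff cont prof_cont_sub ab)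
  then obtain c where c: "c \<in> {a..b}" "\<And>y. y \<in> {a..b} \<Longrightarrow> D y \<le> D c"
    using continuous_attains_sup[of "{a..b}" D] x by auto
  have Dc: "D c > 0" using c(2)[of x] neg x by (simp add: D_def)
  with ends have "c \<noteq> a" "c \<noteq> b" by (auto simp: D_def)
  with c(1) have c': "a < c" "c < b" by auto
  have dD: "(D has_real_derivative S' t - slope t) (at t)" if "a < t" "t < b" for t
    unfolding D_def using that ab by (intro DERIV_diff S1 prof_deriv) auto
  have dE: "((\<lambda>t. S' t - slope t) has_real_derivative S'' c - - 2 / prof c) (at c)"
    using c' ab by (intro DERIV_diff S2 slope_deriv) auto
  have pc: "prof c > 0" "S c > prof c" using prof_pos[of c] c' ab Dc by (auto simp: D_def)
  have "0 < S c" using pc by simp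
  with sub[OF c' this] have "- 2 / S c \<le> S'' c" by (simp add: field_simps)
  moreover have "- 2 / prof c < - 2 / S c" using pc by (simp add: field_simps)
  ultimately have pos: "S'' c - - 2 / prof c > 0" by simp
  have E0: "S' c - slope c = 0"
    using DERIV_local_max[OF dD[OF c'], of "min (c - a) (b - c)"] c' c(2)
    by (force simp: abs_if min_def split: if_splits)
  obtain d where d: "d > 0" "\<And>h. 0 < h \<Longrightarrow> h < d \<Longrightarrow> S' c - slope c < S' (c + h) - slope (c + h)"
    using DERIV_pos_inc_right[OF dE pos] by blast
  define h where "h = min (d/2) ((b - c)/2)"
  have h: "0 < h" "h < d" "c + h < b" using d(1) c' by (auto simp: h_def min_def field_simps)
  have "D c < D (c + h)"
  proof (rule DERIV_pos_imp_increasing_open[of c "c + h" D])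
    show "\<exists>y. (D has_real_derivative y) (at z) \<and> 0 < y" if "c < z" "z < c + h" for z
      using dD[of z] d(2)[of "z - c"] that c' h E0 by auto
    show "continuous_on {c..c + h} D"
      using c' h by (intro continuous_at_imp_continuous_on ballI DERIV_isCont[OF dD]) auto
  qed (use h in auto)
  moreover have "D (c + h) \<le> D c" using c(2)[of "c + h"] c' h by auto
  ultimately show False by simp
qed

lemma prof_ge_1_minus_sq:
  assumes "0 \<le> w" "w \<le> 1" shows "prof w \<ge> 1 - w\<^sup>2"
  by (rule prof_ge_subsolution[of 0 1 "\<lambda>w. 1 - w\<^sup>2" "\<lambda>w. - 2 * w" "\<lambda>_. -2"])
    (use assms in \<open>auto intro!: continuous_intros derivative_eq_intros\<close>)

text \<open>Equal to \<open>sqrt pi / 2\<close> plus half the integral of \<open>exp (- (q\<^sup>2 / 4))\<close> from \<open>0\<close> to \<open>s\<close>.\<close>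

definition gauss_mass :: "real \<Rightarrow> real" where
  "gauss_mass s = sqrt pi * gauss_cdf (s / sqrt 2)"

lemma gauss_mass_deriv: "(gauss_mass has_real_derivative exp (- (s\<^sup>2 / 4)) / 2) (at s)"
proof -
  have "((\<lambda>s. s / sqrt 2) has_real_derivative 1 / sqrt 2) (at s)" by (intro DERIV_cdivide DERIV_ident)
  from DERIV_cmult[OF DERIV_chain2[OF gauss_cdf_deriv this], of "sqrt pi"]
  have "(gauss_mass has_real_derivative
      sqrt pi * (std_normal_density (s / sqrt 2) * (1 / sqrt 2))) (at s)"
    by (simp add: gauss_mass_def[abs_def])
  also have "sqrt pi * (std_normal_density (s / sqrt 2) * (1 / sqrt 2)) =
      exp (- (s\<^sup>2 / 4)) / (sqrt 2 * sqrt 2)"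
    unfolding std_normal_density_def by (simp add: power_divide real_sqrt_mult del: real_sqrt_mult_self)
  finally show ?thesis by simp
qed

lemma gauss_mass_0: "gauss_mass 0 = sqrt pi / 2"
  by (simp add: gauss_mass_def gauss_cdf_0)

lemma gauss_mass_cont: "continuous_on S gauss_mass"
  by (intro continuous_at_imp_continuous_on ballI DERIV_isCont[OF gauss_mass_deriv])

lemma gauss_mass_mono: "s \<le> t \<Longrightarrow> gauss_mass s \<le> gauss_mass t"
  using gauss_cdf_strict_mono[of "s / sqrt 2" "t / sqrt 2"]
  by (cases "s = t") (auto simp: gauss_mass_def divide_strict_right_mono intro!: mult_left_mono less_imp_le)

lemma gauss_mass_pos: "gauss_mass s > 0"
  by (simp add: gauss_mass_def gauss_cdf_pos)

lemma gauss_mass_slope: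
  assumes "0 < w" "w < 1"
  shows "prof w * (exp ((slope w)\<^sup>2 / 4) * gauss_mass (slope w)) = 1 - w"
proof -
  have "prof w * (exp ((slope w)\<^sup>2 / 4) * gauss_mass (slope w)) = energy * gauss_mass (slope w)"
    by (simp flip: prof_energy[OF assms])
  also have "\<dots> = 1 - w"
    using gauss_cdf_slope[OF assms] energy_pos by (simp add: gauss_mass_def)
  finally show ?thesis .
qed

lemma exp_minus_bounds:
  fixes x :: real assumes "x \<ge> 0"
  shows "1 - x \<le> exp (- x)" "exp (- x) \<le> 1 - x + x\<^sup>2 / 2"
proof -
  show "1 - x \<le> exp (- x)" using exp_ge_add_one_self[of "-x"] by simp
  have "exp (- x) - exp (- 0) \<le> (1 - x + x\<^sup>2 / 2) - (1 - 0 + 0\<^sup>2 / 2)"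
  proof (rule increment_le[where f' = "\<lambda>x. - exp (- x)" and h' = "\<lambda>x. x - 1"])
    show "- exp (- t) \<le> t - 1" for t :: real using exp_ge_add_one_self[of "-t"] by simp
  qed (use assms in \<open>auto intro!: continuous_intros derivative_eq_intros\<close>)
  then show "exp (- x) \<le> 1 - x + x\<^sup>2 / 2" by simp
qed

lemma gauss_mass_lower:
  assumes "s \<ge> 0" shows "gauss_mass s \<ge> sqrt pi / 2 + (s - s ^ 3 / 12) / 2"
proof -
  have "(s - s ^ 3 / 12) / 2 - (0 - 0 ^ 3 / 12) / 2 \<le> gauss_mass s - gauss_mass 0"
  proof (rule increment_le[where f' = "\<lambda>s. (1 - s\<^sup>2 / 4) / 2" and h' = "\<lambda>s. exp (- (s\<^sup>2 / 4)) / 2"])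
    show "(1 - t\<^sup>2 / 4) / 2 \<le> exp (- (t\<^sup>2 / 4)) / 2" for t :: real
      using exp_minus_bounds(1)[of "t\<^sup>2 / 4"] by simp
    show "((\<lambda>s. (s - s ^ 3 / 12) / 2) has_real_derivative (1 - t\<^sup>2 / 4) / 2) (at t)" for t :: real
      by (auto intro!: derivative_eq_intros simp: power2_eq_square)
  qed (use assms in \<open>auto intro!: continuous_intros gauss_mass_deriv gauss_mass_cont\<close>)
  then show ?thesis by (simp add: gauss_mass_0 field_simps)
qed

lemma gauss_mass_upper:
  assumes "s \<ge> 0" shows "gauss_mass s \<le> sqrt pi / 2 + (s - s ^ 3 / 12 + s ^ 5 / 160) / 2"
proof -
  have "gauss_mass s - gauss_mass 0 \<le> (s - s ^ 3 / 12 + s ^ 5 / 160) / 2 - (0 - 0 ^ 3 / 12 + 0 ^ 5 / 160) / 2"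
  proof (rule increment_le[where h' = "\<lambda>s. (1 - s\<^sup>2 / 4 + s ^ 4 / 32) / 2" and f' = "\<lambda>s. exp (- (s\<^sup>2 / 4)) / 2"])
    show "exp (- (t\<^sup>2 / 4)) / 2 \<le> (1 - t\<^sup>2 / 4 + t ^ 4 / 32) / 2" for t :: real
      using exp_minus_bounds(2)[of "t\<^sup>2 / 4"] by (simp add: power2_eq_square power4_eq_xxxx)
    show "((\<lambda>s. (s - s ^ 3 / 12 + s ^ 5 / 160) / 2) has_real_derivative (1 - t\<^sup>2 / 4 + t ^ 4 / 32) / 2) (at t)" for t :: real
      by (auto intro!: derivative_eq_intros simp: power2_eq_square power4_eq_xxxx)
  qed (use assms in \<open>auto intro!: continuous_intros gauss_mass_deriv gauss_mass_cont\<close>)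
  then show ?thesis by (simp add: gauss_mass_0 field_simps)
qed

lemma sqrt_pi_bounds: "1.772453 \<le> sqrt pi" "sqrt pi \<le> 1.772454"
proof -
  have "(1.772453::real)\<^sup>2 \<le> pi" using pi_approx(1) by (simp add: power2_eq_square)
  then show "1.772453 \<le> sqrt pi" by (rule real_le_rsqrt)
  have "pi \<le> (1.772454::real)\<^sup>2" using pi_approx(2) by (simp add: power2_eq_square)
  then show "sqrt pi \<le> 1.772454" by (intro real_le_lsqrt) auto
qed

text \<open>Concavity gives \<open>prof w \<ge> 1 - w\<close>, so \<open>gauss_mass_slope\<close> bounds \<open>exp (s\<^sup>2 / 4) * gauss_mass s\<close> by
\<open>1\<close> for \<open>s = slope w\<close>. At \<open>s = 0.207\<close> this product already exceeds \<open>1\<close>, by about \<open>1.4 / 100000\<close>.\<close>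

lemma slope_le:
  assumes w: "0 < w" "w < 1" shows "slope w \<le> 0.207"
proof (rule ccontr)
  assume "\<not> slope w \<le> 0.207"
  then have s: "0.207 < slope w" by simp
  have "(1::real) < (1 + 0.207\<^sup>2 / 4 + (0.207\<^sup>2 / 4)\<^sup>2 / 2) * (1.772453 / 2 + (0.207 - 0.207 ^ 3 / 12) / 2)"
    by (simp add: power_numeral_reduce)
  also have "\<dots> \<le> exp (0.207\<^sup>2 / 4) * gauss_mass 0.207"
    using exp_lower_Taylor_quadratic[of "0.207\<^sup>2 / 4"] gauss_mass_lower[of "0.207"] sqrt_pi_bounds(1)
    by (intro mult_mono) (auto simp: power2_eq_square power3_eq_cube)
  also have "\<dots> \<le> exp ((slope w)\<^sup>2 / 4) * gauss_mass (slope w)"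
    using s gauss_mass_mono[of "0.207" "slope w"] gauss_mass_pos[of "0.207"]
    by (intro mult_mono) (auto intro!: power_mono less_imp_le)
  finally have "prof w * 1 < prof w * (exp ((slope w)\<^sup>2 / 4) * gauss_mass (slope w))"
    using prof_pos[of w] w by (intro mult_strict_left_mono) auto
  with gauss_mass_slope[OF w] prof_ge_1_minus[of w] w show False by simp
qed

lemma prof_tendsto_0: "(prof \<longlongrightarrow> 1) (at_right 0)"
  using continuous_on_Icc_at_rightD[OF prof_cont] by simp

text \<open>The true initial slope is \<open>0.20697...\<close>. If all slopes were at most \<open>0.2068\<close>, the product
\<open>exp (s\<^sup>2 / 4) * gauss_mass s\<close> would stay below a constant less than \<open>1\<close> near \<open>0\<close>, but by
\<open>gauss_mass_slope\<close> it is \<open>(1 - w) / prof w\<close> and tends to \<open>1\<close>.\<close>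

lemma slope_near_0: "\<exists>w0>0. w0 < 1 \<and> 0.2068 < slope w0"
proof (rule ccontr)
  assume "\<not> ?thesis"
  then have up: "slope w \<le> 0.2068" if "0 < w" "w < 1" for w using that by force
  obtain z where z: "0 < z" "z < 0.2" "prof 0.2 - prof 0 = (0.2 - 0) * slope z"
    using prof_mvt[of 0 "0.2"] by auto
  have zs: "slope z \<ge> - 0.2" using prof_ge_1_minus_sq[of "0.2"] z(3) by (simp add: power2_eq_square)
  define X :: real where "X = (1 + 0.2068\<^sup>2 / 4 + (0.2068\<^sup>2 / 4)\<^sup>2) * (1.772454 / 2 + (0.2068 - 0.2068 ^ 3 / 12 + 0.2068 ^ 5 / 160) / 2)"
  have X: "X < 1" unfolding X_def by (simp add: power_numeral_reduce)
  have le: "1 - t \<le> prof t * X" if t: "0 < t" "t < z" for t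
  proof -
    have t1: "t < 1" using t z by simp
    have s: "- 0.2 \<le> slope t" "slope t \<le> 0.2068" using up[of t] slope_decreasing[of t z] zs t z by auto
    then have "(slope t)\<^sup>2 \<le> 0.2068\<^sup>2" by (intro power2_le_iff_abs_le[THEN iffD2]) auto
    then have "exp ((slope t)\<^sup>2 / 4) \<le> exp (0.2068\<^sup>2 / 4)" by simp
    also have "\<dots> \<le> 1 + 0.2068\<^sup>2 / 4 + (0.2068\<^sup>2 / 4)\<^sup>2" by (intro exp_bound) (auto simp: power2_eq_square)
    finally have "exp ((slope t)\<^sup>2 / 4) * gauss_mass (slope t) \<le> X"
      unfolding X_def using gauss_mass_mono[OF s(2)] gauss_mass_upper[of "0.2068"] sqrt_pi_bounds(2) gauss_mass_pos[of "slope t"]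
      by (intro mult_mono) auto
    then have "prof t * (exp ((slope t)\<^sup>2 / 4) * gauss_mass (slope t)) \<le> prof t * X"
      using prof_nonneg[of t] t t1 by (intro mult_left_mono) auto
    then show ?thesis using gauss_mass_slope[OF t(1) t1] by simp
  qed
  have "1 - 0 \<le> 1 * X"
  proof (rule tendsto_le[of "at_right (0::real)"])
    show "((\<lambda>t. prof t * X) \<longlongrightarrow> 1 * X) (at_right 0)" by (intro tendsto_intros prof_tendsto_0)
    show "((\<lambda>t. 1 - t) \<longlongrightarrow> 1 - 0) (at_right (0::real))" by (intro tendsto_intros)
    show "\<forall>\<^sub>F t in at_right 0. 1 - t \<le> prof t * X"
      using z le by (intro eventually_at_rightI[of 0 z]) auto
  qed simp
  with X show False by simp
qed

lemma slope_near_0_obtain: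
  obtains w0 where "0 < w0" "w0 < 1" "\<And>t. 0 < t \<Longrightarrow> t \<le> w0 \<Longrightarrow> 0.2068 < slope t"
proof -
  obtain w0 where w0: "0 < w0" "w0 < 1" "0.2068 < slope w0" using slope_near_0 by blast
  then show thesis using slope_decreasing[of _ w0] by (intro that[of w0]) force+
qed

lemma prof_ge_1_of_slope_nonneg:
  assumes "0 < w" "w < 1" "slope w \<ge> 0" shows "prof w \<ge> 1"
proof -
  have "0 - 0 \<le> prof w - prof 0"
  proof (rule increment_le[where f = "\<lambda>_. 0" and h = prof and f' = "\<lambda>_. 0" and h' = slope])
    show "0 \<le> slope x" if "0 < x" "x < w" for x using slope_decreasing[of x w] that assms by simp
  qed (use assms in \<open>auto intro!: prof_cont_sub prof_deriv\<close>)
  then show ?thesis by simp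
qed

lemma energy_ge: "exp (0.2068\<^sup>2 / 4) \<le> energy"
proof -
  obtain w0 where w0: "0 < w0" "w0 < 1" "0.2068 < slope w0" using slope_near_0 by blast
  have "(0.2068::real)\<^sup>2 \<le> (slope w0)\<^sup>2" using w0 by (intro power_mono) auto
  then have "1 * exp (0.2068\<^sup>2 / 4) \<le> prof w0 * exp ((slope w0)\<^sup>2 / 4)"
    using prof_ge_1_of_slope_nonneg[of w0] w0 by (intro mult_mono) auto
  then show ?thesis using prof_energy[of w0] w0 by simp
qed

lemma energy_bounds: "1.010748 \<le> energy" "energy \<le> 1.0109"
proof -
  have "(1.010748::real) \<le> 1 + 0.2068\<^sup>2 / 4 + (0.2068\<^sup>2 / 4)\<^sup>2 / 2" by (simp add: power2_eq_square)
  also have "\<dots> \<le> exp (0.2068\<^sup>2 / 4)" by (rule exp_lower_Taylor_quadratic) simp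
  finally show "1.010748 \<le> energy" using energy_ge by simp
  obtain w0 where w0: "0 < w0" "w0 < 1" and pos: "\<And>t. 0 < t \<Longrightarrow> t \<le> w0 \<Longrightarrow> 0.2068 < slope t"
    using slope_near_0_obtain by blast
  have "energy \<le> 1 * 1.0109"
  proof (rule tendsto_le[of "at_right (0::real)"])
    show "((\<lambda>t. prof t * 1.0109) \<longlongrightarrow> 1 * 1.0109) (at_right 0)" by (intro tendsto_intros prof_tendsto_0)
    show "((\<lambda>t. energy) \<longlongrightarrow> energy) (at_right (0::real))" by (intro tendsto_intros)
    show "\<forall>\<^sub>F t in at_right 0. energy \<le> prof t * 1.0109"
    proof (rule eventually_at_rightI[of 0 w0])
      fix t assume "t \<in> {0<..<w0}"
      then have t: "0 < t" "t \<le> w0" "t < 1" using w0 by auto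
      have "(slope t)\<^sup>2 \<le> 0.207\<^sup>2" using pos[OF t(1,2)] slope_le[OF t(1,3)] by (intro power_mono) auto
      then have "exp ((slope t)\<^sup>2 / 4) \<le> exp (0.207\<^sup>2 / 4)" by simp
      also have "\<dots> \<le> 1 + 0.207\<^sup>2 / 4 + (0.207\<^sup>2 / 4)\<^sup>2" by (intro exp_bound) (auto simp: power2_eq_square)
      also have "\<dots> \<le> 1.0109" by (simp add: power2_eq_square)
      finally have "prof t * exp ((slope t)\<^sup>2 / 4) \<le> prof t * 1.0109"
        using prof_nonneg[of t] t by (intro mult_left_mono) auto
      then show "energy \<le> prof t * 1.0109" using prof_energy[of t] t by simp
    qed (use w0 in auto)
  qed simp
  then show "energy \<le> 1.0109" by simp
qed

section \<open>Explicit bounds for the profile\<close>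

lemmas slope_deriv_minus = slope_deriv[simplified]

text \<open>While \<open>\<bar>slope\<bar>\<close> is at most its initial value, the energy identity gives \<open>prof \<ge> 1\<close>, hence
\<open>slope\<close> decreases at rate at most \<open>2\<close>.\<close>

lemma slope_ge_before_crossing:
  assumes w: "0 < w" "w < 1" and s: "- 0.2068 \<le> slope w"
  shows "0.2068 - 2 * w \<le> slope w"
proof -
  obtain w0 where w0: "0 < w0" "w0 < 1" "0.2068 < slope w0" using slope_near_0 by blast
  show ?thesis
  proof (cases "w \<le> w0")
    case True
    then show ?thesis using slope_decreasing[of w w0] w0 w by simp
  next
    case False
    then have ww: "w0 < w" by simp
    have ge1: "prof t \<ge> 1" if t: "0 < t" "t < w" for t
    proof (cases "slope t \<ge> 0")
      case True
      then show ?thesis using prof_ge_1_of_slope_nonneg t w by simp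
    next
      case False
      have "- 0.2068 \<le> slope t" using slope_decreasing[of t w] t w s by simp
      with False have "(slope t)\<^sup>2 \<le> 0.2068\<^sup>2" by (intro power2_le_iff_abs_le[THEN iffD2]) auto
      then have "exp ((slope t)\<^sup>2 / 4) \<le> exp (0.2068\<^sup>2 / 4)" by simp
      also have "\<dots> \<le> energy" by (rule energy_ge)
      also have "\<dots> = prof t * exp ((slope t)\<^sup>2 / 4)" using prof_energy[of t] t w by simp
      finally show ?thesis by simp
    qed
    have "(- 2 * w) - (- 2 * w0) \<le> slope w - slope w0"
    proof (rule increment_le[where f' = "\<lambda>_. -2" and h' = "\<lambda>t. - 2 / prof t" and f = "\<lambda>t. - 2 * t" and h = slope])
      show "-2 \<le> - 2 / prof t" if "w0 < t" "t < w" for t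
        using ge1[of t] that w0 by (simp add: divide_le_eq)
    qed (use w w0 ww in \<open>auto intro!: slope_cont slope_deriv_minus continuous_intros derivative_eq_intros\<close>)
    then show ?thesis using w0 by simp
  qed
qed

lemma slope_ge_first_fifth:
  assumes w: "0 < w" "w \<le> 0.2" shows "0.2068 - 2 * w \<le> slope w"
proof (cases "- 0.2068 \<le> slope w")
  case True
  then show ?thesis using slope_ge_before_crossing w by simp
next
  case False
  obtain w0 where w0: "0 < w0" "w0 < 1" "0.2068 < slope w0" using slope_near_0 by blast
  have "w0 \<le> w" by (rule ccontr) (use slope_decreasing[of w w0] w0 w False in auto)
  moreover have "continuous_on {w0..w} slope" using w0 w by (intro slope_cont) auto
  ultimately obtain t where t: "w0 \<le> t" "t \<le> w" "slope t = - 0.2068"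
    using IVT2'[of slope w "-0.2068" w0] False w0 by auto
  then show ?thesis using slope_ge_before_crossing[of t] w0 w by simp
qed

lemma prof_ge_first_fifth:
  assumes w: "0 \<le> w" "w \<le> 0.2" shows "1 + 0.2068 * w - w\<^sup>2 \<le> prof w"
proof -
  have "(0.2068 * w - w\<^sup>2) - (0.2068 * 0 - 0\<^sup>2) \<le> prof w - prof 0"
    by (rule increment_le[where f' = "\<lambda>t. 0.2068 - 2 * t" and h' = slope])
      (use w slope_ge_first_fifth in \<open>auto intro!: prof_cont_sub prof_deriv continuous_intros derivative_eq_intros\<close>)
  then show ?thesis by simp
qed

lemma exp_minus_ge_cubic:
  fixes x :: real assumes "x \<ge> 0"
  shows "1 - x + x\<^sup>2 / 2 - x ^ 3 / 6 \<le> exp (- x)"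
proof -
  have "(- x + x\<^sup>2 / 2 - x ^ 3 / 6) - (- 0 + 0\<^sup>2 / 2 - 0 ^ 3 / 6) \<le> exp (- x) - exp (- 0)"
  proof (rule increment_le[where h' = "\<lambda>x. - exp (- x)" and f' = "\<lambda>x. - 1 + x - x\<^sup>2 / 2"])
    show "- 1 + t - t\<^sup>2 / 2 \<le> - exp (- t)" if "0 < t" for t :: real using exp_minus_bounds(2)[of t] that by simp
    show "((\<lambda>x. - x + x\<^sup>2 / 2 - x ^ 3 / 6) has_real_derivative - 1 + t - t\<^sup>2 / 2) (at t)" for t :: real
      by (auto intro!: derivative_eq_intros simp: power2_eq_square)
  qed (use assms in \<open>auto intro!: continuous_intros derivative_eq_intros\<close>)
  then show ?thesis by simp
qed

text \<open>By the energy identity \<open>1 / prof = exp (s\<^sup>2 / 4) / energy\<close> with \<open>s = slope\<close>, and \<open>exp v * (1 - v) \<le> 1\<close>. Hence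
\<open>s - s ^ 3 / 12\<close> decreases at rate at most \<open>2 / energy\<close>, which bounds \<open>slope (1/2)\<close> from below, and
then \<open>prof (1/2)\<close> by the energy identity again. The true value is \<open>0.851...\<close>.\<close>

lemma prof_half_ge: "prof (1/2) \<ge> 0.85"
proof -
  define s where "s = slope (1/2)"
  obtain w0 where w0: "0 < w0" "w0 < 1" "\<And>t. 0 < t \<Longrightarrow> t \<le> w0 \<Longrightarrow> 0.2068 < slope t"
    using slope_near_0_obtain by blast
  define t0 where "t0 = min w0 (1/4)"
  have t0: "0 < t0" "t0 < 1/2" "0.2068 < slope t0" "slope t0 \<le> 0.207"
    using w0(1,2) w0(3)[of t0] slope_le[of t0] by (auto simp: t0_def)
  have f: "a - a ^ 3 / 12 \<le> b - b ^ 3 / 12" if "a \<le> b" "\<bar>a\<bar> \<le> 2" "\<bar>b\<bar> \<le> 2" for a b :: real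
  proof -
    have "a\<^sup>2 \<le> 4" "b\<^sup>2 \<le> 4" using that power2_le_iff_abs_le[of 2] by auto
    moreover have "2 * (a * b) \<le> a\<^sup>2 + b\<^sup>2" using sum_squares_bound[of a b] by simp
    ultimately have "0 \<le> (b - a) * (12 - (a\<^sup>2 + a * b + b\<^sup>2))" using that by (intro mult_nonneg_nonneg) auto
    then show ?thesis by (simp add: algebra_simps power2_eq_square power3_eq_cube)
  qed
  have "(- (2 / energy) * (1/2)) - (- (2 / energy) * t0) \<le> (s - s ^ 3 / 12) - (slope t0 - slope t0 ^ 3 / 12)"
    unfolding s_def
  proof (rule increment_le[where f' = "\<lambda>t. - (2 / energy)" and h' = "\<lambda>t. - 2 / prof t * (1 - (slope t)\<^sup>2 / 4)"])
    fix t assume "t0 < t" "t < 1/2"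
    then have t: "0 < t" "t < 1" using t0 by auto
    show "((\<lambda>t. slope t - slope t ^ 3 / 12) has_real_derivative - 2 / prof t * (1 - (slope t)\<^sup>2 / 4)) (at t)"
      using prof_pos[of t] t by (auto intro!: derivative_eq_intros slope_deriv simp: field_simps)
    define X where "X = 1 - (slope t)\<^sup>2 / 4"
    have "X * energy \<le> exp (- ((slope t)\<^sup>2 / 4)) * energy"
      unfolding X_def using exp_minus_bounds(1)[of "(slope t)\<^sup>2 / 4"] energy_pos by (intro mult_right_mono) auto
    also have "\<dots> = prof t" using prof_eq_energy[OF t] by simp
    finally have "X / prof t \<le> 1 / energy"
      using energy_pos prof_pos[of t] t by (simp add: field_simps)
    then show "- (2 / energy) \<le> - 2 / prof t * (1 - (slope t)\<^sup>2 / 4)"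
      unfolding X_def[symmetric] by simp
  qed (use t0 energy_pos in \<open>auto intro!: continuous_intros slope_cont derivative_eq_intros\<close>)
  moreover have "0.2068 - 0.2068 ^ 3 / 12 \<le> slope t0 - slope t0 ^ 3 / 12" by (rule f) (use t0 in auto)
  moreover have "1 / energy \<le> 1 / 1.010748" using energy_bounds by (intro divide_left_mono) auto
  moreover have "2 / energy * t0 \<ge> 0" using energy_pos t0 by simp
  ultimately have low: "s - s ^ 3 / 12 \<ge> - 0.78331" by (simp add: power3_eq_cube)
  have "1 + s\<^sup>2 / 4 \<le> exp (s\<^sup>2 / 4)" by (rule exp_ge_add_one_self)
  also have "0.75 * \<dots> \<le> prof (1/2) * \<dots>"
    using prof_ge_1_minus_sq[of "1/2"] by (intro mult_right_mono) (auto simp: power2_eq_square)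
  also have "\<dots> = energy" by (simp add: energy_def s_def)
  finally have "s\<^sup>2 \<le> 2\<^sup>2" using energy_bounds by simp
  then have s2: "\<bar>s\<bar> \<le> 2" using power2_le_iff_abs_le[of 2 s] by simp
  \<comment> \<open>\<open>- 0.8315\<close> is slightly below the root of \<open>s - s ^ 3 / 12 = - 0.78331\<close>.\<close>
  have "s \<ge> - 0.8315"
  proof (rule ccontr)
    assume "\<not> ?thesis"
    then have "s - s ^ 3 / 12 \<le> (- 0.8315) - (- 0.8315) ^ 3 / 12" using s2 by (intro f) auto
    with low show False by (simp add: power3_eq_cube)
  qed
  moreover have "s \<le> 0.207" using slope_le[of "1/2"] by (simp add: s_def)
  ultimately have "s\<^sup>2 \<le> 0.8315\<^sup>2" by (intro power2_le_iff_abs_le[THEN iffD2]) auto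
  then have e: "exp (- (0.8315\<^sup>2 / 4)) \<le> exp (- (s\<^sup>2 / 4))" by simp
  have "(0.8412::real) \<le> 1 - 0.8315\<^sup>2 / 4 + (0.8315\<^sup>2 / 4)\<^sup>2 / 2 - (0.8315\<^sup>2 / 4) ^ 3 / 6"
    by (simp add: power2_eq_square power3_eq_cube)
  also have "\<dots> \<le> exp (- (0.8315\<^sup>2 / 4))" by (rule exp_minus_ge_cubic) simp
  also note e
  finally have "0.8412 \<le> exp (- (s\<^sup>2 / 4))" .
  then have "1.010748 * 0.8412 \<le> energy * exp (- (s\<^sup>2 / 4))" using energy_bounds by (intro mult_mono) auto
  then show ?thesis using prof_eq_energy[of "1/2"] by (simp add: s_def)
qed

text \<open>The parabola is a subsolution only where it is at most \<open>1\<close>, that is from \<open>1/5\<close> on; on \<open>[0, 1/5]\<close> the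
estimate for the slope is used.\<close>

lemma prof_ge_parabola:
  assumes w: "0 \<le> w" "w \<le> 1/2" shows "1 + w / 5 - w\<^sup>2 \<le> prof w"
proof (cases "w \<le> 0.2")
  case True
  then show ?thesis using prof_ge_first_fifth[of w] w by simp
next
  case False
  show ?thesis
  proof (rule prof_ge_subsolution[of "0.2" "1/2" "\<lambda>w. 1 + w / 5 - w\<^sup>2" "\<lambda>w. 1 / 5 - 2 * w" "\<lambda>_. -2"])
    show "- 2 \<le> (1 + t / 5 - t\<^sup>2) * - 2" if "0.2 < t" "t < 1/2" for t :: real
      using that mult_left_mono[of "1/5" t t] by (simp add: power2_eq_square)
  qed (use w False prof_half_ge prof_ge_first_fifth[of "0.2"] in \<open>auto intro!: continuous_intros derivative_eq_intros simp: power2_eq_square\<close>)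
qed

text \<open>The coefficients are chosen such that the parabola vanishes at \<open>1\<close>, equals \<open>0.85\<close> at \<open>1/2\<close> and has second
derivative \<open>-2.35\<close>, just above the bound \<open>-2 / 0.85\<close> for a subsolution with values up to \<open>0.85\<close>.\<close>

lemma prof_ge_right_parabola:
  assumes w: "1/2 \<le> w" "w \<le> 1" shows "(1 - w) * (2.2875 - 1.175 * (1 - w)) \<le> prof w"
proof (rule prof_ge_subsolution[of "1/2" 1 _ "\<lambda>w. - 2.2875 + 2.35 * (1 - w)" "\<lambda>_. -2.35"])
  fix t :: real assume t: "1/2 < t" "t < 1"
  have "0 \<le> (1/2 - (1 - t)) * (2.2875 - 1.175 * (1/2 + (1 - t)))" using t by (intro mult_nonneg_nonneg) auto
  moreover define P where "P = (1 - t) * (2.2875 - 1.175 * (1 - t))"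
  ultimately have "P \<le> 0.85" by (simp add: field_simps)
  then show "- 2 \<le> (1 - t) * (2.2875 - 1.175 * (1 - t)) * - 2.35" unfolding P_def[symmetric] by simp
qed (use w prof_half_ge in \<open>auto intro!: continuous_intros derivative_eq_intros simp: field_simps\<close>)

lemma slope_ge:
  assumes w: "0 < w" "w \<le> 0.27" shows "0.2068 - 2 * w \<le> slope w"
proof (rule field_le_epsilon)
  fix e :: real assume "e > 0"
  obtain w0 where w0: "0 < w0" "w0 < 1" "\<And>t. 0 < t \<Longrightarrow> t \<le> w0 \<Longrightarrow> 0.2068 < slope t"
    using slope_near_0_obtain by blast
  define t0 where "t0 = min w0 w"
  have t0: "0 < t0" "t0 \<le> w" "0.2068 < slope t0" using w0(1,2) w0(3)[of t0] w by (auto simp: t0_def)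
  \<comment> \<open>An antiderivative of a quadratic lower bound for \<open>- 2 / (1 + t / 5 - t\<^sup>2)\<close>.\<close>
  let ?f = "\<lambda>t::real. - 2 * t + 0.19 * t\<^sup>2 - 0.7 * t ^ 3"
  have "?f w - ?f t0 \<le> slope w - slope t0"
  proof (rule increment_le[where f' = "\<lambda>t. - 2 + 0.38 * t - 2.1 * t\<^sup>2" and h' = "\<lambda>t. - 2 / prof t"])
    fix t assume "t0 < t" "t < w"
    then have t: "0 < t" "t < 0.27" using t0 w by auto
    have "t * t \<le> 0.27 * 0.27" using t by (intro mult_mono) auto
    have "0 \<le> t * (0.8 * (t - 0.08)\<^sup>2 + 0.01 * (1 - t))" using t by (intro mult_nonneg_nonneg add_nonneg_nonneg) auto
    also have "\<dots> \<le> 0.02 * t + 0.024 * (t * t) + 0.8 * t * (t * t) - 2.1 * (t * t) * (0.27 * 0.27)"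
      using t by (simp add: power2_eq_square field_simps)
    also have "\<dots> \<le> 0.02 * t + 0.024 * (t * t) + 0.8 * t * (t * t) - 2.1 * (t * t) * (t * t)"
      using mult_left_mono[OF \<open>t * t \<le> 0.27 * 0.27\<close>, of "t * t"] by (simp add: algebra_simps)
    finally have "2 \<le> (2 - 0.38 * t + 2.1 * t\<^sup>2) * (1 + t / 5 - t\<^sup>2)"
      by (simp add: field_simps power2_eq_square)
    also have "\<dots> \<le> (2 - 0.38 * t + 2.1 * t\<^sup>2) * prof t"
    proof (rule mult_left_mono)
      show "1 + t / 5 - t\<^sup>2 \<le> prof t" using prof_ge_parabola[of t] t by simp
      have "0 \<le> 2.1 * t\<^sup>2" by simp
      with t show "0 \<le> 2 - 0.38 * t + 2.1 * t\<^sup>2" by simp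
    qed
    finally show "- 2 + 0.38 * t - 2.1 * t\<^sup>2 \<le> - 2 / prof t"
      using prof_pos[of t] t by (simp add: field_simps)
  qed (use t0 w in \<open>auto intro!: slope_cont slope_deriv_minus continuous_intros derivative_eq_intros simp: power2_eq_square\<close>)
  moreover have "0.19 * w\<^sup>2 - 0.7 * w ^ 3 \<ge> 0"
  proof -
    have "0 \<le> w\<^sup>2 * (0.19 - 0.7 * w)" using w by (intro mult_nonneg_nonneg) auto
    then show ?thesis by (simp add: algebra_simps power2_eq_square power3_eq_cube)
  qed
  moreover have "?f t0 \<le> 0"
  proof -
    have "0 \<le> t0 * (2 - 0.19 * t0 + 0.7 * t0\<^sup>2)" using t0 w by (intro mult_nonneg_nonneg add_nonneg_nonneg) auto
    then show ?thesis by (simp add: algebra_simps power2_eq_square power3_eq_cube)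
  qed
  ultimately show "0.2068 - 2 * w \<le> slope w + e" using t0(3) \<open>e > 0\<close> by simp
qed

lemma prof_le_energy: "0 < w \<Longrightarrow> w < 1 \<Longrightarrow> prof w \<le> energy"
  using prof_eq_energy[of w] energy_pos by simp

lemma slope_upper:
  assumes w: "0 < w" "w < 1" shows "slope w \<le> 0.207 - 1.978 * w"
proof (rule field_le_epsilon)
  fix e :: real assume "e > 0"
  define t0 where "t0 = min (e / 2) w"
  have t0: "0 < t0" "t0 \<le> w" "1.978 * t0 \<le> e" using \<open>e > 0\<close> w by (auto simp: t0_def)
  have "slope w - slope t0 \<le> - 1.978 * w - (- 1.978 * t0)"
  proof (rule increment_le[where h' = "\<lambda>t. - 1.978" and f' = "\<lambda>t. - 2 / prof t"])
    fix t assume "t0 < t" "t < w"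
    then show "- 2 / prof t \<le> - 1.978" using prof_le_energy[of t] prof_pos[of t] energy_bounds(2) t0 w
      by (simp add: field_simps)
  qed (use t0 w in \<open>auto intro!: slope_cont slope_deriv_minus continuous_intros derivative_eq_intros\<close>)
  then show "slope w \<le> 0.207 - 1.978 * w + e" using slope_le[of t0] t0 w by simp
qed

lemma prof_upper:
  assumes w: "0 \<le> w" "w \<le> 1" shows "prof w \<le> 1 + 0.207 * w - 0.989 * w\<^sup>2"
proof -
  have "prof w - prof 0 \<le> (0.207 * w - 0.989 * w\<^sup>2) - (0.207 * 0 - 0.989 * 0\<^sup>2)"
    by (rule increment_le[where h' = "\<lambda>t. 0.207 - 1.978 * t" and f' = slope])
      (use w slope_upper in \<open>auto intro!: prof_cont_sub prof_deriv continuous_intros derivative_eq_intros\<close>)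
  then show ?thesis by simp
qed

section \<open>The increasing part of the profile\<close>

abbreviation (input) beta0 :: real where "beta0 \<equiv> 0.50057"

text \<open>The surplus over the Euclidean norm: with \<open>\<epsilon> = 2 - 1 / \<beta>\<close> the term \<open>w powr (1 / \<beta>)\<close> is
\<open>w\<^sup>2 * w powr (- \<epsilon>)\<close>, which is at least \<open>w\<^sup>2 * (1 - \<epsilon> * ln w)\<close>, and \<open>2 * \<beta> * \<epsilon> = 4 * \<beta> - 2 = 0.00228\<close>.
The logarithm is replaced by its tangent at \<open>exp (-2) = 0.135...\<close>, close to the point where the
two-point inequality is tightest.\<close>

lemma power_gain_ge_square_gain:
  fixes a w \<beta> :: real
  assumes \<beta>: "\<beta> = beta0" and a: "a > 0" and w: "w > 0"
  shows "w\<^sup>2 * (1.00798 - 0.016848 * w + 0.00228 * ln a) \<le>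
    2 * \<beta> * a powr (2 - 1 / \<beta>) * w powr (1 / \<beta>)"
proof -
  let ?\<epsilon> = "2 - 1 / \<beta>"
  have "\<bar>exp 1 - 5837465777 / 2147483648\<bar> \<le> (inverse (2 ^ 32) :: real)" by (rule e_approx_32)
  then have "exp 1 - 5837465777 / 2147483648 \<le> (inverse (2 ^ 32) :: real)" by linarith
  then have "exp 1 \<le> (2.718282 :: real)" by simp
  then have "exp 1 * exp 1 \<le> (2.718282 * 2.718282 :: real)" by (intro mult_mono) auto
  then have e2: "exp 2 \<le> (7.389058 :: real)" by (simp flip: exp_add)
  have "ln (w * exp 2) \<le> w * exp 2 - 1" by (rule ln_le_minus_one) (use w in auto)
  then have "ln w \<le> w * exp 2 - 3" using w by (simp add: ln_mult)
  also have "w * exp 2 \<le> w * 7.389058" using w e2 by (intro mult_left_mono) auto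
  finally have lnw: "- ln w \<ge> 3 - 7.389058 * w" by simp
  have "w powr (1 / \<beta>) = w powr 2 * w powr (- ?\<epsilon>)" by (simp flip: powr_add)
  also have "w powr 2 = w\<^sup>2" using w by simp
  finally have "a powr ?\<epsilon> * w powr (1 / \<beta>) = w\<^sup>2 * (a powr ?\<epsilon> * w powr (- ?\<epsilon>))" by simp
  also have "a powr ?\<epsilon> * w powr (- ?\<epsilon>) = exp (?\<epsilon> * (ln a - ln w))"
    using a w by (simp add: powr_def algebra_simps flip: exp_add)
  finally have e: "2 * \<beta> * a powr ?\<epsilon> * w powr (1 / \<beta>) = w\<^sup>2 * (2 * \<beta> * exp (?\<epsilon> * (ln a - ln w)))" by simp
  have "2 * \<beta> * (1 + ?\<epsilon> * (ln a - ln w)) \<le> 2 * \<beta> * exp (?\<epsilon> * (ln a - ln w))"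
    using \<beta> by (intro mult_left_mono exp_ge_add_one_self) auto
  moreover have "2 * \<beta> * (1 + ?\<epsilon> * (ln a - ln w)) = 2 * \<beta> + (4 * \<beta> - 2) * (ln a - ln w)"
    using \<beta> by (simp add: field_simps)
  moreover have "1.00798 - 0.016848 * w + 0.00228 * ln a \<le> 2 * \<beta> + (4 * \<beta> - 2) * (ln a - ln w)"
    using lnw w unfolding \<beta> by (simp add: field_simps)
  ultimately have "1.00798 - 0.016848 * w + 0.00228 * ln a \<le> 2 * \<beta> * exp (?\<epsilon> * (ln a - ln w))" by linarith
  then show ?thesis unfolding e by (intro mult_left_mono) auto
qed

lemma power_tangent3:
  fixes w w0 m :: real
  assumes "w + 2 * w0 \<le> m"
  shows "w ^ 3 \<le> w0 ^ 3 + 3 * w0\<^sup>2 * (w - w0) + m * (w - w0)\<^sup>2"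
proof -
  have "w ^ 3 = w0 ^ 3 + 3 * w0\<^sup>2 * (w - w0) + (w + 2 * w0) * (w - w0)\<^sup>2"
    by (simp add: algebra_simps power2_eq_square power3_eq_cube)
  also have "(w + 2 * w0) * (w - w0)\<^sup>2 \<le> m * (w - w0)\<^sup>2" using assms by (intro mult_right_mono) auto
  finally show ?thesis by simp
qed

lemma power_tangent4:
  fixes w w0 m :: real
  assumes "w\<^sup>2 + 2 * w0 * w + 3 * w0\<^sup>2 \<le> m"
  shows "w ^ 4 \<le> w0 ^ 4 + 4 * w0 ^ 3 * (w - w0) + m * (w - w0)\<^sup>2"
    and "0 \<le> w \<Longrightarrow> 0 \<le> w0 \<Longrightarrow> w0 ^ 4 + 4 * w0 ^ 3 * (w - w0) \<le> w ^ 4"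
proof -
  have e: "w ^ 4 = w0 ^ 4 + 4 * w0 ^ 3 * (w - w0) + (w\<^sup>2 + 2 * w0 * w + 3 * w0\<^sup>2) * (w - w0)\<^sup>2"
    by (simp add: algebra_simps power_numeral_reduce)
  have "(w\<^sup>2 + 2 * w0 * w + 3 * w0\<^sup>2) * (w - w0)\<^sup>2 \<le> m * (w - w0)\<^sup>2"
    using assms by (intro mult_right_mono) auto
  then show "w ^ 4 \<le> w0 ^ 4 + 4 * w0 ^ 3 * (w - w0) + m * (w - w0)\<^sup>2" using e by simp
  show "w0 ^ 4 + 4 * w0 ^ 3 * (w - w0) \<le> w ^ 4" if "0 \<le> w" "0 \<le> w0" using e that by simp
qed

text \<open>For a Taylor polynomial \<open>L\<close> of a normalized solution with initial slope \<open>s\<close> and remainder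
\<open>c * w ^ 6\<close>, this is an upper bound for \<open>((2 * L (w/2) - 1)\<^sup>2 - (L w)\<^sup>2) / w\<^sup>2\<close>, written as difference times sum.
It is the coefficient of \<open>w\<^sup>2\<close> that the norm has to provide; it starts as \<open>1 + s * w / 2\<close>.\<close>

definition critical_ratio :: "real \<Rightarrow> real \<Rightarrow> real \<Rightarrow> real" where
  "critical_ratio s c w = (1/2 - s/4 * w + 7/48 * (1 + s\<^sup>2) * w\<^sup>2 - 0.218 * s * w ^ 3 + c * w ^ 4)
      * (2 + 2 * s * w - 1.5 * w\<^sup>2 + 5/12 * s * w ^ 3 - 0.174 * w ^ 4)"

lemma square_ge_tangent: "2 * w0 * w - w0\<^sup>2 \<le> (w::real)\<^sup>2"
  using zero_le_power2[of "w - w0"] by (simp add: power2_eq_square algebra_simps)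

text \<open>The tightest estimate: the difference of the two sides has a minimum of about \<open>4 / 100000\<close> near
\<open>w = 0.1335\<close>. Cubic and quartic terms are replaced by their tangents at this point,
after which a quadratic polynomial in \<open>w\<close> remains.\<close>

lemma critical_ratio_near:
  fixes w :: real assumes w: "0 < w" "w \<le> 0.16"
  shows "critical_ratio 0.207 0.126 w \<le> 1.00798 - 0.016848 * w"
proof -
  have e: "critical_ratio 0.207 0.126 w = 1 + 207/2000 * w - 2242849/4800000 * w\<^sup>2 + 747680067/8000000000 * w ^ 3
    - 345075281/4000000000 * w ^ 4 + 1817274689/12800000000 * w ^ 5 - 1754835287/8000000000 * w ^ 6
    + 292491/15625000 * w ^ 7 - 5481/250000 * w ^ 8"
    by (simp add: critical_ratio_def field_simps power_numeral_reduce)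
  have "w ^ 3 \<le> 0.1335 ^ 3 + 3 * 0.1335\<^sup>2 * (w - 0.1335) + 0.427 * (w - 0.1335)\<^sup>2"
    by (rule power_tangent3) (use w in simp)
  then have 3: "w ^ 3 \<le> 0.1335 ^ 3 + 3 * 0.1335\<^sup>2 * (w - 0.1335) + 0.427 * (w\<^sup>2 - 0.267 * w + 0.1335\<^sup>2)"
    by (simp add: power2_diff power2_eq_square field_simps)
  have 4: "0.1335 ^ 4 + 4 * 0.1335 ^ 3 * (w - 0.1335) \<le> w ^ 4" by (rule power_tangent4(2)[OF order_refl]) (use w in auto)
  have 5: "w ^ 5 \<le> 0.16 * w ^ 4" using mult_right_mono[of w "0.16" "w ^ 4"] w by (simp add: power_numeral_reduce)
  have 7: "w ^ 7 \<le> 0.16 * w ^ 6" using mult_right_mono[of w "0.16" "w ^ 6"] w by (simp add: power_numeral_reduce)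
  \<comment> \<open>The powers of \<open>w\<close> as independent variables \<open>a2, ..., a8\<close>: with the bounds above the claim is linear.\<close>
  have gen: "1 + 207/2000 * w - 2242849/4800000 * a2 + 747680067/8000000000 * a3
    - 345075281/4000000000 * a4 + 1817274689/12800000000 * a5 - 1754835287/8000000000 * a6
    + 292491/15625000 * a7 - 5481/250000 * a8 \<le> 1.00798 - 0.016848 * w"
    if "2 * 0.1335 * w - 0.1335\<^sup>2 \<le> a2" "a3 \<le> 0.1335 ^ 3 + 3 * 0.1335\<^sup>2 * (w - 0.1335) + 0.427 * (a2 - 0.267 * w + 0.1335\<^sup>2)"
      "0.1335 ^ 4 + 4 * 0.1335 ^ 3 * (w - 0.1335) \<le> a4" "a5 \<le> 0.16 * a4" "0 \<le> a6" "a7 \<le> 0.16 * a6" "0 \<le> a8"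
    for a2 a3 a4 a5 a6 a7 a8 :: real
    using that w by (simp add: field_simps power_numeral_reduce)
  show ?thesis unfolding e by (rule gen[OF square_ge_tangent 3 4 5 _ 7]) (use w in auto)
qed

text \<open>For smaller initial slopes there is room for a solution that has dropped below its initial value,
which costs at most \<open>0.00007\<close> in the coefficient.\<close>

lemma critical_ratio_flat:
  fixes w :: real assumes w: "0 < w" "w \<le> 0.16"
  shows "critical_ratio 0.165 0.126 w \<le> 1.00798 - 0.016848 * w - 0.00007"
proof -
  have e: "critical_ratio 0.165 0.126 w = 1 + 33/400 * w - 89089/192000 * w\<^sup>2 + 4719693/64000000 * w ^ 3
    - 11905841/160000000 * w ^ 4 + 34717133/307200000 * w ^ 5 - 69612407/320000000 * w ^ 6
    + 46629/3125000 * w ^ 7 - 5481/250000 * w ^ 8"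
    by (simp add: critical_ratio_def field_simps power_numeral_reduce)
  have 3: "w ^ 3 \<le> 0.16 * w\<^sup>2" using mult_right_mono[of w "0.16" "w\<^sup>2"] w by (simp add: power_numeral_reduce)
  have 5: "w ^ 5 \<le> 0.16 * w ^ 4" using mult_right_mono[of w "0.16" "w ^ 4"] w by (simp add: power_numeral_reduce)
  have 7: "w ^ 7 \<le> 0.16 * w ^ 6" using mult_right_mono[of w "0.16" "w ^ 6"] w by (simp add: power_numeral_reduce)
  have gen: "1 + 33/400 * w - 89089/192000 * a2 + 4719693/64000000 * a3
    - 11905841/160000000 * a4 + 34717133/307200000 * a5 - 69612407/320000000 * a6
    + 46629/3125000 * a7 - 5481/250000 * a8 \<le> 1.00798 - 0.016848 * w - 0.00007"
    if "2 * 0.11 * w - 0.11\<^sup>2 \<le> a2" "a3 \<le> 0.16 * a2"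
      "0 \<le> a4" "a5 \<le> 0.16 * a4" "0 \<le> a6" "a7 \<le> 0.16 * a6" "0 \<le> a8"
    for a2 a3 a4 a5 a6 a7 a8 :: real
    using that w by (simp add: field_simps power_numeral_reduce)
  show ?thesis unfolding e by (rule gen[OF square_ge_tangent 3 _ 5 _ 7]) (use w in auto)
qed

text \<open>At \<open>w = 0.16\<close> the margin is again about \<open>4 / 100000\<close>, but it increases from there on.\<close>

lemma critical_ratio_far:
  fixes w :: real assumes w: "0.16 \<le> w" "w \<le> 1/4"
  shows "critical_ratio 0.207 0.223 w \<le> 1.00798 - 0.016848 * w - 0.00018"
proof -
  have e: "critical_ratio 0.207 0.223 w = 1 + 207/2000 * w - 2242849/4800000 * w\<^sup>2 + 747680067/8000000000 * w ^ 3
    + 430924719/4000000000 * w ^ 4 + 2331297089/12800000000 * w ^ 5 - 2918835287/8000000000 * w ^ 6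
    + 13542837/500000000 * w ^ 7 - 19401/500000 * w ^ 8"
    by (simp add: critical_ratio_def field_simps power_numeral_reduce)
  have "w ^ 3 \<le> 0.16 ^ 3 + 3 * 0.16\<^sup>2 * (w - 0.16) + 0.57 * (w - 0.16)\<^sup>2"
    by (rule power_tangent3) (use w in simp)
  then have 3: "w ^ 3 \<le> 0.16 ^ 3 + 3 * 0.16\<^sup>2 * (w - 0.16) + 0.57 * (w\<^sup>2 - 0.32 * w + 0.16\<^sup>2)"
    by (simp add: power2_diff power2_eq_square field_simps)
  have "w * w \<le> 1/4 * (1/4)" using w by (intro mult_mono) auto
  then have "w ^ 4 \<le> 0.16 ^ 4 + 4 * 0.16 ^ 3 * (w - 0.16) + 0.22 * (w - 0.16)\<^sup>2"
    by (intro power_tangent4(1)) (use w in \<open>simp add: power2_eq_square\<close>)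
  then have 4: "w ^ 4 \<le> 0.16 ^ 4 + 4 * 0.16 ^ 3 * (w - 0.16) + 0.22 * (w\<^sup>2 - 0.32 * w + 0.16\<^sup>2)"
    by (simp add: power2_diff power2_eq_square field_simps)
  have 5: "w ^ 5 \<le> 1/4 * w ^ 4" using mult_right_mono[of w "1/4" "w ^ 4"] w by (simp add: power_numeral_reduce)
  have 7: "w ^ 7 \<le> 1/4 * w ^ 6" using mult_right_mono[of w "1/4" "w ^ 6"] w by (simp add: power_numeral_reduce)
  have gen: "1 + 207/2000 * w - 2242849/4800000 * a2 + 747680067/8000000000 * a3
    + 430924719/4000000000 * a4 + 2331297089/12800000000 * a5 - 2918835287/8000000000 * a6
    + 13542837/500000000 * a7 - 19401/500000 * a8 \<le> 1.00798 - 0.016848 * w - 0.00018"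
    if "2 * 0.16 * w - 0.16\<^sup>2 \<le> a2" "a3 \<le> 0.16 ^ 3 + 3 * 0.16\<^sup>2 * (w - 0.16) + 0.57 * (a2 - 0.32 * w + 0.16\<^sup>2)"
      "a4 \<le> 0.16 ^ 4 + 4 * 0.16 ^ 3 * (w - 0.16) + 0.22 * (a2 - 0.32 * w + 0.16\<^sup>2)"
      "a5 \<le> 1/4 * a4" "0 \<le> a6" "a7 \<le> 1/4 * a6" "0 \<le> a8"
    for a2 a3 a4 a5 a6 a7 a8 :: real
    using that w by (simp add: field_simps power_numeral_reduce)
  show ?thesis unfolding e by (rule gen[OF square_ge_tangent 3 4 5 _ 7]) (use w in auto)
qed

text \<open>From a base point \<open>x\<close> of positive slope, the solution is normalized to \<open>h\<close> with value \<open>1\<close> at \<open>0\<close> by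
the scaling symmetry of the equation. The slope \<open>q\<close> of \<open>h\<close> is that of \<open>prof\<close>, so the only parameter left is
\<open>s = q 0 \<in> (0, 0.207]\<close>.\<close>

context
  fixes x j s :: real and h q :: "real \<Rightarrow> real"
  assumes x: "0 < x" "x < 1" and spos: "slope x > 0"
  defines "j \<equiv> prof x" and "s \<equiv> slope x"
  defines "h \<equiv> \<lambda>t. prof (x + j * t) / j" and "q \<equiv> \<lambda>t. slope (x + j * t)"
begin

lemma base_small: "x \<le> 0.10466" using slope_upper[OF x] spos by simp

lemma j_bounds: "1 \<le> j" "j \<le> 1.0109"
  using prof_ge_1_of_slope_nonneg[OF x] spos prof_le_energy[OF x] energy_bounds by (auto simp: j_def)

lemma s_bounds: "0 < s" "s \<le> 0.207" using spos slope_le[OF x] by (auto simp: s_def)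

lemma shift_range:
  assumes "0 \<le> t" "t \<le> 1/4"
  shows "0 < x + j * t" "x + j * t < 1" "x + j * t \<le> 0.10466 + 1.0109 * t"
proof -
  have "j * t \<le> 1.0109 * t" using j_bounds assms by (intro mult_right_mono) auto
  then show 3: "x + j * t \<le> 0.10466 + 1.0109 * t" using base_small by simp
  then show "x + j * t < 1" using assms by simp
  have "0 \<le> j * t" using j_bounds assms by simp
  then show "0 < x + j * t" using x by simp
qed

lemma h_0: "h 0 = 1" and q_0: "q 0 = s"
  using j_bounds by (auto simp: h_def q_def s_def j_def)

lemma h_pos: "0 \<le> t \<Longrightarrow> t \<le> 1/4 \<Longrightarrow> h t > 0"
  using shift_range[of t] prof_pos[of "x + j * t"] j_bounds by (simp add: h_def)

lemma h_deriv:
  assumes "0 \<le> t" "t \<le> 1/4" shows "(h has_real_derivative q t) (at t)"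
proof -
  have "((\<lambda>t. x + j * t) has_real_derivative j) (at t)" by (auto intro!: derivative_eq_intros)
  from DERIV_cdivide[OF DERIV_chain2[OF prof_deriv this], of j] shift_range[OF assms]
  show ?thesis using j_bounds by (simp add: h_def q_def)
qed

lemma q_deriv:
  assumes "0 \<le> t" "t \<le> 1/4" shows "(q has_real_derivative - (2 / h t)) (at t)"
proof -
  have "((\<lambda>t. x + j * t) has_real_derivative j) (at t)" by (auto intro!: derivative_eq_intros)
  from DERIV_chain2[OF slope_deriv this] shift_range[OF assms]
  show ?thesis using j_bounds by (simp add: h_def q_def)
qed

text \<open>The derivatives of \<open>h\<close> up to order six, with the equation \<open>h'' = -2 / h\<close> used to eliminate all but
\<open>h\<close> and \<open>q = h'\<close>.\<close>

definition rescaled_deriv :: "nat \<Rightarrow> real \<Rightarrow> real" where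
  "rescaled_deriv n t = (if n = 0 then h t else if n = 1 then q t else if n = 2 then - (2 / h t)
    else if n = 3 then 2 * q t / h t ^ 2 else if n = 4 then - 4 * (1 + q t ^ 2) / h t ^ 3
    else if n = 5 then q t * (28 + 12 * q t ^ 2) / h t ^ 4
    else - (56 + 184 * q t ^ 2 + 48 * q t ^ 4) / h t ^ 5)"

lemma rescaled_deriv_step:
  assumes "n < 6" "0 \<le> t" "t \<le> 1/4"
  shows "(rescaled_deriv n has_real_derivative rescaled_deriv (Suc n) t) (at t)"
proof -
  note hd = h_deriv[OF assms(2,3)] and qd = q_deriv[OF assms(2,3)]
  have nz: "h t \<noteq> 0" using h_pos[OF assms(2,3)] by simp
  consider "n = 0" | "n = 1" | "n = 2" | "n = 3" | "n = 4" | "n = 5" using assms(1) by linarith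
  then show ?thesis
  proof cases
    case 1 then show ?thesis using hd unfolding 1 rescaled_deriv_def by simp
  next
    case 2 then show ?thesis using qd unfolding 2 rescaled_deriv_def by simp
  next
    case 3
    have "((\<lambda>t. - (2 / h t)) has_real_derivative 2 * q t / h t ^ 2) (at t)"
      using nz by (auto intro!: derivative_eq_intros hd simp: power2_eq_square)
    then show ?thesis unfolding 3 rescaled_deriv_def by simp
  next
    case 4
    have "((\<lambda>t. 2 * q t / h t ^ 2) has_real_derivative - 4 * (1 + q t ^ 2) / h t ^ 3) (at t)"
      using nz by (auto intro!: derivative_eq_intros hd qd simp: field_simps power_numeral_reduce)
    then show ?thesis unfolding 4 rescaled_deriv_def by simp
  next
    case 5
    have "((\<lambda>t. - 4 * (1 + q t ^ 2) / h t ^ 3) has_real_derivative q t * (28 + 12 * q t ^ 2) / h t ^ 4) (at t)"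
      using nz by (auto intro!: derivative_eq_intros hd qd simp: field_simps power_numeral_reduce)
    then show ?thesis unfolding 5 rescaled_deriv_def by simp
  next
    case 6
    have "((\<lambda>t. q t * (28 + 12 * q t ^ 2) / h t ^ 4) has_real_derivative - (56 + 184 * q t ^ 2 + 48 * q t ^ 4) / h t ^ 5) (at t)"
      using nz by (auto intro!: derivative_eq_intros hd qd simp: field_simps power_numeral_reduce)
    then show ?thesis unfolding 6 rescaled_deriv_def by simp
  qed
qed

lemma rescaled_upper:
  assumes v: "0 < v" "v \<le> 1/4"
  shows "h v \<le> 1 + s * v - v\<^sup>2 + s / 3 * v ^ 3 - (1 + s\<^sup>2) / 6 * v ^ 4 + 0.2377 * s * v ^ 5"
proof -
  obtain t where t: "0 < t" "t < v"
    "h v = (\<Sum>m<5. (rescaled_deriv m 0 / fact m) * v ^ m) + (rescaled_deriv 5 t / fact 5) * v ^ 5"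
    using Maclaurin[of v 5 rescaled_deriv h] v rescaled_deriv_step by (fastforce simp: rescaled_deriv_def[of 0])
  have t': "0 < x + j * t" "x + j * t < 1" "0 \<le> t" "t \<le> 1/4" using shift_range[of t] t v by auto
  have hp: "h t > 0" using h_pos t' by simp
  have "rescaled_deriv 5 t \<le> s * 28.52"
  proof (cases "q t \<ge> 0")
    case True
    have q1: "q t \<le> s"
      using slope_decreasing[of x "x + j * t"] x t' j_bounds by (simp add: q_def s_def)
    have "j \<le> prof (x + j * t)"
    proof -
      have "0 - 0 \<le> prof (x + j * t) - prof x"
      proof (rule increment_le[where f = "\<lambda>_. 0" and h = prof and f' = "\<lambda>_. 0" and h' = slope])
        show "0 \<le> slope y" if "x < y" "y < x + j * t" for y
          using slope_decreasing[of y "x + j * t"] that True t' x by (simp add: q_def)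
      qed (use x t' j_bounds in \<open>auto intro!: prof_cont_sub prof_deriv\<close>)
      then show ?thesis by (simp add: j_def)
    qed
    then have h1: "1 \<le> h t" using j_bounds by (simp add: h_def)
    have "(q t)\<^sup>2 \<le> 0.207\<^sup>2" using True q1 s_bounds by (intro power_mono) auto
    then have "q t * (28 + 12 * q t ^ 2) \<le> s * 28.52" using True q1 s_bounds
      by (intro mult_mono) (auto simp: power2_eq_square)
    moreover have "1 \<le> h t ^ 4" using h1 by simp
    moreover have "0 \<le> q t * (28 + 12 * q t ^ 2)" using True by (intro mult_nonneg_nonneg add_nonneg_nonneg) auto
    ultimately have "q t * (28 + 12 * q t ^ 2) / h t ^ 4 \<le> s * 28.52 / 1"
      using s_bounds by (intro frac_le) auto
    then show ?thesis by (simp add: rescaled_deriv_def)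
  next
    case False
    have "q t * (28 + 12 * q t ^ 2) \<le> 0" using False by (intro mult_nonpos_nonneg add_nonneg_nonneg) auto
    then have "rescaled_deriv 5 t \<le> 0" using hp by (simp add: rescaled_deriv_def divide_nonpos_pos)
    also have "0 \<le> s * 28.52" using s_bounds by simp
    finally show ?thesis .
  qed
  then have "rescaled_deriv 5 t * v ^ 5 \<le> s * 28.52 * v ^ 5" using v by (intro mult_right_mono) auto
  moreover have "0 \<le> s * v ^ 5" using v s_bounds by simp
  moreover have "h v = 1 + s * v - v\<^sup>2 + s / 3 * v ^ 3 - (1 + s\<^sup>2) / 6 * v ^ 4 + rescaled_deriv 5 t * v ^ 5 / 120"
    unfolding t(3) by (simp add: rescaled_deriv_def h_0 q_0 lessThan_nat_numeral fact_numeral sum.lessThan_Suc eval_nat_numeral field_simps)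
  ultimately show ?thesis by (simp add: algebra_simps)
qed

lemma rescaled_lower:
  assumes v: "0 < v" "v \<le> 1/4"
    and c: "\<And>t. 0 < t \<Longrightarrow> t < v \<Longrightarrow> 56 + 184 * q t ^ 2 + 48 * q t ^ 4 \<le> 720 * c * h t ^ 5"
  shows "1 + s * v - v\<^sup>2 + s / 3 * v ^ 3 - (1 + s\<^sup>2) / 6 * v ^ 4 + s * (28 + 12 * s\<^sup>2) / 120 * v ^ 5 - c * v ^ 6 \<le> h v"
proof -
  obtain t where t: "0 < t" "t < v"
    "h v = (\<Sum>m<6. (rescaled_deriv m 0 / fact m) * v ^ m) + (rescaled_deriv 6 t / fact 6) * v ^ 6"
    using Maclaurin[of v 6 rescaled_deriv h] v rescaled_deriv_step by (fastforce simp: rescaled_deriv_def[of 0])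
  have "h t > 0" using h_pos t v by simp
  with c[OF t(1,2)] have "- 720 * c \<le> rescaled_deriv 6 t" by (simp add: rescaled_deriv_def pos_le_divide_eq)
  then have "- 720 * c * v ^ 6 \<le> rescaled_deriv 6 t * v ^ 6" using v by (intro mult_right_mono) auto
  moreover have "h v = 1 + s * v - v\<^sup>2 + s / 3 * v ^ 3 - (1 + s\<^sup>2) / 6 * v ^ 4
      + s * (28 + 12 * s\<^sup>2) / 120 * v ^ 5 + rescaled_deriv 6 t * v ^ 6 / 720"
    unfolding t(3) by (simp add: rescaled_deriv_def h_0 q_0 lessThan_nat_numeral fact_numeral sum.lessThan_Suc eval_nat_numeral field_simps)
  ultimately show ?thesis by simp
qed

lemma rescaled_range:
  assumes t: "0 < t" "t \<le> 1/4"
  shows "h t \<ge> 0.9335" "56 + 184 * q t ^ 2 + 48 * q t ^ 4 \<le> 720 * 0.223 * h t ^ 5"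
    "t \<le> 0.16 \<Longrightarrow> 56 + 184 * q t ^ 2 + 48 * q t ^ 4 \<le> 720 * 0.126 * h t ^ 5"
    "t \<le> 0.16 \<Longrightarrow> h t \<ge> 0.971"
proof -
  let ?y = "x + j * t"
  note y = shift_range[of t]
  have *: "h t \<ge> a / 1.0109 \<and> q t ^ 2 \<le> 4 * (1.0109 / a - 1)"
    if "?y \<le> Y" "Y \<le> 1/2" "0.1 \<le> Y" "0 < a" "a \<le> 1" "a \<le> 1 + Y / 5 - Y\<^sup>2" for Y a
  proof
    have "0 \<le> (Y - ?y) * (Y + ?y - 1/5) \<or> ?y \<le> 1/5"
      using that y t by (cases "?y \<le> 1/5") auto
    then have "a \<le> 1 + ?y / 5 - ?y\<^sup>2"
    proof
      assume "0 \<le> (Y - ?y) * (Y + ?y - 1/5)"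
      then have "1 + Y / 5 - Y\<^sup>2 \<le> 1 + ?y / 5 - ?y\<^sup>2" by (simp add: field_simps power2_eq_square)
      with that show ?thesis by simp
    next
      assume "?y \<le> 1/5"
      then have "0 \<le> ?y * (1/5 - ?y)" using y t by simp
      then have "0 \<le> ?y / 5 - ?y\<^sup>2" by (simp add: power2_eq_square algebra_simps)
      with that(5) show ?thesis by linarith
    qed
    also have "\<dots> \<le> prof ?y" using prof_ge_parabola[of ?y] y t that by simp
    finally have p: "a \<le> prof ?y" .
    then show "h t \<ge> a / 1.0109" unfolding h_def using j_bounds that by (intro frac_le) auto
    have "a * (1 + q t ^ 2 / 4) \<le> prof ?y * exp (q t ^ 2 / 4)"
      using p that by (intro mult_mono) auto
    also have "\<dots> \<le> 1.0109" using prof_energy[of ?y] y t energy_bounds by (simp add: q_def)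
    finally show "q t ^ 2 \<le> 4 * (1.0109 / a - 1)" using that by (simp add: field_simps)
  qed
  have 1: "h t \<ge> 0.9437 / 1.0109 \<and> q t ^ 2 \<le> 4 * (1.0109 / 0.9437 - 1)"
    by (rule *[of "0.3574"]) (use y t in \<open>auto simp: power2_eq_square\<close>)
  then show h1: "h t \<ge> 0.9335" by simp
  have fin: "56 + 184 * q t ^ 2 + 48 * q t ^ 4 \<le> 720 * c * h t ^ 5"
    if "q t ^ 2 \<le> Q" "a \<le> h t" "0 \<le> a" "0 \<le> c" "56 + 184 * Q + 48 * Q\<^sup>2 \<le> 720 * c * a ^ 5" for Q a c
  proof -
    have "(q t ^ 2)\<^sup>2 \<le> Q\<^sup>2" using that by (intro power_mono) auto
    then have "56 + 184 * q t ^ 2 + 48 * q t ^ 4 \<le> 56 + 184 * Q + 48 * Q\<^sup>2" using that by simp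
    also have "\<dots> \<le> 720 * c * a ^ 5" by fact
    also have "\<dots> \<le> 720 * c * h t ^ 5" using that by (intro mult_left_mono power_mono) auto
    finally show ?thesis .
  qed
  show "56 + 184 * q t ^ 2 + 48 * q t ^ 4 \<le> 720 * 0.223 * h t ^ 5"
    by (rule fin[of "0.2849" "0.9335"]) (use 1 in \<open>auto simp: power_numeral_reduce\<close>)
  assume t2: "t \<le> 0.16"
  have 2: "h t \<ge> 0.9822 / 1.0109 \<and> q t ^ 2 \<le> 4 * (1.0109 / 0.9822 - 1)"
    by (rule *[of "0.2665"]) (use y t t2 in \<open>auto simp: power2_eq_square\<close>)
  then show "h t \<ge> 0.971" by simp
  show "56 + 184 * q t ^ 2 + 48 * q t ^ 4 \<le> 720 * 0.126 * h t ^ 5"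
    by (rule fin[of "0.1169" "0.9716"]) (use 2 in \<open>auto simp: power_numeral_reduce\<close>)
qed

text \<open>With \<open>T\<close> and \<open>L0\<close> the Taylor bounds for \<open>2 * U - 1\<close> and \<open>L\<close>, the difference of squares factors
into \<open>(T - L0) * (T + L0)\<close>, at most \<open>w\<^sup>2\<close> times \<open>critical_ratio\<close> at \<open>s\<close>. The latter increases
with \<open>s\<close>, so the slope may be replaced by an upper bound \<open>s'\<close>.\<close>

lemma square_gap_from_taylor:
  fixes L U w c k :: real
  assumes w: "0 < w" "w \<le> 1/4" and s': "s \<le> s'" "s' \<le> 0.207"
    and L: "1 + s * w - w\<^sup>2 + s / 3 * w ^ 3 - (1 + s\<^sup>2) / 6 * w ^ 4 + s * (28 + 12 * s\<^sup>2) / 120 * w ^ 5 - c * w ^ 6 \<le> L"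
    and U: "U \<le> 1 + s * (w/2) - (w/2)\<^sup>2 + s / 3 * (w/2) ^ 3 - (1 + s\<^sup>2) / 6 * (w/2) ^ 4 + 0.2377 * s * (w/2) ^ 5"
    and c: "0 \<le> c" "c \<le> 1" and LU: "0 \<le> L" "0 \<le> 2 * U - 1"
    and k: "critical_ratio s' c w \<le> k"
  shows "(2 * U - 1)\<^sup>2 \<le> L\<^sup>2 + k * w\<^sup>2"
proof -
  define a where "a = (\<lambda>s. 1/2 - s/4 * w + 7/48 * (1 + s\<^sup>2) * w\<^sup>2 - 0.218 * s * w ^ 3 + c * w ^ 4)"
  define m where "m = (\<lambda>s. 2 + 2 * s * w - 1.5 * w\<^sup>2 + 5/12 * s * w ^ 3 - 0.174 * w ^ 4)"
  define L0 where "L0 = 1 + s * w - w\<^sup>2 + s / 3 * w ^ 3 - (1 + s\<^sup>2) / 6 * w ^ 4 + s * (28 + 12 * s\<^sup>2) / 120 * w ^ 5 - c * w ^ 6"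
  define T where "T = 1 + s * w - w\<^sup>2 / 2 + s / 12 * w ^ 3 - (1 + s\<^sup>2) / 48 * w ^ 4 + 0.2377 / 16 * s * w ^ 5"
  have s: "0 < s" "s \<le> 0.207" by (fact s_bounds)+
  have UT: "2 * U - 1 \<le> T" using U by (simp add: T_def power_divide)
  have s2: "s\<^sup>2 \<le> 0.207\<^sup>2" "s'\<^sup>2 \<le> 0.207\<^sup>2" using s s' by (auto intro!: power_mono)
  have w2: "w\<^sup>2 \<le> (1/4)\<^sup>2" "w ^ 3 \<le> (1/4) ^ 3" "w ^ 4 \<le> (1/4) ^ 4" using w by (auto intro!: power_mono)
  have sw: "s * w \<le> 0.207 * (1/4)" "s' * w \<le> 0.207 * (1/4)" using mult_mono[of s "0.207" w "1/4"] mult_mono[of s' "0.207" w "1/4"] s s' w by auto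
  have "T - L0 = w\<^sup>2 * (1/2 - s/4 * w + 7/48 * (1 + s\<^sup>2) * w\<^sup>2
      - s * (28/120 - 0.2377/16 + s\<^sup>2 / 10) * w ^ 3 + c * w ^ 4)"
    by (simp add: T_def L0_def field_simps power_numeral_reduce)
  also have "\<dots> \<le> w\<^sup>2 * a s"
  proof (intro mult_left_mono)
    have "(0.218::real) - (28/120 - 0.2377/16) \<le> 0" by simp
    also have "0 \<le> s\<^sup>2 / 10" by simp
    finally have "0.218 \<le> 28/120 - 0.2377/16 + s\<^sup>2 / 10" by (simp only: diff_le_eq add.commute)
    then have "0.218 * (s * w ^ 3) \<le> (28/120 - 0.2377/16 + s\<^sup>2 / 10) * (s * w ^ 3)"
      using s w by (intro mult_right_mono) simp_all
    then show "1/2 - s/4 * w + 7/48 * (1 + s\<^sup>2) * w\<^sup>2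
      - s * (28/120 - 0.2377/16 + s\<^sup>2 / 10) * w ^ 3 + c * w ^ 4 \<le> a s"
      by (simp add: a_def mult_ac)
  qed auto
  finally have d: "T - L0 \<le> w\<^sup>2 * a s" .
  have "T + L0 = m s + w ^ 4 * (0.174 - 3/16 * (1 + s\<^sup>2) + s * w * (28/120 + 0.2377/16 + s\<^sup>2 / 10) - c * w\<^sup>2)"
    by (simp add: T_def L0_def m_def field_simps power_numeral_reduce)
  also have "\<dots> \<le> m s + w ^ 4 * 0"
  proof (intro add_left_mono mult_left_mono)
    have "s * w * (28/120 + 0.2377/16 + s\<^sup>2 / 10) \<le> 0.207 * (1/4) * (28/120 + 0.2377/16 + 0.207\<^sup>2 / 10)"
      using sw s2 s w by (intro mult_mono) auto
    moreover have "0.174 - 3/16 * (1 + S) + A - C \<le> 0"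
      if "A \<le> 0.207 * (1/4) * (28/120 + 0.2377/16 + 0.207\<^sup>2 / 10)" "0 \<le> S" "0 \<le> C" for A S C :: real
      using that by (simp add: field_simps)
    ultimately show "0.174 - 3/16 * (1 + s\<^sup>2) + s * w * (28/120 + 0.2377/16 + s\<^sup>2 / 10) - c * w\<^sup>2 \<le> 0"
      using c by (meson zero_le_power2 mult_nonneg_nonneg)
  qed (use w in auto)
  finally have p: "T + L0 \<le> m s" by simp
  define \<sigma> where "\<sigma> = s' - s"
  define \<alpha> where "\<alpha> = w/4 - 7/48 * (s + s') * w\<^sup>2 + 0.218 * w ^ 3"
  define \<gamma> where "\<gamma> = 2 * w + 5/12 * w ^ 3"
  have \<sigma>: "\<sigma> \<ge> 0" using s' by (simp add: \<sigma>_def)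
  have a: "a s = a s' + \<sigma> * \<alpha>" by (simp add: a_def \<sigma>_def \<alpha>_def field_simps power_numeral_reduce)
  have m: "m s = m s' - \<sigma> * \<gamma>" by (simp add: m_def \<sigma>_def \<gamma>_def field_simps power_numeral_reduce)
  have nn: "0 \<le> s' * w ^ 3" "0 \<le> s'\<^sup>2 * w\<^sup>2" "0 \<le> c * w ^ 4" "0 \<le> w ^ 3" "0 \<le> w\<^sup>2" "0 \<le> w ^ 4" using s s' w c by auto
  have s'w3: "s' * w ^ 3 \<le> 0.207 * (1/4) ^ 3" using s s' w w2 by (intro mult_mono) auto
  have s'w: "0 \<le> s' * w" using s s' w by simp
  have a_low: "a s' \<ge> 0.48"
  proof -
    have "0.48 \<le> 1/2 - A/4 + 7/48 * X - 0.218 * B + C"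
      if "A \<le> 0.207 * (1/4)" "0 \<le> X" "B \<le> 0.207 * (1/4) ^ 3" "0 \<le> C" for A X B C :: real
      using that by (simp add: power3_eq_cube)
    from this[OF sw(2) _ s'w3 nn(3), of "(1 + s'\<^sup>2) * w\<^sup>2"] show ?thesis
      by (simp add: a_def mult_ac)
  qed
  have m_up: "m s' \<le> 2.11"
  proof -
    have "2 + 2 * A - 1.5 * X + 5/12 * B - 0.174 * C \<le> 2.11"
      if "A \<le> 0.207 * (1/4)" "0 \<le> X" "B \<le> 0.207 * (1/4) ^ 3" "0 \<le> C" for A X B C :: real
      using that by (simp add: power3_eq_cube)
    from this[OF sw(2) nn(5) s'w3 nn(6)] show ?thesis by (simp add: m_def mult_ac)
  qed
  have m_low: "m s \<ge> 0"
  proof -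
    have "0 \<le> 2 + 2 * A - 1.5 * X + 5/12 * B - 0.174 * C"
      if "0 \<le> A" "X \<le> (1/4)\<^sup>2" "0 \<le> B" "C \<le> (1/4) ^ 4" for A X B C :: real
      using that by (simp add: power_numeral_reduce)
    from this[OF _ w2(1) _ w2(3), of "s * w" "s * w ^ 3"] show ?thesis using s w by (simp add: m_def mult_ac)
  qed
  have \<alpha>_up: "\<alpha> \<le> w/4 + 0.218 * w ^ 3" using s s' by (simp add: \<alpha>_def)
  have w3: "w ^ 3 \<le> w / 16"
  proof -
    have "w * w\<^sup>2 \<le> w * (1/4)\<^sup>2" using w w2 by (intro mult_left_mono) auto
    then show ?thesis by (simp add: power2_eq_square power3_eq_cube)
  qed
  have \<alpha>_pos: "\<alpha> \<ge> 0"
  proof -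
    have "(s + s') * w\<^sup>2 \<le> 0.414 * w\<^sup>2" using s s' by (intro mult_right_mono) auto
    also have "0.414 * w\<^sup>2 \<le> w"
      using w mult_right_mono[of w "1/4" w] by (simp add: power2_eq_square)
    finally have "(s + s') * w\<^sup>2 \<le> w" .
    moreover have "0 \<le> w/4 - 7/48 * Y + 0.218 * Z" if "Y \<le> w" "0 \<le> Z" for Y Z using that w by simp
    ultimately show ?thesis using nn(4) unfolding \<alpha>_def by (metis mult.assoc)
  qed
  have "a s * m s = a s' * m s' + \<sigma> * (\<alpha> * m s' - a s' * \<gamma>) - (\<sigma> * \<sigma>) * (\<alpha> * \<gamma>)"
    unfolding a m by (simp add: algebra_simps)
  also have "\<dots> \<le> a s' * m s' + \<sigma> * 0 - 0"
  proof (intro diff_mono add_left_mono mult_left_mono)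
    have "\<alpha> * m s' \<le> (w/4 + 0.218 * w ^ 3) * 2.11"
      using \<alpha>_up \<alpha>_pos m_up by (meson mult_left_mono mult_right_mono order_trans zero_le_numeral divide_nonneg_nonneg zero_le_power)
    also have "\<dots> \<le> 0.48 * \<gamma>" using w3 w nn unfolding \<gamma>_def by simp
    also have "\<dots> \<le> a s' * \<gamma>" using a_low w nn unfolding \<gamma>_def by (intro mult_right_mono) auto
    finally show "\<alpha> * m s' - a s' * \<gamma> \<le> 0" by simp
    show "0 \<le> \<sigma> * \<sigma> * (\<alpha> * \<gamma>)" using \<sigma> \<alpha>_pos w nn unfolding \<gamma>_def by (intro mult_nonneg_nonneg) auto
  qed (fact \<sigma>)
  also have "\<dots> \<le> k" using k by (simp add: a_def m_def critical_ratio_def)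
  finally have am: "a s * m s \<le> k" .
  have a_pos: "0 \<le> a s" unfolding a using a_low \<sigma> \<alpha>_pos by simp
  have "T\<^sup>2 - L0\<^sup>2 = (T - L0) * (T + L0)" by (simp add: algebra_simps power2_eq_square)
  show ?thesis
  proof (cases "2 * U - 1 \<le> L")
    case True
    then have "(2 * U - 1)\<^sup>2 \<le> L\<^sup>2" using LU by (intro power_mono) auto
    moreover have "0 \<le> k * w\<^sup>2" using am a_pos m_low by (meson mult_nonneg_nonneg order_trans zero_le_power2)
    ultimately show ?thesis by simp
  next
    case False
    have dd: "2 * U - 1 - L \<le> w\<^sup>2 * a s" using d UT L unfolding L0_def[symmetric] by simp
    have pp: "2 * U - 1 + L \<le> m s + (L - L0)" using p UT by simp
    have "(2 * U - 1)\<^sup>2 - L\<^sup>2 = (2 * U - 1 - L) * (2 * U - 1 + L)" by (simp add: algebra_simps power2_eq_square)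
    also have "\<dots> \<le> (T - L) * (T + L)"
      using UT False LU by (intro mult_mono) auto
    also have "\<dots> = T\<^sup>2 - L\<^sup>2" by (simp add: algebra_simps power2_eq_square)
    also have "\<dots> \<le> T\<^sup>2 - L0\<^sup>2"
    proof -
      have "0 \<le> L0"
      proof -
        have "w ^ 6 \<le> (1/4) ^ 6" using w by (intro power_mono) auto
        then have "c * w ^ 6 \<le> 1 * (1/4) ^ 6" using c w by (intro mult_mono) auto
        moreover have "(1 + s\<^sup>2) / 6 * w ^ 4 \<le> 2 / 6 * (1/4) ^ 4" using w2 s2 nn by (intro mult_mono) (auto simp: power2_eq_square)
        moreover have "0 \<le> s * w" "0 \<le> s / 3 * w ^ 3" "0 \<le> s * (28 + 12 * s\<^sup>2) / 120 * w ^ 5" using s w by auto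
        moreover have "0 \<le> 1 + A1 - A2 + A3 - A4 + A5 - A6"
          if "A6 \<le> 1 * (1/4) ^ 6" "A4 \<le> 2 / 6 * (1/4) ^ 4" "0 \<le> A1" "0 \<le> A3" "0 \<le> A5" "A2 \<le> (1/4)\<^sup>2"
          for A1 A2 A3 A4 A5 A6 :: real
          using that by (simp add: power_numeral_reduce)
        ultimately show ?thesis using w2(1) unfolding L0_def by blast
      qed
      then have "L0\<^sup>2 \<le> L\<^sup>2" using L unfolding L0_def[symmetric] by (intro power_mono) auto
      then show ?thesis by simp
    qed
    also have "\<dots> = (T - L0) * (T + L0)" by (simp add: algebra_simps power2_eq_square)
    also have "\<dots> \<le> (w\<^sup>2 * a s) * m s"
    proof (rule order_trans)
      have "T - L0 \<ge> 0" using False UT L unfolding L0_def[symmetric] by simp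
      then show "(T - L0) * (T + L0) \<le> (T - L0) * m s" using p by (intro mult_left_mono) auto
      show "(T - L0) * m s \<le> (w\<^sup>2 * a s) * m s" using d m_low by (intro mult_right_mono) auto
    qed
    also have "\<dots> = w\<^sup>2 * (a s * m s)" by simp
    also have "\<dots> \<le> w\<^sup>2 * k" using am by (intro mult_left_mono) auto
    finally show ?thesis by (simp add: mult.commute)
  qed
qed

text \<open>The two-point inequality for close points in the increasing part, in squared form. The term
\<open>ln (h w)\<close> in the gain is nonnegative when \<open>s\<close> is large, since then \<open>h w \<ge> 1\<close>; otherwise it costs
little and \<open>critical_ratio\<close> is smaller.\<close>

lemma rescaled_near:
  assumes \<beta>: "\<beta> = beta0" and w: "0 < w" "w \<le> 1/4"
  shows "(2 * h (w/2) - 1)\<^sup>2 \<le> (h w)\<^sup>2 + 2 * \<beta> * h w powr (2 - 1 / \<beta>) * w powr (1 / \<beta>)"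
proof -
  have hw: "h w \<ge> 0.9335" by (rule rescaled_range(1)) (use w in auto)
  have hv: "h (w/2) \<ge> 0.9335" by (rule rescaled_range(1)) (use w in auto)
  have U: "h (w/2) \<le> 1 + s * (w/2) - (w/2)\<^sup>2 + s / 3 * (w/2) ^ 3 - (1 + s\<^sup>2) / 6 * (w/2) ^ 4 + 0.2377 * s * (w/2) ^ 5"
    by (rule rescaled_upper) (use w in auto)
  let ?k = "1.00798 - 0.016848 * w + 0.00228 * ln (h w)"
  have ln_ge: "ln (h w) \<ge> 1 - 1 / h w"
    using ln_le_minus_one[of "1 / h w"] hw by (simp add: ln_div)
  have main: "(2 * h (w/2) - 1)\<^sup>2 \<le> (h w)\<^sup>2 + ?k * w\<^sup>2"
  proof (cases "w \<le> 0.16")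
    case True
    have L: "1 + s * w - w\<^sup>2 + s / 3 * w ^ 3 - (1 + s\<^sup>2) / 6 * w ^ 4 + s * (28 + 12 * s\<^sup>2) / 120 * w ^ 5 - 0.126 * w ^ 6 \<le> h w"
      by (rule rescaled_lower) (use w True rescaled_range(3) in auto)
    show ?thesis
    proof (cases "s \<le> 0.165")
      case s: True
      have "h w \<ge> 0.971" by (rule rescaled_range(4)) (use w True in auto)
      then have "1 / h w \<le> 1 / 0.971" by (intro divide_left_mono) auto
      then have "ln (h w) \<ge> -0.03" using ln_ge by simp
      then have "critical_ratio 0.165 0.126 w \<le> ?k" using critical_ratio_flat[OF w(1) True] by simp
      then show ?thesis by (intro square_gap_from_taylor[OF w s _ L U]) (use hw hv in auto)
    next
      case s: False
      have "1 \<le> h w"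
      proof -
        have "s\<^sup>2 \<le> 0.207\<^sup>2" using s_bounds by (intro power_mono) auto
        then have "(1 + s\<^sup>2) / 6 * w ^ 3 \<le> 1.05 / 6 * 0.16 ^ 3"
          using w True by (intro mult_mono power_mono) (auto simp: power2_eq_square)
        moreover have "w ^ 5 \<le> 0.16 ^ 5" using w True by (intro power_mono) auto
        moreover have "0 \<le> s / 3 * w\<^sup>2" "0 \<le> s * (28 + 12 * s\<^sup>2) / 120 * w ^ 4" using s_bounds w by auto
        moreover have "0 \<le> s - w + A2 - A3 + A4 - 0.126 * A5"
          if "A3 \<le> 1.05 / 6 * 0.16 ^ 3" "A5 \<le> 0.16 ^ 5" "0 \<le> A2" "0 \<le> A4" for A2 A3 A4 A5 :: real
          using that s True by (simp add: power_numeral_reduce)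
        ultimately have "0 \<le> s - w + s / 3 * w\<^sup>2 - (1 + s\<^sup>2) / 6 * w ^ 3 + s * (28 + 12 * s\<^sup>2) / 120 * w ^ 4 - 0.126 * w ^ 5"
          by blast
        then have "0 \<le> w * (s - w + s / 3 * w\<^sup>2 - (1 + s\<^sup>2) / 6 * w ^ 3 + s * (28 + 12 * s\<^sup>2) / 120 * w ^ 4 - 0.126 * w ^ 5)"
          using w by simp
        also have "\<dots> = (1 + s * w - w\<^sup>2 + s / 3 * w ^ 3 - (1 + s\<^sup>2) / 6 * w ^ 4 + s * (28 + 12 * s\<^sup>2) / 120 * w ^ 5 - 0.126 * w ^ 6) - 1"
          by (simp add: field_simps power_numeral_reduce)
        also have "\<dots> \<le> h w - 1" using L by simp
        finally show ?thesis by simp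
      qed
      then have "ln (h w) \<ge> 0" by simp
      then have "critical_ratio 0.207 0.126 w \<le> ?k" using critical_ratio_near[OF w(1) True] by simp
      then show ?thesis by (intro square_gap_from_taylor[OF w s_bounds(2) _ L U]) (use hw hv in auto)
    qed
  next
    case False
    have L: "1 + s * w - w\<^sup>2 + s / 3 * w ^ 3 - (1 + s\<^sup>2) / 6 * w ^ 4 + s * (28 + 12 * s\<^sup>2) / 120 * w ^ 5 - 0.223 * w ^ 6 \<le> h w"
      by (rule rescaled_lower) (use w rescaled_range(2) in auto)
    have "1 / h w \<le> 1 / 0.9335" using hw by (intro divide_left_mono) auto
    then have "ln (h w) \<ge> -0.0713" using ln_ge by simp
    then have "critical_ratio 0.207 0.223 w \<le> ?k" using critical_ratio_far[of w] w False by simp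
    then show ?thesis by (intro square_gap_from_taylor[OF w s_bounds(2) _ L U]) (use hw hv in auto)
  qed
  also have "?k * w\<^sup>2 \<le> 2 * \<beta> * h w powr (2 - 1 / \<beta>) * w powr (1 / \<beta>)"
    using power_gain_ge_square_gain[OF \<beta>, of "h w" w] hw w by (simp add: mult.commute)
  finally show ?thesis by simp
qed

end

section \<open>The two-point inequality for the profile\<close>

lemma pnorm_ge_sqrt:
  assumes p: "1 \<le> p" "p \<le> 2" and ab: "0 \<le> a" "0 \<le> b"
  shows "sqrt (a\<^sup>2 + b\<^sup>2) \<le> pnorm p a b"
proof (cases "pnorm p a b = 0")
  case True
  then have "a powr p + b powr p = 0" by (simp add: pnorm_def)
  moreover have "a powr p \<ge> 0" "b powr p \<ge> 0" by auto
  ultimately have "a powr p = 0" "b powr p = 0" by linarith+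
  then show ?thesis by (simp add: pnorm_nonneg)
next
  case False
  define N where "N = pnorm p a b"
  have N: "N > 0" using False pnorm_nonneg[of p a b] by (simp add: N_def)
  have Np: "N powr p = a powr p + b powr p" unfolding N_def by (rule pnorm_powr) (use p in auto)
  have *: "(u / N)\<^sup>2 \<le> (u / N) powr p" if "u \<ge> 0" "u powr p \<le> N powr p" for u
  proof -
    have "u \<le> N" using that N p powr_less_mono2[of p N u] by (metis less_le_trans zero_less_one not_le order.asym less_imp_le)
    then have "u / N \<le> 1" using N by simp
    then have "(u / N) powr 2 \<le> (u / N) powr p" using p that N by (intro powr_mono') auto
    then show ?thesis using that N by (cases "u = 0") auto
  qed
  have "(a / N)\<^sup>2 + (b / N)\<^sup>2 \<le> (a / N) powr p + (b / N) powr p"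
    using *[of a] *[of b] ab Np by (intro add_mono) auto
  also have "\<dots> = (a powr p + b powr p) / N powr p"
    using N ab by (simp only: powr_divide add_divide_distrib less_imp_le)
  also have "\<dots> = N powr p / N powr p" by (simp only: Np)
  also have "\<dots> = 1" using N by simp
  finally have "a\<^sup>2 + b\<^sup>2 \<le> N\<^sup>2" using N by (simp add: field_simps)
  then show ?thesis using N unfolding N_def by (intro real_le_lsqrt) auto
qed

text \<open>Bernoulli's inequality \<open>(1 + r) powr (2 * \<beta>) \<ge> 1 + 2 * \<beta> * r\<close> for \<open>r = (b / a) powr (1 / \<beta>)\<close>.\<close>

lemma pnorm_sq_ge:
  assumes \<beta>: "1/2 \<le> \<beta>" and a: "0 < a" and b: "0 \<le> b"
  shows "a\<^sup>2 + 2 * \<beta> * a powr (2 - 1 / \<beta>) * b powr (1 / \<beta>) \<le> (pnorm (1 / \<beta>) a b)\<^sup>2"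
proof -
  define r where "r = (b / a) powr (1 / \<beta>)"
  have r: "r \<ge> 0" by (simp add: r_def)
  have r1: "0 < 1 + 2 * \<beta> * r" using \<beta> r by (intro add_pos_nonneg) auto
  have "(1 + 2 * \<beta> * r) powr (1 / (2 * \<beta>)) * 1 powr (1 - 1 / (2 * \<beta>)) \<le>
      1 / (2 * \<beta>) * (1 + 2 * \<beta> * r) + (1 - 1 / (2 * \<beta>)) * 1"
    by (rule Youngs_inequality_0) (use \<beta> r1 in auto)
  also have "\<dots> = 1 + r" using \<beta> by (simp add: field_simps)
  finally have "(1 + 2 * \<beta> * r) powr (1 / (2 * \<beta>)) \<le> 1 + r" by simp
  then have "((1 + 2 * \<beta> * r) powr (1 / (2 * \<beta>))) powr (2 * \<beta>) \<le> (1 + r) powr (2 * \<beta>)"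
    using \<beta> by (intro powr_mono2) auto
  moreover have "((1 + 2 * \<beta> * r) powr (1 / (2 * \<beta>))) powr (2 * \<beta>) = 1 + 2 * \<beta> * r"
    using \<beta> r1 by (simp add: powr_powr)
  ultimately have B: "1 + 2 * \<beta> * r \<le> (1 + r) powr (2 * \<beta>)" by simp
  have n: "pnorm (1 / \<beta>) a b = a * (1 + r) powr \<beta>"
  proof -
    have "pnorm (1 / \<beta>) (a * 1) (a * (b / a)) = a * pnorm (1 / \<beta>) 1 (b / a)"
      using \<beta> a b by (intro pnorm_scale) auto
    then show ?thesis using a by (simp add: pnorm_def r_def)
  qed
  have "((1 + r) powr \<beta>)\<^sup>2 = (1 + r) powr (2 * \<beta>)"
    by (simp add: power2_eq_square flip: powr_add)
  then have "(pnorm (1 / \<beta>) a b)\<^sup>2 = a\<^sup>2 * (1 + r) powr (2 * \<beta>)" by (simp add: n power_mult_distrib)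
  moreover have "a\<^sup>2 * (1 + 2 * \<beta> * r) = a\<^sup>2 + 2 * \<beta> * a powr (2 - 1 / \<beta>) * b powr (1 / \<beta>)"
  proof -
    have "a powr 2 * r = a powr (2 - 1 / \<beta>) * b powr (1 / \<beta>)"
      using a b by (simp add: r_def powr_divide powr_diff)
    then show ?thesis using a by (simp add: algebra_simps)
  qed
  ultimately show ?thesis using B a by (metis mult_left_mono zero_le_power2)
qed

lemma prof_decreasing:
  assumes "0 \<le> a" "a \<le> b" "b \<le> 1" "\<And>m. a < m \<Longrightarrow> m < b \<Longrightarrow> slope m \<le> 0"
  shows "prof b \<le> prof a"
proof -
  have "prof b - prof a \<le> 0 - 0"
    by (rule increment_le[where f = prof and h = "\<lambda>_. 0" and f' = slope and h' = "\<lambda>_. 0"])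
      (use assms in \<open>auto intro!: prof_cont_sub prof_deriv\<close>)
  then show ?thesis by simp
qed

text \<open>The global step. Write \<open>m\<close> for the midpoint of \<open>x\<close> and \<open>z\<close>. As \<open>prof\<close> decreases on \<open>[m, z]\<close>,
\<open>slope m - slope z\<close>, the integral of \<open>2 / prof\<close>, is at most \<open>(z - x) / prof z\<close>. Therefore
\<open>prof z * slope z + (z - x) \<ge> prof z * slope m \<ge> R * slope m\<close> with \<open>R \<ge> prof z\<close> the square root, and the
derivative of the difference with respect to the upper point is nonnegative. The lower point \<open>x\<close> may be negative,
as \<open>prof x\<close> does not occur.\<close>

lemma sqrt_gap_mono:
  assumes x: "x \<le> y0" "0 \<le> x + y0" and y: "y0 \<le> y" "y \<le> 1"
    and neg: "\<And>m. (x + y0) / 2 < m \<Longrightarrow> m < 1 \<Longrightarrow> slope m \<le> 0"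
  shows "sqrt ((prof y0)\<^sup>2 + (y0 - x)\<^sup>2) - 2 * prof ((x + y0) / 2)
      \<le> sqrt ((prof y)\<^sup>2 + (y - x)\<^sup>2) - 2 * prof ((x + y) / 2)"
proof (rule DERIV_nonneg_imp_increasing_open[OF y(1)])
  fix z assume z: "y0 < z" "z < y"
  define m where "m = (x + z) / 2"
  define R where "R = sqrt ((prof z)\<^sup>2 + (z - x)\<^sup>2)"
  have z1: "0 < z" "z < 1" "x < z" using z x y by auto
  have m: "0 < m" "m < z" "m < 1" "(x + y0) / 2 < m" using z x y by (auto simp: m_def)
  have pz: "prof z > 0" using prof_pos[of z] z1 by simp
  have R: "prof z \<le> R" "R > 0" using pz unfolding R_def by (auto intro!: real_le_rsqrt add_pos_nonneg)
  have dR: "((\<lambda>y. sqrt ((prof y)\<^sup>2 + (y - x)\<^sup>2)) has_real_derivative (prof z * slope z + (z - x)) / R) (at z)"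
  proof -
    have "((\<lambda>y. (prof y)\<^sup>2 + (y - x)\<^sup>2) has_real_derivative 2 * (prof z * slope z + (z - x))) (at z)"
      by (auto intro!: derivative_eq_intros prof_deriv z1)
    then have "((\<lambda>y. sqrt ((prof y)\<^sup>2 + (y - x)\<^sup>2)) has_real_derivative
        inverse R / 2 * (2 * (prof z * slope z + (z - x)))) (at z)"
      unfolding R_def by (intro DERIV_chain2[OF DERIV_real_sqrt]) (use pz in \<open>auto intro: add_pos_nonneg\<close>)
    moreover have "inverse R / 2 * (2 * A) = A / R" for A using R by (simp add: field_simps)
    ultimately show ?thesis by (simp only:)
  qed
  have "((\<lambda>y. (x + y) / 2) has_real_derivative 1 / 2) (at z)" by (auto intro!: derivative_eq_intros)
  from DERIV_cmult[OF DERIV_chain2[OF prof_deriv this], of 2] m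
  have dm: "((\<lambda>y. 2 * prof ((x + y) / 2)) has_real_derivative slope m) (at z)" by (simp add: m_def)
  have "slope m - slope z \<le> (z - x) / prof z"
  proof -
    have "(- (2 / prof z) * z) - (- (2 / prof z) * m) \<le> slope z - slope m"
    proof (rule increment_le[where f' = "\<lambda>_. - (2 / prof z)" and h' = "\<lambda>t. - (2 / prof t)"])
      fix t assume t: "m < t" "t < z"
      have "prof z \<le> prof t" by (rule prof_decreasing) (use t m z1 neg in auto)
      then show "- (2 / prof z) \<le> - (2 / prof t)" using pz by (simp add: frac_le)
    qed (use m z1 pz in \<open>auto intro!: slope_cont slope_deriv_minus continuous_intros derivative_eq_intros\<close>)
    then have "slope m - slope z \<le> 2 / prof z * z - 2 / prof z * m" by linarith
    also have "\<dots> = 2 / prof z * (z - m)" by (simp only: right_diff_distrib)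
    also have "\<dots> = (z - x) / prof z" using pz by (simp add: m_def field_simps)
    finally show ?thesis .
  qed
  then have "prof z * (slope m - slope z) \<le> z - x" using pz by (simp add: field_simps)
  then have "prof z * slope m \<le> prof z * slope z + (z - x)" by (simp add: algebra_simps)
  moreover have "R * slope m \<le> prof z * slope m" using R neg[of m] m by (intro mult_right_mono_neg) auto
  ultimately have "slope m * R \<le> prof z * slope z + (z - x)" by (simp add: mult.commute)
  then have "slope m \<le> (prof z * slope z + (z - x)) / R" using R by (simp add: pos_le_divide_eq)
  then show "\<exists>d. ((\<lambda>y. sqrt ((prof y)\<^sup>2 + (y - x)\<^sup>2) - 2 * prof ((x + y) / 2)) has_real_derivative d) (at z) \<and> d \<ge> 0"
    using DERIV_diff[OF dR dm] by (intro exI conjI) auto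
next
  show "continuous_on {y0..y} (\<lambda>y. sqrt ((prof y)\<^sup>2 + (y - x)\<^sup>2) - 2 * prof ((x + y) / 2))"
    by (intro continuous_intros continuous_on_compose2[OF prof_cont]) (use x y in auto)
qed

lemma slope_nonpos: "0.105 \<le> m \<Longrightarrow> m < 1 \<Longrightarrow> slope m \<le> 0"
  using slope_upper[of m] by simp

lemma right_near:
  assumes \<beta>: "\<beta> = beta0" and x: "0 < x" "x < 1" "slope x > 0" and D: "0 < D" "D \<le> prof x / 4"
  shows "(2 * prof (x + D / 2) - prof x)\<^sup>2 \<le>
    (prof (x + D))\<^sup>2 + 2 * \<beta> * prof (x + D) powr (2 - 1 / \<beta>) * D powr (1 / \<beta>)"
proof -
  define j where "j = prof x"
  have j: "j > 0" using prof_pos[of x] x by (simp add: j_def)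
  define w where "w = D / j"
  have w: "0 < w" "w \<le> 1/4" "j * w = D" "j * (w / 2) = D / 2"
    using D j by (auto simp: w_def j_def field_simps)
  have pos: "prof (x + D) \<ge> 0"
    using shift_range(1,2)[OF x, of w] w unfolding j_def[symmetric] by (intro prof_nonneg) auto
  have *: "(2 * (prof (x + D / 2) / j) - 1)\<^sup>2 \<le> (prof (x + D) / j)\<^sup>2 +
      2 * \<beta> * (prof (x + D) / j) powr (2 - 1 / \<beta>) * w powr (1 / \<beta>)"
    using rescaled_near[OF x \<beta> w(1,2)] unfolding j_def[symmetric] w(3,4) .
  have "(2 * prof (x + D / 2) - prof x)\<^sup>2 = j\<^sup>2 * (2 * (prof (x + D / 2) / j) - 1)\<^sup>2"
    using j by (simp add: power_mult_distrib[symmetric] j_def[symmetric] algebra_simps)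
  also have "\<dots> \<le> j\<^sup>2 * ((prof (x + D) / j)\<^sup>2 +
      2 * \<beta> * (prof (x + D) / j) powr (2 - 1 / \<beta>) * w powr (1 / \<beta>))"
    by (intro mult_left_mono *) auto
  also have "\<dots> = (prof (x + D))\<^sup>2 + 2 * \<beta> * (j powr 2 * ((prof (x + D) / j) powr (2 - 1 / \<beta>) * w powr (1 / \<beta>)))"
    using j by (simp add: power_divide algebra_simps)
  also have "j powr 2 = j powr (2 - 1 / \<beta>) * j powr (1 / \<beta>)" by (simp flip: powr_add)
  also have "j powr (2 - 1 / \<beta>) * j powr (1 / \<beta>) * ((prof (x + D) / j) powr (2 - 1 / \<beta>) * w powr (1 / \<beta>))
      = prof (x + D) powr (2 - 1 / \<beta>) * D powr (1 / \<beta>)"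
    using j pos w D by (simp add: powr_divide powr_mult[symmetric] w_def)
  finally show ?thesis by (simp add: mult.assoc)
qed

text \<open>At distance \<open>prof x / 4\<close> the Euclidean norm suffices already. From there on the midpoint lies in the
decreasing part, so that \<open>sqrt_gap_mono\<close> takes over.\<close>

lemma right_quarter:
  assumes x: "0 < x" "x < 1" "slope x > 0" and D: "D = prof x / 4"
  shows "2 * prof (x + D / 2) - prof x \<le> sqrt ((prof (x + D))\<^sup>2 + D\<^sup>2)"
proof -
  define j where "j = prof x"
  have j: "j > 0" using prof_pos[of x] x by (simp add: j_def)
  let ?h = "\<lambda>t. prof (x + j * t) / j"
  have jd: "j * (1/4) = D" "j * (1/4/2) = D / 2" using D by (auto simp: j_def)
  have h1: "0.9335 \<le> ?h (1/4)" and h2: "0.9335 \<le> ?h (1/4/2)"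
    unfolding j_def by (rule rescaled_range(1)[OF x]; simp)+
  have "(2 * ?h (1/4/2) - 1)\<^sup>2 \<le> (?h (1/4))\<^sup>2 + 1 * (1/4)\<^sup>2"
  proof (rule square_gap_from_taylor[OF x, where s' = "0.207" and c = "0.223"])
    show "slope x \<le> 0.207" using slope_le x by simp
    show "critical_ratio 0.207 0.223 (1/4) \<le> 1" by (simp add: critical_ratio_def power_numeral_reduce)
    show "?h (1/4/2) \<le> 1 + slope x * (1/4/2) - (1/4/2)\<^sup>2 + slope x / 3 * (1/4/2) ^ 3
        - (1 + (slope x)\<^sup>2) / 6 * (1/4/2) ^ 4 + 0.2377 * slope x * (1/4/2) ^ 5"
      unfolding j_def by (rule rescaled_upper[OF x]) auto
    show "1 + slope x * (1/4) - (1/4)\<^sup>2 + slope x / 3 * (1/4) ^ 3 - (1 + (slope x)\<^sup>2) / 6 * (1/4) ^ 4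
        + slope x * (28 + 12 * (slope x)\<^sup>2) / 120 * (1/4) ^ 5 - 0.223 * (1/4) ^ 6 \<le> ?h (1/4)"
      unfolding j_def by (rule rescaled_lower[OF x]) (use rescaled_range(2)[OF x] in auto)
    have "0 \<le> a" "0 \<le> 2 * a - 1" if "0.9335 \<le> a" for a :: real using that by simp_all
    then show "0 \<le> ?h (1/4)" "0 \<le> 2 * ?h (1/4/2) - 1" using h1 h2 by blast+
  qed auto
  then have "j\<^sup>2 * (2 * ?h (1/4/2) - 1)\<^sup>2 \<le> j\<^sup>2 * ((?h (1/4))\<^sup>2 + (1/4)\<^sup>2)"
    by (intro mult_left_mono) auto
  moreover have "j\<^sup>2 * (2 * ?h (1/4/2) - 1)\<^sup>2 = (2 * prof (x + D / 2) - prof x)\<^sup>2"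
    using j unfolding jd by (simp add: power_mult_distrib[symmetric] j_def[symmetric] algebra_simps)
  moreover have "j\<^sup>2 * ((?h (1/4))\<^sup>2 + (1/4)\<^sup>2) = (prof (x + D))\<^sup>2 + D\<^sup>2"
    using j unfolding jd by (simp add: D j_def[symmetric] power_divide field_simps)
  ultimately show ?thesis by (intro real_le_rsqrt) simp
qed

lemma right_far:
  assumes x: "0 < x" "x < 1" "slope x > 0" and y: "prof x / 4 \<le> y - x" "y \<le> 1"
  shows "2 * prof ((x + y) / 2) \<le> prof x + sqrt ((prof y)\<^sup>2 + (y - x)\<^sup>2)"
proof -
  define y0 where "y0 = x + prof x / 4"
  have j1: "prof x \<ge> 1" using prof_ge_1_of_slope_nonneg[of x] x by simp
  have "sqrt ((prof y0)\<^sup>2 + (y0 - x)\<^sup>2) - 2 * prof ((x + y0) / 2)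
      \<le> sqrt ((prof y)\<^sup>2 + (y - x)\<^sup>2) - 2 * prof ((x + y) / 2)"
    by (rule sqrt_gap_mono) (use x y j1 in \<open>auto simp: y0_def intro!: slope_nonpos\<close>)
  moreover have "2 * prof ((x + y0) / 2) - prof x \<le> sqrt ((prof y0)\<^sup>2 + (y0 - x)\<^sup>2)"
  proof -
    have "(x + y0) / 2 = x + prof x / 4 / 2" "y0 - x = prof x / 4" by (simp_all add: y0_def)
    then show ?thesis using right_quarter[OF x refl] by (simp only: y0_def)
  qed
  ultimately show ?thesis by simp
qed

text \<open>The limit of \<open>right_near\<close> as the base point tends to \<open>0\<close>.\<close>

lemma origin_near:
  assumes \<beta>: "\<beta> = beta0" and w: "0 < w" "w \<le> 1/4"
  shows "(2 * prof (w / 2) - 1)\<^sup>2 \<le> (prof w)\<^sup>2 + 2 * \<beta> * prof w powr (2 - 1 / \<beta>) * w powr (1 / \<beta>)"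
proof -
  obtain w0 where w0: "0 < w0" "w0 < 1" "\<And>t. 0 < t \<Longrightarrow> t \<le> w0 \<Longrightarrow> 0.2068 < slope t"
    using slope_near_0_obtain by blast
  have c: "((\<lambda>x. prof (x + u)) \<longlongrightarrow> prof (0 + u)) (at_right 0)" if "0 < u" "u < 1" for u
  proof -
    have "isCont prof (0 + u)" using prof_deriv[of u] that by (auto dest: DERIV_isCont)
    then show ?thesis by (intro isCont_tendsto_compose[of "0 + u" prof] tendsto_intros)
  qed
  have "(2 * prof (0 + w / 2) - 1)\<^sup>2 \<le> (prof (0 + w))\<^sup>2 + 2 * \<beta> * prof (0 + w) powr (2 - 1 / \<beta>) * w powr (1 / \<beta>)"
  proof (rule tendsto_le[of "at_right (0::real)"])
    show "((\<lambda>x. (2 * prof (x + w / 2) - prof x)\<^sup>2) \<longlongrightarrow> (2 * prof (0 + w / 2) - 1)\<^sup>2) (at_right 0)"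
      by (intro tendsto_intros c prof_tendsto_0) (use w in auto)
    show "((\<lambda>x. (prof (x + w))\<^sup>2 + 2 * \<beta> * prof (x + w) powr (2 - 1 / \<beta>) * w powr (1 / \<beta>)) \<longlongrightarrow>
      (prof (0 + w))\<^sup>2 + 2 * \<beta> * prof (0 + w) powr (2 - 1 / \<beta>) * w powr (1 / \<beta>)) (at_right 0)"
      using prof_pos[of w] w by (intro tendsto_intros c) auto
    show "\<forall>\<^sub>F x in at_right 0. (2 * prof (x + w / 2) - prof x)\<^sup>2
        \<le> (prof (x + w))\<^sup>2 + 2 * \<beta> * prof (x + w) powr (2 - 1 / \<beta>) * w powr (1 / \<beta>)"
    proof (rule eventually_at_rightI[of 0 w0])
      fix x assume "x \<in> {0<..<w0}"
      then have x: "0 < x" "x < 1" "slope x > 0" using w0(2) w0(3)[of x] by auto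
      have "prof x \<ge> 1" using prof_ge_1_of_slope_nonneg[of x] x by simp
      then show "(2 * prof (x + w / 2) - prof x)\<^sup>2
        \<le> (prof (x + w))\<^sup>2 + 2 * \<beta> * prof (x + w) powr (2 - 1 / \<beta>) * w powr (1 / \<beta>)"
        using w by (intro right_near[OF \<beta> x]) auto
    qed (use w0 in auto)
  qed simp
  then show ?thesis by simp
qed

lemma origin_far:
  assumes w: "1/4 < w" "w \<le> 1"
  shows "2 * prof (w / 2) \<le> 1 + sqrt ((prof w)\<^sup>2 + w\<^sup>2)"
proof -
  obtain w0 where w0: "0 < w0" "w0 < 1" "\<And>t. 0 < t \<Longrightarrow> t \<le> w0 \<Longrightarrow> 0.2068 < slope t"
    using slope_near_0_obtain by blast
  have c: "((\<lambda>x. prof ((x + w) / 2)) \<longlongrightarrow> prof ((0 + w) / 2)) (at_right 0)"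
  proof -
    have "isCont prof ((0 + w) / 2)" using prof_deriv[of "w / 2"] w by (auto dest: DERIV_isCont)
    then show ?thesis by (intro isCont_tendsto_compose[of _ prof] tendsto_intros) auto
  qed
  have "2 * prof ((0 + w) / 2) \<le> 1 + sqrt ((prof w)\<^sup>2 + (w - 0)\<^sup>2)"
  proof (rule tendsto_le[of "at_right (0::real)"])
    show "((\<lambda>x. 2 * prof ((x + w) / 2)) \<longlongrightarrow> 2 * prof ((0 + w) / 2)) (at_right 0)"
      by (intro tendsto_intros c)
    show "((\<lambda>x. prof x + sqrt ((prof w)\<^sup>2 + (w - x)\<^sup>2)) \<longlongrightarrow> 1 + sqrt ((prof w)\<^sup>2 + (w - 0)\<^sup>2)) (at_right 0)"
      by (intro tendsto_intros prof_tendsto_0)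
    have "\<forall>\<^sub>F x in at_right 0. x + prof x / 4 < w"
      using tendsto_add[OF tendsto_ident_at tendsto_divide[OF prof_tendsto_0 tendsto_const[of 4]]] w
      by (intro order_tendstoD(2)) auto
    moreover have "\<forall>\<^sub>F x in at_right (0::real). x \<in> {0<..<w0}" using w0 by (intro eventually_at_rightI[of 0 w0]) auto
    ultimately show "\<forall>\<^sub>F x in at_right 0. 2 * prof ((x + w) / 2) \<le> prof x + sqrt ((prof w)\<^sup>2 + (w - x)\<^sup>2)"
    proof eventually_elim
      case (elim x)
      then have x: "0 < x" "x < 1" "slope x > 0" using w0(2) w0(3)[of x] by auto
      show ?case by (rule right_far[OF x]) (use elim w in auto)
    qed
  qed simp
  then show ?thesis by simp
qed

text \<open>Monotonicity starts at \<open>y = x\<close> if the slope at \<open>x\<close> is nonpositive, and otherwise at distance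
\<open>prof x / 4\<close>, up to which the Taylor estimate holds.\<close>

lemma two_point_right:
  assumes \<beta>: "\<beta> = beta0" and x: "0 \<le> x" and y: "x \<le> y" "y \<le> 1"
  shows "2 * prof ((x + y) / 2) \<le> prof x + pnorm (1 / \<beta>) (prof y) (y - x)"
proof -
  have p: "1 \<le> 1 / \<beta>" "1 / \<beta> \<le> 2" "1/2 \<le> \<beta>" unfolding \<beta> by simp_all
  have nn: "prof y \<ge> 0" "prof x \<ge> 0" using prof_nonneg x y by auto
  have sq: "2 * prof ((x + y) / 2) \<le> prof x + pnorm (1 / \<beta>) (prof y) (y - x)"
    if "2 * prof ((x + y) / 2) \<le> prof x + sqrt ((prof y)\<^sup>2 + (y - x)\<^sup>2)"
    using that pnorm_ge_sqrt[OF p(1,2) nn(1), of "y - x"] y by simp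
  have near: "2 * prof ((x + y) / 2) \<le> prof x + pnorm (1 / \<beta>) (prof y) (y - x)"
    if "(2 * prof ((x + y) / 2) - prof x)\<^sup>2 \<le>
      (prof y)\<^sup>2 + 2 * \<beta> * prof y powr (2 - 1 / \<beta>) * (y - x) powr (1 / \<beta>)" "prof y > 0"
  proof -
    have "(2 * prof ((x + y) / 2) - prof x)\<^sup>2 \<le> (pnorm (1 / \<beta>) (prof y) (y - x))\<^sup>2"
      using that(1) pnorm_sq_ge[OF p(3) that(2), of "y - x"] y by simp
    then have "2 * prof ((x + y) / 2) - prof x \<le> pnorm (1 / \<beta>) (prof y) (y - x)"
      by (rule power2_le_imp_le) (rule pnorm_nonneg)
    then show ?thesis by simp
  qed
  consider "x = y" | "x < y" "x = 0" "y \<le> 1/4" | "x < y" "x = 0" "y > 1/4"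
    | "x < y" "x > 0" "slope x \<le> 0" | "x < y" "x > 0" "slope x > 0" "y - x \<le> prof x / 4"
    | "x < y" "x > 0" "slope x > 0" "y - x > prof x / 4" using x y by linarith
  then show ?thesis
  proof cases
    case 1 then show ?thesis by (intro sq) (use nn in simp)
  next
    case 2 then show ?thesis using origin_near[OF \<beta>, of y] prof_pos[of y] by (intro near) auto
  next
    case 3 then show ?thesis using origin_far[of y] y by (intro sq) auto
  next
    case 4
    have "sqrt ((prof x)\<^sup>2 + (x - x)\<^sup>2) - 2 * prof ((x + x) / 2)
      \<le> sqrt ((prof y)\<^sup>2 + (y - x)\<^sup>2) - 2 * prof ((x + y) / 2)"
    proof (rule sqrt_gap_mono)
      show "slope m \<le> 0" if "(x + x) / 2 < m" "m < 1" for m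
        using slope_decreasing[of x m] 4 that by simp
    qed (use 4 y in auto)
    then show ?thesis using nn by (intro sq) simp
  next
    case 5
    then have m: "x + (y - x) / 2 = (x + y) / 2" "x < 1" using y by (auto simp: field_simps)
    have "y < 1" using shift_range(2)[of x "(y - x) / prof x"] 5 m prof_pos[of x] by (simp add: field_simps)
    then have "prof y > 0" using prof_pos[of y] 5 by simp
    with right_near[OF \<beta> 5(2) m(2) 5(3), of "y - x"] 5 show ?thesis by (intro near) (simp_all add: m)
  next
    case 6
    then show ?thesis using y by (intro sq right_far) auto
  qed
qed

section \<open>Pairs meeting the parabola\<close>

text \<open>The parabola \<open>9/5 * x - 8/5 * x\<^sup>2\<close> on \<open>[0, 1/2]\<close> in the rescaled variable \<open>w = 2 * x - 1\<close>, times \<open>2\<close>. Its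
slope \<open>1/5\<close> at \<open>0\<close> is below the initial slope of \<open>prof\<close>.\<close>

definition left_arc :: "real \<Rightarrow> real" where
  "left_arc w = 1 + w / 5 - 4 / 5 * w\<^sup>2"

lemma left_arc_bounds:
  assumes "-1 \<le> w" "w \<le> 0" shows "0 \<le> left_arc w" "left_arc w \<le> 1"
proof -
  have "left_arc w = (1 + w) * (1 - 4 / 5 * w)"
    by (simp add: left_arc_def field_simps power2_eq_square)
  then show "0 \<le> left_arc w" using assms by simp
  show "left_arc w \<le> 1" using assms unfolding left_arc_def
    by (smt (verit) divide_nonpos_pos mult_nonneg_nonneg zero_le_power2 divide_nonneg_pos)
qed

text \<open>With \<open>b\<close> the value at \<open>y\<close> and \<open>D = y - x\<close> squaring reduces the claim to \<open>4/5 * b + 4/25 * D\<^sup>2 \<le> 1\<close>, and \<open>b\<close>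
and \<open>D\<close> are at most \<open>1\<close>.\<close>

lemma two_point_left_left:
  assumes "-1 \<le> x" "x \<le> y" "y \<le> 0"
  shows "2 * left_arc ((x + y) / 2) \<le> left_arc x + sqrt ((left_arc y)\<^sup>2 + (y - x)\<^sup>2)"
proof -
  define b D where "b = left_arc y" and "D = y - x"
  have b: "0 \<le> b" "b \<le> 1" using left_arc_bounds[of y] assms by (auto simp: b_def)
  have D: "0 \<le> D" "D \<le> 1" using assms by (auto simp: D_def)
  have "2 * left_arc ((x + y) / 2) - left_arc x = b + 2 / 5 * D\<^sup>2"
    by (simp add: left_arc_def b_def D_def field_simps power2_eq_square)
  moreover have "b + 2 / 5 * D\<^sup>2 \<le> sqrt (b\<^sup>2 + D\<^sup>2)"
  proof (rule real_le_rsqrt)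
    have "D\<^sup>2 \<le> 1" using D power_le_one by blast
    then have "4 / 5 * b + 4 / 25 * D\<^sup>2 \<le> 1" using b by simp
    then have "D\<^sup>2 * (4 / 5 * b + 4 / 25 * D\<^sup>2) \<le> D\<^sup>2 * 1" by (intro mult_left_mono) auto
    then show "(b + 2 / 5 * D\<^sup>2)\<^sup>2 \<le> b\<^sup>2 + D\<^sup>2" by (simp add: field_simps power2_eq_square)
  qed
  ultimately show ?thesis by (simp add: b_def D_def)
qed

lemma sqrt_2_ge: "1.4142 \<le> (2::real) powr (1/2)"
proof -
  have "1.4142 \<le> sqrt 2" by (rule real_le_rsqrt) (simp add: power2_eq_square)
  then show ?thesis by (simp add: powr_half_sqrt)
qed

text \<open>Here \<open>- m\<close> is the lower point and \<open>D = w + m\<close> the distance. In terms of \<open>k = w / D \<le> 1/2\<close> the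
inequality is tightest at \<open>D = 1\<close>, where it becomes a quartic inequality in \<open>k\<close>.\<close>

lemma straddle_left_sqrt:
  assumes w: "0 < w" "w \<le> m" "w + m \<le> 1"
  shows "2 * left_arc ((w - m) / 2) \<le> left_arc (- m) + sqrt ((prof w)\<^sup>2 + (w + m)\<^sup>2)"
proof -
  define D where "D = w + m"
  define k where "k = w / D"
  define l where "l = 1 + w / 5 - w\<^sup>2"
  have D: "0 < D" "D \<le> 1" "2 * w \<le> D" using w by (auto simp: D_def)
  have k: "0 \<le> k" "k \<le> 1/2" "w = k * D" using D w by (auto simp: k_def field_simps)
  have w2: "w \<le> 1/2" using w by simp
  have l: "0 \<le> l" using w w2 mult_mono[of w 1 w 1] by (simp add: l_def power2_eq_square)
  have T: "2 * left_arc ((w - m) / 2) - left_arc (- m) = l + D\<^sup>2 * (k\<^sup>2 / 5 + 2 / 5)"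
  proof -
    have "2 * left_arc ((w - m) / 2) - left_arc (- m) = l + (w\<^sup>2 / 5 + 2 / 5 * D\<^sup>2)"
      by (simp add: left_arc_def l_def D_def field_simps power2_eq_square)
    also have "w\<^sup>2 / 5 = D\<^sup>2 * (k\<^sup>2 / 5)" by (simp add: k(3) power_mult_distrib)
    finally show ?thesis by (simp add: algebra_simps)
  qed
  have "(k\<^sup>2 / 5 + 2 / 5) * (2 * l + D\<^sup>2 * (k\<^sup>2 / 5 + 2 / 5)) \<le> 1"
  proof -
    have kk: "k\<^sup>2 \<le> k / 2" using k mult_left_mono[of k "1/2" k] by (simp add: power2_eq_square)
    have "0 \<le> (1 - D) * (2 / 5 * k + (2 / 5 - 9 / 5 * k\<^sup>2) * (1 + D))"
    proof (intro mult_nonneg_nonneg)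
      have "0 \<le> (1 - 2 * k) * (25 + 45 * D)" using k D by (intro mult_nonneg_nonneg) auto
      then have "0 \<le> k / 2 * 1 + (2 / 5 - 9 / 5 * (k / 2)) * (1 + D) - k / 10"
        using D by (simp add: field_simps)
      also have "\<dots> \<le> 2 / 5 * k + (2 / 5 - 9 / 5 * k\<^sup>2) * (1 + D)"
        using mult_right_mono[OF kk, of "1 + D"] D by (simp add: field_simps)
      finally show "0 \<le> 2 / 5 * k + (2 / 5 - 9 / 5 * k\<^sup>2) * (1 + D)" .
    qed (use D in auto)
    then have "2 * l + D\<^sup>2 * (k\<^sup>2 / 5 + 2 / 5) \<le> 12 / 5 + 2 / 5 * k - 9 / 5 * k\<^sup>2"
      by (simp add: l_def k(3) field_simps power2_eq_square)
    then have "(k\<^sup>2 / 5 + 2 / 5) * (2 * l + D\<^sup>2 * (k\<^sup>2 / 5 + 2 / 5)) \<le> (k\<^sup>2 / 5 + 2 / 5) * (12 / 5 + 2 / 5 * k - 9 / 5 * k\<^sup>2)"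
      by (intro mult_left_mono) auto
    also have "\<dots> \<le> 1"
    proof -
      have "k * k\<^sup>2 \<le> 1/2 * (1/2)\<^sup>2" using k by (intro mult_mono power_mono) auto
      then have "0 \<le> 6 / 25 * (k - 1/3)\<^sup>2 + (1 / 75 - 2 / 25 * (k * k\<^sup>2)) + 9 / 25 * (k\<^sup>2)\<^sup>2"
        by (intro add_nonneg_nonneg) (auto simp: power2_eq_square)
      then show ?thesis by (simp add: field_simps power2_eq_square)
    qed
    finally show ?thesis .
  qed
  then have "D\<^sup>2 * ((k\<^sup>2 / 5 + 2 / 5) * (2 * l + D\<^sup>2 * (k\<^sup>2 / 5 + 2 / 5))) \<le> D\<^sup>2 * 1"
    by (intro mult_left_mono) auto
  then have "(l + D\<^sup>2 * (k\<^sup>2 / 5 + 2 / 5))\<^sup>2 \<le> l\<^sup>2 + D\<^sup>2"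
    by (simp add: power2_sum algebra_simps power_mult_distrib power2_eq_square)
  also have "\<dots> \<le> (prof w)\<^sup>2 + D\<^sup>2"
    using prof_ge_parabola[of w] w w2 l by (intro add_right_mono power_mono) (auto simp: l_def)
  finally have "l + D\<^sup>2 * (k\<^sup>2 / 5 + 2 / 5) \<le> sqrt ((prof w)\<^sup>2 + D\<^sup>2)" by (rule real_le_rsqrt)
  with T show ?thesis by (simp add: D_def)
qed

text \<open>The defect \<open>F\<close> is concave in \<open>m\<close>, so it suffices to check the ends of the range of \<open>m\<close>. At
\<open>w = 0\<close> and \<open>m = 1\<close> this amounts to \<open>2 powr \<beta> - 1 \<ge> 2/5\<close>. The norm would not do here: for \<open>m = 1\<close> and
\<open>w = 1/2\<close> it is about \<open>1.73\<close>, but \<open>1.8\<close> is required.\<close>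

lemma straddle_left_chord:
  assumes c: "c \<ge> 0.4142" and w: "0 < w" "w \<le> m" "m \<le> 1" "1 \<le> w + m"
  shows "2 * left_arc ((w - m) / 2) \<le> left_arc (- m) + (w + m + c * prof w)"
proof -
  define F where "F = (\<lambda>g m. w + m + 0.4142 * g - 1 - w / 5 - 4 / 5 * m\<^sup>2 + 2 / 5 * (w - m)\<^sup>2)"
  have T: "left_arc (- m) + (w + m + 0.4142 * g) - 2 * left_arc ((w - m) / 2) = F g m" for g
    by (simp add: left_arc_def F_def field_simps power2_eq_square)
  have "0.4142 * prof w \<le> c * prof w" using c prof_nonneg[of w] w by (intro mult_right_mono) auto
  moreover have mono: "F g m \<le> F (prof w) m" if "g \<le> prof w" for g using that by (simp add: F_def)
  moreover have "0 \<le> F (prof w) m"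
  proof (cases "w \<le> 1/2")
    case True
    define g where "g = 1 + w / 5 - w\<^sup>2"
    have "0 \<le> 0.38 * (w - 0.154)\<^sup>2 + 0.005 + 0.005 * w\<^sup>2" by simp
    then have "0 \<le> F g (1 - w)" using w True
      by (simp add: F_def g_def field_simps power2_eq_square)
    moreover have "0 \<le> w * (0.08284 - 0.0142 * w)" using w by simp
    then have "0 \<le> F g 1" by (simp add: F_def g_def field_simps power2_eq_square)
    ultimately have "0 \<le> (1 - m) * F g (1 - w) + (m - (1 - w)) * F g 1 + 2 / 5 * w * (1 - m) * (m - (1 - w))"
      using w by (intro add_nonneg_nonneg mult_nonneg_nonneg) auto
    also have "\<dots> = w * F g m" by (simp add: F_def field_simps power2_eq_square)
    finally have "0 \<le> F g m" using w by (simp add: zero_le_mult_iff)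
    with mono[of g] prof_ge_parabola[of w] w True show ?thesis by (simp add: g_def)
  next
    case False
    define g where "g = (1 - w) * (2.2875 - 1.175 * (1 - w))"
    have gp: "g \<le> prof w" using prof_ge_right_parabola[of w] w False by (simp add: g_def)
    have "0 \<le> (1 - w) * (0.7474825 - 1.286685 * (1 - w))" using w False by (intro mult_nonneg_nonneg) auto
    also have "\<dots> \<le> F g w" using w by (simp add: F_def g_def field_simps power2_eq_square)
    finally have 1: "0 \<le> F g w" .
    have "0 \<le> (1 - w) * (0.1474825 - 0.086685 * (1 - w))" using w by (intro mult_nonneg_nonneg) auto
    also have "\<dots> \<le> F g 1" using w by (simp add: F_def g_def field_simps power2_eq_square)
    finally have 2: "0 \<le> F g 1" .
    have "0 \<le> F g m"
    proof (cases "w = 1")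
      case True then show ?thesis using 2 w by simp
    next
      case w1: False
      have "0 \<le> (1 - m) * F g w + (m - w) * F g 1 + 2 / 5 * (1 - w) * (1 - m) * (m - w)"
        using w 1 2 by (intro add_nonneg_nonneg mult_nonneg_nonneg) auto
      also have "\<dots> = (1 - w) * F g m" by (simp add: F_def field_simps power2_eq_square)
      finally show ?thesis using w w1 by (simp add: zero_le_mult_iff)
    qed
    with mono[OF gp] show ?thesis by simp
  qed
  ultimately show ?thesis using T[of "prof w"] by linarith
qed

lemma slope_increment:
  assumes "0 \<le> u" "u < v" "v < 1"
  shows "slope v * (v - u) + (v - u)\<^sup>2 / 1.0109 \<le> prof v - prof u"
proof -
  let ?f = "\<lambda>t. slope v * t - (v - t)\<^sup>2 / 1.0109"
  have "?f v - ?f u \<le> prof v - prof u"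
  proof (rule increment_le[where f' = "\<lambda>t. slope v + 2 * (v - t) / 1.0109" and h' = slope])
    fix t assume t: "u < t" "t < v"
    have "slope v - slope t \<le> - 2 / 1.0109 * v - (- 2 / 1.0109 * t)"
    proof (rule increment_le[where h' = "\<lambda>t. - 2 / 1.0109" and f' = "\<lambda>t. - (2 / prof t)"])
      fix z assume "t < z" "z < v"
      then show "- (2 / prof z) \<le> - 2 / 1.0109" using prof_le_energy[of z] prof_pos[of z] energy_bounds(2) t assms
        by (simp add: field_simps)
    qed (use t assms in \<open>auto intro!: slope_cont slope_deriv_minus continuous_intros derivative_eq_intros\<close>)
    then show "slope v + 2 * (v - t) / 1.0109 \<le> slope t" by (simp add: field_simps)
  qed (use assms in \<open>auto intro!: prof_cont_sub prof_deriv continuous_intros derivative_eq_intros simp: field_simps\<close>)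
  then show ?thesis by (simp add: algebra_simps)
qed

lemma mu_step_poly:
  fixes w m :: real
  assumes w: "0 < w" "w \<le> 0.53" and m: "0 \<le> m" "m \<le> w"
  shows "(w + 0.3056 * m - 0.0068) * (2 + 0.414 * w - 0.989 * w\<^sup>2 + m * (w + 0.3056 * m)) \<le> 0.9999 * (2 * w + m)"
proof -
  define t where "t = m / w"
  have t: "0 \<le> t" "t \<le> 1" "m = t * w" using w m by (auto simp: t_def field_simps)
  define A where "A = w - 0.0068"
  define C where "C = 0.414 - 0.989 * w"
  \<comment> \<open>As a polynomial in \<open>t\<close> the left-hand side is convex, so only \<open>t = 0\<close> and \<open>t = 1\<close> matter.\<close>
  have conv: "(a + 0.3056 * w * t) * (C + w * t + 0.3056 * w * t\<^sup>2) \<le>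
      (1 - t) * (a * C) + t * ((a + 0.3056 * w) * (C + 1.3056 * w))" if a: "0 \<le> a" for a
  proof -
    have "0 \<le> t * (1 - t) * (0.3056 * w * (w + a) + 0.3056 * w * (0.3056 * w) * (1 + t))"
      using t a w by (intro mult_nonneg_nonneg add_nonneg_nonneg) auto
    also have "\<dots> = (1 - t) * (a * C) + t * ((a + 0.3056 * w) * (C + 1.3056 * w))
        - (a + 0.3056 * w * t) * (C + w * t + 0.3056 * w * t\<^sup>2)"
      by (simp add: field_simps power2_eq_square)
    finally show ?thesis by simp
  qed
  have comb: "(A + 0.3056 * w * t) * (w * (C + w * t + 0.3056 * w * t\<^sup>2)) \<le> 0.0136 - 0.0002 * w + 0.3887 * w * t"
    if "0 \<le> a" and le: "(A + 0.3056 * w * t) * (C + w * t + 0.3056 * w * t\<^sup>2) \<le> (a + 0.3056 * w * t) * (C + w * t + 0.3056 * w * t\<^sup>2)"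
      and E0: "a * C * w \<le> 0.0136 - 0.0002 * w"
      and E1: "(a + 0.3056 * w) * (C + 1.3056 * w) * w \<le> 0.0136 + 0.3885 * w" for a
  proof -
    have "(A + 0.3056 * w * t) * (w * (C + w * t + 0.3056 * w * t\<^sup>2)) \<le>
        w * ((1 - t) * (a * C) + t * ((a + 0.3056 * w) * (C + 1.3056 * w)))"
      using mult_left_mono[OF order_trans[OF le conv[OF that(1)]], of w] w by (simp add: mult_ac)
    also have "\<dots> = (1 - t) * (a * C * w) + t * ((a + 0.3056 * w) * (C + 1.3056 * w) * w)"
      by (simp add: algebra_simps)
    also have "\<dots> \<le> (1 - t) * (0.0136 - 0.0002 * w) + t * (0.0136 + 0.3885 * w)"
      using t E0 E1 by (intro add_mono mult_left_mono) auto
    also have "\<dots> = 0.0136 - 0.0002 * w + 0.3887 * w * t" by (simp add: field_simps)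
    finally show ?thesis .
  qed
  have "(A + 0.3056 * w * t) * (w * (C + w * t + 0.3056 * w * t\<^sup>2)) \<le> 0.0136 - 0.0002 * w + 0.3887 * w * t"
  proof (cases "w \<le> 0.4")
    case True
    show ?thesis
    proof (rule comb[of w])
      have "0 \<le> C + w * t + 0.3056 * w * t\<^sup>2" using True t w by (auto simp: C_def intro!: add_nonneg_nonneg)
      then show "(A + 0.3056 * w * t) * (C + w * t + 0.3056 * w * t\<^sup>2) \<le> (w + 0.3056 * w * t) * (C + w * t + 0.3056 * w * t\<^sup>2)"
        by (intro mult_right_mono) (auto simp: A_def)
      \<comment> \<open>\<open>0.28\<close> is close to the maximum \<open>2/3 * 0.414 / 0.989\<close> of \<open>w\<^sup>2 * C\<close>.\<close>
      have "0 \<le> 0.989 * ((w - 0.28)\<^sup>2 * (w + 0.14)) + 0.00138 * w\<^sup>2 + (0.0027 - 0.0002 * w)"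
        using True w by (intro add_nonneg_nonneg mult_nonneg_nonneg) auto
      then show "w * C * w \<le> 0.0136 - 0.0002 * w"
        by (simp add: C_def field_simps power2_eq_square)
      have "(w + 0.3056 * w) * (C + 1.3056 * w) \<le> 1.3056 * 0.4 * (0.414 + 0.3166 * 0.4)"
        using True w by (intro mult_mono) (auto simp: C_def)
      then have "(w + 0.3056 * w) * (C + 1.3056 * w) \<le> 0.3885" by simp
      then have "(w + 0.3056 * w) * (C + 1.3056 * w) * w \<le> 0.3885 * w" using w by (intro mult_right_mono) auto
      then show "(w + 0.3056 * w) * (C + 1.3056 * w) * w \<le> 0.0136 + 0.3885 * w" by (rule order_trans) simp
    qed (use w in auto)
  next
    case False
    show ?thesis
    proof (rule comb[of A])
      show "0 \<le> A" using False by (simp add: A_def)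
      have "C \<le> 0.0184" using False by (simp add: C_def)
      then have "A * w * C \<le> A * w * 0.0184" using False w by (intro mult_left_mono) (auto simp: A_def)
      also have "\<dots> \<le> 1 * 0.53 * 0.0184" using False w by (intro mult_mono) (auto simp: A_def)
      finally show "A * C * w \<le> 0.0136 - 0.0002 * w" using w by (simp add: mult_ac)
      have "(A + 0.3056 * w) * (C + 1.3056 * w) \<le> (1.3056 * 0.53 - 0.0068) * (0.414 + 0.3166 * 0.53)"
        using False w by (intro mult_mono) (auto simp: A_def C_def)
      then have "(A + 0.3056 * w) * (C + 1.3056 * w) \<le> 0.4" by simp
      then have "(A + 0.3056 * w) * (C + 1.3056 * w) * w \<le> 0.4 * w" using w by (intro mult_right_mono) auto
      then show "(A + 0.3056 * w) * (C + 1.3056 * w) * w \<le> 0.0136 + 0.3885 * w"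
        by (rule order_trans) (use w in simp)
    qed simp
  qed
  then show ?thesis
    unfolding t(3) A_def C_def by (simp add: field_simps power2_eq_square)
qed

text \<open>How the required value grows when the lower point moves from \<open>0\<close> to \<open>- m\<close>. The distance then gains
\<open>(w + m)\<^sup>2 - w\<^sup>2 = (2 * w + m) * m\<close> in square, and the right-hand side \<open>T\<close> gains at most \<open>m * \<tau>\<close>. The comparison
is won because \<open>prof\<close> has a larger slope at \<open>0\<close> than the parabola. The factor \<open>0.9999\<close> leaves room
for \<open>prof w powr (2 - 1 / \<beta>)\<close> when \<open>prof w < 1\<close>.\<close>

lemma mu_step:
  assumes w: "0 < w" "w \<le> 0.53" and m: "0 \<le> m" "m \<le> w"
    and T: "0 \<le> 2 * prof ((w - m) / 2) - left_arc (- m)"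
  shows "(2 * prof ((w - m) / 2) - left_arc (- m))\<^sup>2 \<le> (2 * prof (w / 2) - 1)\<^sup>2 + 0.9999 * ((w + m)\<^sup>2 - w\<^sup>2)"
proof -
  define T T0 where "T = 2 * prof ((w - m) / 2) - left_arc (- m)" and "T0 = 2 * prof (w / 2) - 1"
  define \<tau> where "\<tau> = w + 0.3056 * m - 0.0068"
  have T0: "0 \<le> T0" using prof_ge_1_minus_sq[of "w / 2"] w mult_mono[of w 1 w 1] by (simp add: T0_def power2_eq_square)
  have T0_up: "T0 \<le> 1 + 0.207 * w - 0.4945 * w\<^sup>2"
    using prof_upper[of "w / 2"] w by (simp add: T0_def power_divide)
  have d: "T \<le> T0 + m * \<tau>"
  proof (cases "m = 0")
    case False
    then have "slope (w / 2) * (m / 2) + (m / 2)\<^sup>2 / 1.0109 \<le> prof (w / 2) - prof ((w - m) / 2)"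
      using slope_increment[of "(w - m) / 2" "w / 2"] w m by (simp add: diff_divide_distrib)
    moreover have "(0.2068 - w) * (m / 2) \<le> slope (w / 2) * (m / 2)"
      using slope_ge[of "w / 2"] w m by (intro mult_right_mono) auto
    moreover have "m\<^sup>2 * 0.4946 \<le> 2 * ((m / 2)\<^sup>2 / 1.0109)"
      using zero_le_power2[of m] by (simp add: power_divide)
    ultimately have "T - T0 \<le> m / 5 + 4 / 5 * m\<^sup>2 - (0.2068 - w) * m - m\<^sup>2 * 0.4946"
      unfolding T_def T0_def left_arc_def by (simp only: power2_minus) argo
    also have "\<dots> \<le> m * \<tau>" by (simp add: \<tau>_def algebra_simps power2_eq_square)
    finally show ?thesis by simp
  qed (simp add: T_def T0_def left_arc_def)
  have "T\<^sup>2 - T0\<^sup>2 \<le> 0.9999 * ((2 * w + m) * m)"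
  proof (cases "\<tau> \<le> 0")
    case True
    then have "m * \<tau> \<le> 0" using m by (intro mult_nonneg_nonpos) auto
    with d have "T \<le> T0" by simp
    then have "T\<^sup>2 \<le> T0\<^sup>2" using T by (intro power_mono) (auto simp: T_def)
    moreover have "0 \<le> 0.9999 * ((2 * w + m) * m)" using w m by simp
    ultimately show ?thesis by linarith
  next
    case False
    have "T\<^sup>2 \<le> (T0 + m * \<tau>)\<^sup>2" using d T by (intro power_mono) (auto simp: T_def)
    then have "T\<^sup>2 - T0\<^sup>2 \<le> m * (\<tau> * (2 * T0 + m * \<tau>))" by (simp add: power2_eq_square algebra_simps)
    also have "\<dots> \<le> m * (\<tau> * (2 + 0.414 * w - 0.989 * w\<^sup>2 + m * (w + 0.3056 * m)))"
    proof (intro mult_left_mono)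
      have "m * \<tau> \<le> m * (w + 0.3056 * m)" using m by (intro mult_left_mono) (auto simp: \<tau>_def)
      then show "2 * T0 + m * \<tau> \<le> 2 + 0.414 * w - 0.989 * w\<^sup>2 + m * (w + 0.3056 * m)" using T0_up by simp
    qed (use False m in auto)
    also have "\<dots> \<le> m * (0.9999 * (2 * w + m))"
      unfolding \<tau>_def by (intro mult_left_mono mu_step_poly w m)
    finally show ?thesis by (simp add: algebra_simps)
  qed
  also have "(2 * w + m) * m = (w + m)\<^sup>2 - w\<^sup>2" by (simp add: power2_eq_square algebra_simps)
  finally have "T\<^sup>2 \<le> T0\<^sup>2 + 0.9999 * ((w + m)\<^sup>2 - w\<^sup>2)" by (simp add: field_simps)
  then show ?thesis by (simp only: T_def T0_def)
qed

lemma power_gain_increment: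
  fixes \<beta> w D :: real
  assumes \<beta>: "1/2 \<le> \<beta>" "\<beta> \<le> 1" and w: "0 < w" "w \<le> D" "D \<le> 1"
  shows "D\<^sup>2 - w\<^sup>2 \<le> 2 * \<beta> * D powr (1 / \<beta>) - 2 * \<beta> * w powr (1 / \<beta>)"
proof (rule increment_le[where f' = "\<lambda>t. 2 * t" and h' = "\<lambda>t. 2 * t powr (1 / \<beta> - 1)"])
  fix t assume t: "w < t" "t < D"
  have "1 / \<beta> \<le> 2" using \<beta> by (simp add: field_simps)
  then have "t powr 1 \<le> t powr (1 / \<beta> - 1)" using t w by (intro powr_mono') auto
  then show "2 * t \<le> 2 * t powr (1 / \<beta> - 1)" using t w by simp
  show "((\<lambda>t. 2 * \<beta> * t powr (1 / \<beta>)) has_real_derivative 2 * t powr (1 / \<beta> - 1)) (at t)"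
    using t w \<beta> by (auto intro!: derivative_eq_intros)
qed (use w in \<open>auto intro!: continuous_intros derivative_eq_intros\<close>)

lemma prof_powr_ge:
  assumes \<beta>: "\<beta> = beta0" and w: "0 < w" "w \<le> 1/4"
  shows "0.9999 \<le> prof w powr (2 - 1 / \<beta>)"
proof -
  have "0 \<le> (1/4 - w) * (w + 0.05)" using w by (intro mult_nonneg_nonneg) auto
  then have "0.985 \<le> 1 + w / 5 - w\<^sup>2" by (simp add: field_simps power2_eq_square)
  also have "\<dots> \<le> prof w" using prof_ge_parabola[of w] w by simp
  finally have g: "0.985 \<le> prof w" .
  have e: "0 \<le> 2 - 1 / \<beta>" "2 - 1 / \<beta> \<le> 0.0023" unfolding \<beta> by simp_all
  have "1 / prof w \<le> 1 / 0.985" using g by (intro divide_left_mono) auto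
  moreover have "1 - 1 / prof w \<le> ln (prof w)" using ln_le_minus_one[of "1 / prof w"] g by (simp add: ln_div)
  ultimately have "- ln (prof w) \<le> 0.0153" by simp
  then have "(2 - 1 / \<beta>) * (- ln (prof w)) \<le> (2 - 1 / \<beta>) * 0.0153" using e by (intro mult_left_mono) auto
  also have "\<dots> \<le> 0.0023 * 0.0153" using e by (intro mult_right_mono) auto
  finally have "0.9999 \<le> 1 + (2 - 1 / \<beta>) * ln (prof w)" by simp
  also have "\<dots> \<le> exp ((2 - 1 / \<beta>) * ln (prof w))" by (rule exp_ge_add_one_self)
  also have "\<dots> = prof w powr (2 - 1 / \<beta>)" using g by (simp add: powr_def)
  finally show ?thesis .
qed

text \<open>Reduction to the case of lower point \<open>0\<close> by \<open>mu_step\<close>. That case is known in the sharper form with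
powers of exponent \<open>1 / \<beta>\<close> for \<open>w \<le> 1/4\<close> and in the Euclidean form beyond.\<close>

lemma straddle_right_small:
  assumes \<beta>: "\<beta> = beta0" and w: "0 < w" "w \<le> 0.53" and m: "0 \<le> m" "m \<le> w"
  shows "2 * prof ((w - m) / 2) \<le> left_arc (- m) + pnorm (1 / \<beta>) (prof w) (w + m)"
    and "1/4 < w \<Longrightarrow> 2 * prof ((w - m) / 2) \<le> left_arc (- m) + sqrt ((prof w)\<^sup>2 + (w + m)\<^sup>2)"
proof -
  have p: "1 \<le> 1 / \<beta>" "1 / \<beta> \<le> 2" "1/2 \<le> \<beta>" "\<beta> \<le> 1" unfolding \<beta> by simp_all
  have g: "0 < prof w" using prof_pos[of w] w by simp
  let ?T = "2 * prof ((w - m) / 2) - left_arc (- m)"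
  have sq: "?T \<le> sqrt ((prof w)\<^sup>2 + (w + m)\<^sup>2)" if w4: "1/4 < w"
  proof (cases "0 \<le> ?T")
    case True
    have T0: "0 \<le> 2 * prof (w / 2) - 1"
      using prof_ge_1_minus_sq[of "w / 2"] w mult_mono[of w 1 w 1] by (simp add: power2_eq_square)
    have "?T\<^sup>2 \<le> (2 * prof (w / 2) - 1)\<^sup>2 + 0.9999 * ((w + m)\<^sup>2 - w\<^sup>2)" by (rule mu_step[OF w m True])
    also have "(2 * prof (w / 2) - 1)\<^sup>2 \<le> (sqrt ((prof w)\<^sup>2 + w\<^sup>2))\<^sup>2"
      using origin_far[OF w4] w T0 by (intro power_mono) auto
    also have "(sqrt ((prof w)\<^sup>2 + w\<^sup>2))\<^sup>2 = (prof w)\<^sup>2 + w\<^sup>2" by simp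
    also have "0.9999 * ((w + m)\<^sup>2 - w\<^sup>2) \<le> (w + m)\<^sup>2 - w\<^sup>2"
    proof -
      have "w\<^sup>2 \<le> (w + m)\<^sup>2" using w m by (intro power_mono) auto
      then show ?thesis by simp
    qed
    finally show ?thesis by (intro real_le_rsqrt) simp
  next
    case False
    then show ?thesis by (meson not_le order_trans less_imp_le real_sqrt_ge_zero add_nonneg_nonneg zero_le_power2)
  qed
  then show "1/4 < w \<Longrightarrow> 2 * prof ((w - m) / 2) \<le> left_arc (- m) + sqrt ((prof w)\<^sup>2 + (w + m)\<^sup>2)" by simp
  have "?T \<le> pnorm (1 / \<beta>) (prof w) (w + m)"
  proof (cases "1/4 < w")
    case True
    then show ?thesis using sq pnorm_ge_sqrt[OF p(1,2), of "prof w" "w + m"] g w m by simp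
  next
    case w4: False
    show ?thesis
    proof (cases "0 \<le> ?T")
      case True
      let ?g = "prof w powr (2 - 1 / \<beta>)"
      have w2: "w\<^sup>2 \<le> (w + m)\<^sup>2" using w m by (intro power_mono) auto
      have "?T\<^sup>2 \<le> (2 * prof (w / 2) - 1)\<^sup>2 + 0.9999 * ((w + m)\<^sup>2 - w\<^sup>2)" by (rule mu_step[OF w m True])
      also have "\<dots> \<le> ((prof w)\<^sup>2 + 2 * \<beta> * ?g * w powr (1 / \<beta>)) + ?g * (2 * \<beta> * (w + m) powr (1 / \<beta>) - 2 * \<beta> * w powr (1 / \<beta>))"
      proof (intro add_mono mult_mono)
        show "(2 * prof (w / 2) - 1)\<^sup>2 \<le> (prof w)\<^sup>2 + 2 * \<beta> * ?g * w powr (1 / \<beta>)"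
          using origin_near[OF \<beta> w(1)] w4 by simp
        show "0.9999 \<le> ?g" by (rule prof_powr_ge[OF \<beta> w(1)]) (use w4 in simp)
        show "(w + m)\<^sup>2 - w\<^sup>2 \<le> 2 * \<beta> * (w + m) powr (1 / \<beta>) - 2 * \<beta> * w powr (1 / \<beta>)"
          by (rule power_gain_increment) (use p w m w4 in auto)
      qed (use w2 in auto)
      also have "\<dots> = (prof w)\<^sup>2 + 2 * \<beta> * ?g * (w + m) powr (1 / \<beta>)" by (simp add: algebra_simps)
      also have "\<dots> \<le> (pnorm (1 / \<beta>) (prof w) (w + m))\<^sup>2"
        by (rule pnorm_sq_ge[OF p(3) g]) (use w m in simp)
      finally show ?thesis by (rule power2_le_imp_le) (rule pnorm_nonneg)
    next
      case False
      then show ?thesis using pnorm_nonneg[of "1 / \<beta>" "prof w" "w + m"] by linarith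
    qed
  qed
  then show "2 * prof ((w - m) / 2) \<le> left_arc (- m) + pnorm (1 / \<beta>) (prof w) (w + m)" by simp
qed

text \<open>Again concave in the free variable, here \<open>d = w - m\<close>, so only \<open>d = 0\<close> and \<open>d = 1/4\<close> have to be checked.\<close>

lemma straddle_right_chord:
  assumes c: "c \<ge> 0.4142" and w: "0.53 \<le> w" "w \<le> 1" and m: "m \<le> w" "w - m \<le> 1/4"
  shows "2 * prof ((w - m) / 2) \<le> left_arc (- m) + (w + m + c * prof w)"
proof -
  define d where "d = w - m"
  define g where "g = (1 - w) * (2.2875 - 1.175 * (1 - w))"
  have d: "0 \<le> d" "d \<le> 1/4" "m = w - d" using m by (auto simp: d_def)
  have "0 \<le> (1 - w) * (2.2875 - 1.175 * (1 - w))" using w by (intro mult_nonneg_nonneg) auto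
  then have g: "0 \<le> g" "g \<le> prof w" using prof_ge_right_parabola[of w] w by (auto simp: g_def)
  define q where "q = 1.8 * w - 1 - 0.8 * w\<^sup>2 + 0.4142 * g"
  define a where "a = 1.6 * w - 1.007"
  define G where "G = (\<lambda>d. q + d * a - 0.3055 * d\<^sup>2)"
  have "0 \<le> (1 - w) * (0.7474825 - 1.286685 * (1 - w))" using w by (intro mult_nonneg_nonneg) auto
  also have "\<dots> = G 0" by (simp add: G_def q_def g_def field_simps power2_eq_square)
  finally have G0: "0 \<le> G 0" .
  have G1: "0 \<le> G (1/4)"
  proof -
    have "0 \<le> (0.47 - (1 - w)) * (0.2572 + 1.286685 * (1 - w))" using w by (intro mult_nonneg_nonneg) auto
    also have "\<dots> \<le> G (1/4)" using w by (simp add: G_def q_def a_def g_def field_simps power2_eq_square)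
    finally show ?thesis .
  qed
  have "0 \<le> (1/4 - d) * G 0 + d * G (1/4) + 0.3055 * (1/4) * (d * (1/4 - d))"
    using d G0 G1 by (intro add_nonneg_nonneg mult_nonneg_nonneg) auto
  also have "\<dots> = G d / 4" by (simp add: G_def field_simps power2_eq_square)
  finally have Gd: "0 \<le> G d" by simp
  have "prof ((w - m) / 2) \<le> 1 + 0.207 * (d / 2) - 0.989 * (d / 2)\<^sup>2"
    using prof_upper[of "d / 2"] d(1,2) by (simp add: d_def)
  then have "2 * prof ((w - m) / 2) - left_arc (- m) \<le> w + m + 0.4142 * g - G d"
    unfolding d(3) left_arc_def G_def q_def a_def by (simp add: field_simps power2_eq_square)
  also have "\<dots> \<le> w + m + 0.4142 * g" using Gd by simp
  also have "0.4142 * g \<le> c * prof w" using c g by (intro mult_mono) auto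
  finally show ?thesis by simp
qed

text \<open>Once the midpoint is at \<open>1/8\<close>, where \<open>prof\<close> decreases, the inequality propagates to larger \<open>w\<close>
by \<open>sqrt_gap_mono\<close>; it remains to check the start \<open>w = m + 1/4\<close>.\<close>

lemma straddle_right_far:
  assumes \<beta>: "\<beta> = beta0" and m: "0 < m" "m + 1/4 \<le> w" "w \<le> 1"
  shows "2 * prof ((w - m) / 2) \<le> left_arc (- m) + sqrt ((prof w)\<^sup>2 + (w + m)\<^sup>2)"
proof -
  define y where "y = m + 1/4"
  have y: "1/4 < y" "y \<le> w" "m \<le> y" using m by (auto simp: y_def)
  have start: "2 * prof ((y - m) / 2) \<le> left_arc (- m) + sqrt ((prof y)\<^sup>2 + (y + m)\<^sup>2)"
  proof (cases "y \<le> 0.53")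
    case True
    then show ?thesis using straddle_right_small(2)[OF \<beta>, of y m] y m by simp
  next
    case False
    define u where "u = 1 - y"
    have u: "0 \<le> u" "u \<le> 0.47" "y = 1 - u" "m = 0.75 - u" using False y m by (auto simp: u_def y_def)
    \<comment> \<open>\<open>S\<close> bounds the profile from below, \<open>T\<close> the required value from above and \<open>D\<close> is the distance; the
      quartic polynomial \<open>S\<^sup>2 + D\<^sup>2 - T\<^sup>2\<close> has its minimum near \<open>u = 0.41\<close>.\<close>
    define S where "S = u * (2.2875 - 1.175 * u)"
    define T where "T = 1.620844 - 1.4 * u + 0.8 * u\<^sup>2"
    define D where "D = 1.75 - 2 * u"
    have S: "0 \<le> S" "S \<le> prof y" using prof_ge_right_parabola[of y] u unfolding S_def
      by (auto intro!: mult_nonneg_nonneg)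
    have "(y - m) / 2 = 1/8" by (simp add: y_def)
    moreover have "2 * prof (1/8) \<le> 2.020844" using prof_upper[of "1/8"] by (simp add: power2_eq_square)
    ultimately have "2 * prof ((y - m) / 2) \<le> 2.020844" by (simp only:)
    moreover have "left_arc (- m) = 2.020844 - T"
      unfolding T_def left_arc_def u(4) by (simp add: power2_eq_square field_simps)
    ultimately have "2 * prof ((y - m) / 2) - left_arc (- m) \<le> T" by simp
    moreover have "T \<le> sqrt (S\<^sup>2 + D\<^sup>2)"
    proof (rule real_le_rsqrt)
      have "u ^ 3 \<le> 0.41 ^ 3 + 3 * 0.41\<^sup>2 * (u - 0.41) + 1.29 * (u - 0.41)\<^sup>2"
        by (rule power_tangent3) (use u in simp)
      then have 3: "u ^ 3 \<le> 0.41 ^ 3 + 3 * 0.41\<^sup>2 * (u - 0.41) + 1.29 * (u\<^sup>2 - 0.82 * u + 0.41\<^sup>2)"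
        by (simp add: power2_diff power2_eq_square field_simps)
      have 4: "0.41 ^ 4 + 4 * 0.41 ^ 3 * (u - 0.41) \<le> u ^ 4" by (rule power_tangent4(2)[OF order_refl]) (use u in auto)
      have e: "S\<^sup>2 + D\<^sup>2 - T\<^sup>2 = 0.435364727664 - 2.4616368 * u + 4.67930585 * u\<^sup>2 - 3.135625 * u ^ 3 + 0.740625 * u ^ 4"
        by (simp add: S_def T_def D_def power2_eq_square field_simps power_numeral_reduce)
      have gen: "0 \<le> 0.435364727664 - 2.4616368 * u + 4.67930585 * a2 - 3.135625 * a3 + 0.740625 * a4"
        if "2 * 0.41 * u - 0.41\<^sup>2 \<le> a2" "a3 \<le> 0.41 ^ 3 + 3 * 0.41\<^sup>2 * (u - 0.41) + 1.29 * (a2 - 0.82 * u + 0.41\<^sup>2)"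
          "0.41 ^ 4 + 4 * 0.41 ^ 3 * (u - 0.41) \<le> a4" for a2 a3 a4 :: real
        using that u by (simp add: field_simps power_numeral_reduce)
      have "0 \<le> S\<^sup>2 + D\<^sup>2 - T\<^sup>2" unfolding e by (rule gen[OF square_ge_tangent 3 4])
      then show "T\<^sup>2 \<le> S\<^sup>2 + D\<^sup>2" by simp
    qed
    moreover have "sqrt (S\<^sup>2 + D\<^sup>2) \<le> sqrt ((prof y)\<^sup>2 + (y + m)\<^sup>2)"
      using S u by (auto simp: D_def intro!: power_mono)
    ultimately show ?thesis by linarith
  qed
  have "sqrt ((prof y)\<^sup>2 + (y - (- m))\<^sup>2) - 2 * prof ((- m + y) / 2)
      \<le> sqrt ((prof w)\<^sup>2 + (w - (- m))\<^sup>2) - 2 * prof ((- m + w) / 2)"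
    by (rule sqrt_gap_mono) (use y m in \<open>auto simp: y_def intro!: slope_nonpos\<close>)
  with start show ?thesis by simp
qed

definition arch :: "real \<Rightarrow> real" where
  "arch w = (if w < 0 then left_arc w else prof w)"

lemma arch_nonneg: "-1 \<le> w \<Longrightarrow> w \<le> 1 \<Longrightarrow> 0 \<le> arch w"
  using left_arc_bounds[of w] prof_nonneg[of w] by (auto simp: arch_def)

text \<open>Lower points on the parabola and upper points on the profile are treated according to the position of
the midpoint. The norm is used at small and the chord at large distance.\<close>

lemma two_point_arch:
  assumes \<beta>: "\<beta> = beta0" and xy: "-1 \<le> x" "x \<le> y" "y \<le> 1"
  shows "2 * arch ((x + y) / 2) \<le>
    arch x + max (pnorm (1 / \<beta>) (arch y) (y - x)) (y - x + (2 powr \<beta> - 1) * arch y)"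
proof -
  have p: "1 \<le> 1 / \<beta>" "1 / \<beta> \<le> 2" unfolding \<beta> by simp_all
  have "2 powr (1/2) \<le> (2::real) powr \<beta>" using \<beta> by (intro powr_mono) auto
  then have c: "0.4142 \<le> (2::real) powr \<beta> - 1" using order_trans[OF sqrt_2_ge] by force
  have la: "arch z = left_arc z" if "z \<le> 0" for z using that by (auto simp: arch_def left_arc_def)
  have pr: "arch z = prof z" if "0 \<le> z" for z using that by (simp add: arch_def)
  have sq: "sqrt ((arch y)\<^sup>2 + (y - x)\<^sup>2) \<le> pnorm (1 / \<beta>) (arch y) (y - x)"
    using arch_nonneg[of y] xy by (intro pnorm_ge_sqrt p) auto
  consider "y \<le> 0" | "0 \<le> x" | "x < 0" "0 < y" "x + y \<le> 0" "y - x \<le> 1"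
    | "x < 0" "0 < y" "x + y \<le> 0" "y - x \<ge> 1"
    | "x < 0" "0 < y" "0 \<le> x + y" "y \<le> 0.53" | "x < 0" "0.53 \<le> y" "0 \<le> x + y" "x + y \<le> 1/4"
    | "x < 0" "0 < y" "1/4 \<le> x + y" by linarith
  then show ?thesis
  proof cases
    case 1
    then show ?thesis using two_point_left_left[of x y] xy sq by (simp add: la)
  next
    case 2
    then show ?thesis using two_point_right[OF \<beta>, of x y] xy by (simp add: pr)
  next
    case 3
    then show ?thesis using straddle_left_sqrt[of y "- x"] sq by (simp add: la pr add.commute)
  next
    case 4
    then show ?thesis using straddle_left_chord[OF c, of y "- x"] xy by (simp add: la pr add.commute)
  next
    case 5
    then show ?thesis using straddle_right_small(1)[OF \<beta>, of y "- x"] by (simp add: la pr add.commute)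
  next
    case 6
    then show ?thesis using straddle_right_chord[OF c, of y "- x"] xy by (simp add: la pr add.commute)
  next
    case 7
    then show ?thesis using straddle_right_far[OF \<beta>, of "- x" y] xy sq by (simp add: la pr add.commute)
  qed
qed

section \<open>The profile of subcubes\<close>

lemma powr_le_young:
  fixes x a :: real
  assumes "0 < x" "0 \<le> a" "a \<le> 1"
  shows "x powr a \<le> 1 + a * (x - 1)"
  using Youngs_inequality_0[of a "1 - a" x 1] assms by (simp add: algebra_simps)

lemma powr_one_plus_ge:
  fixes x \<beta> :: real
  assumes \<beta>: "0 \<le> \<beta>" "\<beta> \<le> 1" and x: "0 \<le> x"
  shows "1 + \<beta> * x - x\<^sup>2 / 8 \<le> (1 + x) powr \<beta>"
proof -
  have "(\<beta> * x - x\<^sup>2 / 8) - (\<beta> * 0 - 0\<^sup>2 / 8) \<le> (1 + x) powr \<beta> - (1 + 0) powr \<beta>"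
  proof (rule increment_le[where f' = "\<lambda>t. \<beta> - t / 4" and h' = "\<lambda>t. \<beta> * (1 + t) powr (\<beta> - 1)"])
    fix t assume t: "0 < t" "t < x"
    have "1 \<le> (1 + (1 - \<beta>) * t) * (1 + t) powr (\<beta> - 1)"
    proof -
      have "(1 + t) powr (1 - \<beta>) \<le> 1 + (1 - \<beta>) * t" using powr_le_young[of "1 + t" "1 - \<beta>"] t \<beta> by simp
      then have "(1 + t) powr (1 - \<beta>) * (1 + t) powr (\<beta> - 1) \<le> (1 + (1 - \<beta>) * t) * (1 + t) powr (\<beta> - 1)"
        by (intro mult_right_mono) auto
      then show ?thesis using t by (simp flip: powr_add)
    qed
    moreover have "(1 + t) powr (\<beta> - 1) \<le> 1" using t \<beta> powr_mono[of "\<beta> - 1" 0 "1 + t"] by simp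
    then have "(1 - \<beta>) * t * (1 + t) powr (\<beta> - 1) \<le> (1 - \<beta>) * t * 1"
      using t \<beta> by (intro mult_left_mono) auto
    ultimately have "1 - (1 - \<beta>) * t \<le> (1 + t) powr (\<beta> - 1)" by (simp add: algebra_simps)
    then have "\<beta> * (1 - (1 - \<beta>) * t) \<le> \<beta> * (1 + t) powr (\<beta> - 1)" using \<beta> by (intro mult_left_mono) auto
    moreover have "\<beta> * (1 - \<beta>) \<le> 1/4"
      using zero_le_power2[of "\<beta> - 1/2"] by (simp add: power2_eq_square algebra_simps)
    then have "\<beta> * (1 - \<beta>) * t \<le> 1/4 * t" using t by (intro mult_right_mono) auto
    ultimately show "\<beta> - t / 4 \<le> \<beta> * (1 + t) powr (\<beta> - 1)" by (simp add: algebra_simps)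
  qed (use x in \<open>auto intro!: continuous_intros derivative_eq_intros\<close>)
  then show ?thesis by simp
qed

lemma powr_one_minus_ge:
  fixes r \<beta> :: real
  assumes \<beta>: "0 \<le> \<beta>" "\<beta> \<le> 1" and r: "0 \<le> r" "r \<le> 1/16"
  shows "1 - \<beta> * r - 0.15 * r\<^sup>2 \<le> (1 - r) powr \<beta>"
proof -
  have "(- \<beta> * r - 0.15 * r\<^sup>2) - (- \<beta> * 0 - 0.15 * 0\<^sup>2) \<le> (1 - r) powr \<beta> - (1 - 0) powr \<beta>"
  proof (rule increment_le[where f' = "\<lambda>t. - \<beta> - 0.3 * t" and h' = "\<lambda>t. - \<beta> * (1 - t) powr (\<beta> - 1)"])
    fix t assume t: "0 < t" "t < r"
    have t1: "0 < 1 - t" using t r by simp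
    have "(1 - t) powr (\<beta> - 1) = (1 / (1 - t)) powr (1 - \<beta>)"
      using t1 powr_minus_divide[of "1 - t" "1 - \<beta>"] by (simp add: powr_divide)
    also have "\<dots> \<le> 1 + (1 - \<beta>) * (1 / (1 - t) - 1)" by (rule powr_le_young) (use t1 \<beta> in auto)
    also have "1 / (1 - t) - 1 \<le> 16/15 * t"
    proof -
      have "0 \<le> t * (1/15 - 16/15 * t)" using t r by (intro mult_nonneg_nonneg) auto
      then show ?thesis using t1 by (simp add: field_simps)
    qed
    finally have "(1 - t) powr (\<beta> - 1) \<le> 1 + (1 - \<beta>) * (16/15 * t)"
      using \<beta> by (simp add: mult_left_mono)
    then have "\<beta> * (1 - t) powr (\<beta> - 1) \<le> \<beta> * (1 + (1 - \<beta>) * (16/15 * t))" using \<beta> by (intro mult_left_mono) auto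
    moreover have "\<beta> * (1 - \<beta>) \<le> 1/4"
      using zero_le_power2[of "\<beta> - 1/2"] by (simp add: power2_eq_square algebra_simps)
    then have "\<beta> * (1 - \<beta>) * (16/15 * t) \<le> 1/4 * (16/15 * t)" using t by (intro mult_right_mono) auto
    ultimately show "- \<beta> - 0.3 * t \<le> - \<beta> * (1 - t) powr (\<beta> - 1)" using t by (simp add: field_simps)
    show "((\<lambda>x. (1 - x) powr \<beta>) has_real_derivative - \<beta> * (1 - t) powr (\<beta> - 1)) (at t)"
      using t1 by (auto intro!: derivative_eq_intros)
  qed (use r in \<open>auto intro!: continuous_intros derivative_eq_intros\<close>)
  then show ?thesis by simp
qed

lemma ln_one_minus_upper:
  fixes z :: real assumes "0 \<le> z" "z < 1" shows "z + z\<^sup>2 / 2 \<le> - ln (1 - z)"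
proof -
  have "(z + z\<^sup>2 / 2) - (0 + 0\<^sup>2 / 2) \<le> - ln (1 - z) - (- ln (1 - 0))"
  proof (rule increment_le[where f' = "\<lambda>t. 1 + t" and h' = "\<lambda>t. 1 / (1 - t)"])
    show "1 + t \<le> 1 / (1 - t)" if "0 < t" "t < z" for t
      using that assms by (simp add: field_simps)
  qed (use assms in \<open>auto intro!: continuous_intros derivative_eq_intros\<close>)
  then show ?thesis by simp
qed

lemma ln_one_plus_cubic:
  fixes z :: real assumes "0 \<le> z" shows "ln (1 + z) \<le> z - z\<^sup>2 / 2 + z ^ 3 / 3"
proof -
  have "ln (1 + z) - ln (1 + 0) \<le> (z - z\<^sup>2 / 2 + z ^ 3 / 3) - (0 - 0\<^sup>2 / 2 + 0 ^ 3 / 3)"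
  proof (rule increment_le[where h' = "\<lambda>t. 1 - t + t\<^sup>2" and f' = "\<lambda>t. 1 / (1 + t)"])
    fix t :: real assume t: "0 < t" "t < z"
    have "1 \<le> (1 - t + t\<^sup>2) * (1 + t)" using t by (simp add: algebra_simps power2_eq_square)
    then show "1 / (1 + t) \<le> 1 - t + t\<^sup>2" using t by (simp add: divide_le_eq)
  qed (use assms in \<open>auto intro!: continuous_intros derivative_eq_intros\<close>)
  then show ?thesis by simp
qed

lemma sixteen_powr_bounds:
  assumes "\<beta> = beta0" shows "4 \<le> 16 powr \<beta>" "16 powr \<beta> \<le> 4.04"
proof -
  have 4: "16 powr (1/2) = (4::real)" by (simp add: powr_half_sqrt)
  have "16 powr (1/2) \<le> (16::real) powr \<beta>" using assms by (intro powr_mono) auto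
  then show "4 \<le> 16 powr \<beta>" by (simp only: 4)
  have "16 powr \<beta> = 16 powr (1/2) * 16 powr (\<beta> - 1/2)" using powr_add[of 16 "1/2" "\<beta> - 1/2"] by simp
  also have "16 powr (\<beta> - 1/2) \<le> 1 + (\<beta> - 1/2) * (16 - 1)" by (rule powr_le_young) (use assms in auto)
  finally show "16 powr \<beta> \<le> 4.04" by (simp add: 4 assms)
qed

text \<open>With \<open>N = log 2 (1 / \<rho>)\<close> for the midpoint \<open>\<rho>\<close> and points \<open>\<rho> * (1 - z)\<close>, \<open>\<rho> * (1 + z)\<close>, the factor \<open>\<rho>\<close> cancels.
For small \<open>z\<close> a second-order expansion suffices: the first-order terms in \<open>z\<close> cancel, the entropy costs
about \<open>z\<^sup>2 / ln 2\<close> and the distance gains about \<open>4 * z\<^sup>2\<close>. For large \<open>z\<close> the first summand falls short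
of \<open>(1 + z) * N powr \<beta>\<close> only by a term of order \<open>N powr (\<beta> - 1)\<close>, and the distance term \<open>A\<close> alone lifts
the second summand above \<open>(1 - z) * N powr \<beta>\<close> by more.\<close>

lemma subcube_prof_two_point_normalized:
  fixes N z :: real
  assumes \<beta>: "\<beta> = beta0" and L: "16 \<le> N" and z: "0 \<le> z" "z < 1"
  shows "2 * N powr \<beta> \<le> (1 + z) * (N - log 2 (1 + z)) powr \<beta>
    + (1 - z) * (N - log 2 (1 - z) + (2 * z / (1 - z)) powr (1 / \<beta>)) powr \<beta>"
proof -
  define a b A where "a = - log 2 (1 - z)" and "b = log 2 (1 + z)" and "A = (2 * z / (1 - z)) powr (1 / \<beta>)"
  define q :: real where "q = 1 / ln 2"
  have q: "0 < q" "q \<le> 3/2" using ln2_ge_two_thirds by (auto simp: q_def field_simps)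
  have \<beta>01: "0 \<le> \<beta>" "\<beta> \<le> 1" using \<beta> by auto
  have bz: "0 \<le> b" "b \<le> 1" "b \<le> q * z" "b \<le> q * (z - z\<^sup>2 / 2 + z ^ 3 / 3)"
  proof -
    show "0 \<le> b" using z by (simp add: b_def)
    show "b \<le> 1" using z by (simp add: b_def log_le_iff)
    have "b = q * ln (1 + z)" by (simp add: b_def q_def log_def)
    then show "b \<le> q * z" "b \<le> q * (z - z\<^sup>2 / 2 + z ^ 3 / 3)"
      using q z ln_one_plus_cubic[of z] ln_add_one_self_le_self[of z] by (auto intro!: mult_left_mono)
  qed
  have a0: "0 \<le> a" and az: "q * (z + z\<^sup>2 / 2) \<le> a"
  proof -
    have "a = q * (- ln (1 - z))" by (simp add: a_def q_def log_def)
    moreover have "q * (z + z\<^sup>2 / 2) \<le> q * (- ln (1 - z))"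
      using q ln_one_minus_upper[OF z] by (intro mult_left_mono) auto
    ultimately show az: "q * (z + z\<^sup>2 / 2) \<le> a" by simp
    have "0 \<le> q * (z + z\<^sup>2 / 2)" using q z by simp
    with az show "0 \<le> a" by simp
  qed
  have A0: "0 \<le> A" by (simp add: A_def)
  have Lp: "0 < N powr \<beta>" using L by simp
  define r where "r = b / N"
  have "b * 16 \<le> 1 * N" using bz L by (intro mult_mono) auto
  then have r: "0 \<le> r" "r \<le> 1/16" using bz L by (auto simp: r_def field_simps)
  have lowb: "(N - b) powr \<beta> \<ge> N powr \<beta> * (1 - \<beta> * r - 0.15 * r\<^sup>2)"
  proof -
    have "N - b = N * (1 - r)" using L by (simp add: r_def field_simps)
    then have "(N - b) powr \<beta> = N powr \<beta> * (1 - r) powr \<beta>" using L r by (simp add: powr_mult)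
    then show ?thesis using powr_one_minus_ge[OF \<beta>01 r] Lp by simp
  qed
  have upx: "(N + x) powr \<beta> \<ge> N powr \<beta> * (1 + \<beta> * (x / N) - (x / N)\<^sup>2 / 8)" if "0 \<le> x" for x
  proof -
    have "N + x = N * (1 + x / N)" using L by (simp add: field_simps)
    then have "(N + x) powr \<beta> = N powr \<beta> * (1 + x / N) powr \<beta>" using L that by (simp add: powr_mult)
    then show ?thesis using powr_one_plus_ge[OF \<beta>01, of "x / N"] Lp L that by simp
  qed
  have "2 * N powr \<beta> \<le> (1 + z) * (N - b) powr \<beta> + (1 - z) * (N + (a + A)) powr \<beta>"
  proof (cases "z \<le> 0.45")
    case True
    define \<alpha> where "\<alpha> = q * (z + z\<^sup>2 / 2) + 4 * z\<^sup>2"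
    have \<alpha>0: "0 \<le> \<alpha>" using q z by (simp add: \<alpha>_def)
    have "1 / \<beta> \<le> 2" unfolding \<beta> by simp
    then have "(2 * z) powr 2 \<le> (2 * z) powr (1 / \<beta>)" using z True by (intro powr_mono') auto
    also have "\<dots> \<le> A" unfolding A_def using z \<beta> by (intro powr_mono2) (auto simp: field_simps)
    finally have "4 * z\<^sup>2 \<le> A" using z by (cases "z = 0") (auto simp: power2_eq_square)
    then have "\<alpha> \<le> a + A" using az by (simp add: \<alpha>_def)
    then have "(N + \<alpha>) powr \<beta> \<le> (N + (a + A)) powr \<beta>" using \<alpha>0 L \<beta> by (intro powr_mono2) auto
    then have 1: "(N + (a + A)) powr \<beta> \<ge> N powr \<beta> * (1 + \<beta> * (\<alpha> / N) - (\<alpha> / N)\<^sup>2 / 8)"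
      using upx[OF \<alpha>0] by simp
    have "2 \<le> (1 + z) * (1 - \<beta> * r - 0.15 * r\<^sup>2) + (1 - z) * (1 + \<beta> * (\<alpha> / N) - (\<alpha> / N)\<^sup>2 / 8)"
    proof -
      have "0 \<le> (1 - z) * (\<beta> * \<alpha> - \<alpha>\<^sup>2 / (8 * N)) - (1 + z) * (\<beta> * b + 0.15 * b\<^sup>2 / N)"
      proof -
        have "\<alpha> = z * (q * (1 + z / 2) + 4 * z)" by (simp add: \<alpha>_def algebra_simps power2_eq_square)
        also have "\<dots> \<le> z * (3/2 * (1 + 0.45 / 2) + 4 * 0.45)"
          using q z True by (intro mult_left_mono add_mono mult_mono) auto
        also have "\<dots> \<le> 3.65 * z" using z by simp
        finally have "\<alpha>\<^sup>2 \<le> (3.65 * z)\<^sup>2" using \<alpha>0 by (intro power_mono) auto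
        then have "\<alpha>\<^sup>2 / (8 * N) \<le> (3.65 * z)\<^sup>2 / (8 * 16)" using L by (intro frac_le) auto
        also have "(3.65 * z)\<^sup>2 / (8 * 16) = 13.3225 / 128 * z\<^sup>2" by (simp add: power2_eq_square)
        also have "\<dots> \<le> 0.105 * z\<^sup>2" by (intro mult_right_mono) auto
        finally have "\<alpha>\<^sup>2 / (8 * N) \<le> 0.105 * z\<^sup>2" .
        then have "(1 - z) * (\<alpha>\<^sup>2 / (8 * N)) \<le> 1 * (0.105 * z\<^sup>2)" using z L by (intro mult_mono) auto
        moreover have "(1 + z) * (0.15 * b\<^sup>2 / N) \<le> 0.031 * z\<^sup>2"
        proof -
          have "b\<^sup>2 \<le> (3/2 * z)\<^sup>2"
            using bz mult_right_mono[OF q(2), of z] z by (intro power_mono) auto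
          then have "0.15 * b\<^sup>2 / N \<le> 0.15 * (3/2 * z)\<^sup>2 / 16" using L by (intro frac_le) auto
          then have "(1 + z) * (0.15 * b\<^sup>2 / N) \<le> 1.45 * (0.15 * (3/2 * z)\<^sup>2 / 16)" using z L True by (intro mult_mono) auto
          also have "1.45 * (0.15 * (3/2 * z)\<^sup>2 / 16) = 1.45 * 0.15 * 9 / 64 * z\<^sup>2" by (simp add: power2_eq_square)
          also have "\<dots> \<le> 0.031 * z\<^sup>2" by (intro mult_right_mono) auto
          finally show ?thesis .
        qed
        moreover have "0.37 * z\<^sup>2 \<le> (1 - z) * \<alpha> - (1 + z) * b"
        proof -
          have "z * (4 + q / 3) \<le> 0.45 * (4 + 1/2)" using z True q by (intro mult_mono) auto
          moreover have "q * z\<^sup>2 \<le> 3/2 * 0.45\<^sup>2" using z True q by (intro mult_mono power_mono) auto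
          ultimately have "0.37 \<le> 4 - q - z * (4 + q / 3) - q * z\<^sup>2 / 3" using q by (simp add: power2_eq_square)
          then have "0.37 * z\<^sup>2 \<le> (4 - q - z * (4 + q / 3) - q * z\<^sup>2 / 3) * z\<^sup>2" by (intro mult_right_mono) auto
          also have "\<dots> = (1 - z) * \<alpha> - (1 + z) * (q * (z - z\<^sup>2 / 2 + z ^ 3 / 3))"
            by (simp add: \<alpha>_def field_simps power2_eq_square power3_eq_cube)
          also have "\<dots> \<le> (1 - z) * \<alpha> - (1 + z) * b"
            using bz(4) z by (intro diff_left_mono mult_left_mono) auto
          finally show ?thesis .
        qed
        then have "\<beta> * (0.37 * z\<^sup>2) \<le> \<beta> * ((1 - z) * \<alpha> - (1 + z) * b)" using \<beta>01 by (intro mult_left_mono) auto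
        moreover have "0.18 * z\<^sup>2 \<le> \<beta> * (0.37 * z\<^sup>2)"
          unfolding \<beta> using zero_le_power2[of z] by simp
        moreover have "(1 - z) * (\<beta> * \<alpha> - \<alpha>\<^sup>2 / (8 * N)) - (1 + z) * (\<beta> * b + 0.15 * b\<^sup>2 / N)
            = \<beta> * ((1 - z) * \<alpha> - (1 + z) * b) - (1 - z) * (\<alpha>\<^sup>2 / (8 * N)) - (1 + z) * (0.15 * b\<^sup>2 / N)"
          by (simp only: algebra_simps)
        moreover have "0 \<le> X - Y - W"
          if "Y \<le> 1 * (0.105 * Q)" "W \<le> 0.031 * Q" "0.18 * Q \<le> V" "V \<le> X" "0 \<le> Q" for X Y W V Q :: real
          using that by simp
        ultimately show ?thesis by (metis zero_le_power2)
      qed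
      then have "0 \<le> ((1 - z) * (\<beta> * \<alpha> - \<alpha>\<^sup>2 / (8 * N)) - (1 + z) * (\<beta> * b + 0.15 * b\<^sup>2 / N)) / N"
        using L by simp
      also have "\<dots> = (1 + z) * (1 - \<beta> * r - 0.15 * r\<^sup>2) + (1 - z) * (1 + \<beta> * (\<alpha> / N) - (\<alpha> / N)\<^sup>2 / 8) - 2"
        using L by (simp add: r_def field_simps power2_eq_square)
      finally show ?thesis by simp
    qed
    then have "N powr \<beta> * 2 \<le> N powr \<beta> * ((1 + z) * (1 - \<beta> * r - 0.15 * r\<^sup>2) + (1 - z) * (1 + \<beta> * (\<alpha> / N) - (\<alpha> / N)\<^sup>2 / 8))"
      using Lp by (intro mult_left_mono) auto
    also have "\<dots> = (1 + z) * (N powr \<beta> * (1 - \<beta> * r - 0.15 * r\<^sup>2)) + (1 - z) * (N powr \<beta> * (1 + \<beta> * (\<alpha> / N) - (\<alpha> / N)\<^sup>2 / 8))"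
      by (simp only: distrib_left mult_ac)
    also have "\<dots> \<le> (1 + z) * (N - b) powr \<beta> + (1 - z) * (N + (a + A)) powr \<beta>"
      using z lowb 1 by (intro add_mono mult_left_mono) auto
    finally show ?thesis by simp
  next
    case False
    define R where "R = 2 * z / (1 - z)"
    have R1: "1 \<le> R" using False z by (simp add: R_def field_simps)
    have Rz: "(1 - z) * R = 2 * z" using z by (simp add: R_def)
    have RA: "A = R powr (1 / \<beta>)" "A powr \<beta> = R" using z \<beta> by (auto simp: A_def R_def powr_powr)
    have "0.15 * r\<^sup>2 \<le> 0.01 * r" using r mult_right_mono[of r "1/16" r] by (simp add: power2_eq_square)
    then have lowb2: "N powr \<beta> - (N - b) powr \<beta> \<le> N powr \<beta> * (0.511 * r)"
    proof -
      have "1 - 0.511 * r \<le> 1 - \<beta> * r - 0.15 * r\<^sup>2"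
        using \<open>0.15 * r\<^sup>2 \<le> 0.01 * r\<close> r unfolding \<beta> by (simp add: algebra_simps)
      then have "N powr \<beta> * (1 - 0.511 * r) \<le> N powr \<beta> * (1 - \<beta> * r - 0.15 * r\<^sup>2)" using Lp by simp
      with lowb show ?thesis by (simp add: algebra_simps)
    qed
    have mono: "(N + A) powr \<beta> \<le> (N + (a + A)) powr \<beta>" using a0 A0 L \<beta> by (intro powr_mono2) auto
    have "(1 + z) * (N powr \<beta> * (0.511 * r)) \<le> (1 - z) * ((N + A) powr \<beta> - N powr \<beta>)"
    proof (cases "A \<le> N")
      case True
      define x where "x = A / N"
      have x: "0 \<le> x" "x \<le> 1" using True A0 L by (auto simp: x_def)
      have "N powr \<beta> * (0.3755 * x) \<le> (N + A) powr \<beta> - N powr \<beta>"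
      proof -
        have "x\<^sup>2 \<le> x" using x mult_right_mono[of x 1 x] by (simp add: power2_eq_square)
        then have "1 + 0.3755 * x \<le> 1 + \<beta> * x - x\<^sup>2 / 8" using x unfolding \<beta> by (simp add: algebra_simps)
        then have "N powr \<beta> * (1 + 0.3755 * x) \<le> N powr \<beta> * (1 + \<beta> * x - x\<^sup>2 / 8)" using Lp by simp
        also have "\<dots> \<le> (N + A) powr \<beta>" using upx[OF A0] by (simp add: x_def)
        finally show ?thesis by (simp add: algebra_simps)
      qed
      then have "(1 - z) * (N powr \<beta> * (0.3755 * x)) \<le> (1 - z) * ((N + A) powr \<beta> - N powr \<beta>)"
        using z by (intro mult_left_mono) auto
      moreover have "(1 + z) * (0.511 * b) \<le> (1 - z) * (0.3755 * A)"
      proof -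
        have "R powr (1 / \<beta>) = R * R powr (1 / \<beta> - 1)" using R1 by (simp add: powr_diff)
        then have "(1 - z) * A = 2 * z * R powr (1 / \<beta> - 1)" using Rz unfolding RA(1) by simp
        moreover have "R powr (1 / \<beta> - 1) \<ge> 1.03 * (1 + z)"
        proof -
          define y where "y = 1.12 * (1 + z)"
          have y: "1 \<le> y" "y \<le> 2.24" using z by (auto simp: y_def)
          have e: "0 \<le> 2 - 1 / \<beta>" "2 - 1 / \<beta> \<le> 0.0023" "0 \<le> 1 / \<beta> - 1" unfolding \<beta> by simp_all
          have "0 \<le> (z - 0.45) * (1.12 * z + 2.504)" using False z by (intro mult_nonneg_nonneg) auto
          then have "y \<le> R" using False z by (simp add: y_def R_def field_simps)
          then have "y powr (1 / \<beta> - 1) \<le> R powr (1 / \<beta> - 1)" using e y by (intro powr_mono2) auto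
          moreover have "y powr (2 - 1 / \<beta>) \<le> 1.003"
          proof -
            have "y powr (2 - 1 / \<beta>) \<le> 1 + (2 - 1 / \<beta>) * (y - 1)" by (rule powr_le_young) (use y e in auto)
            also have "\<dots> \<le> 1 + 0.0023 * 1.24" using e y by (intro add_left_mono mult_mono) auto
            finally show ?thesis by simp
          qed
          then have "y powr (1 / \<beta> - 1) * y powr (2 - 1 / \<beta>) \<le> y powr (1 / \<beta> - 1) * 1.003" by (intro mult_left_mono) auto
          then have "y \<le> y powr (1 / \<beta> - 1) * 1.003" using y by (simp flip: powr_add)
          ultimately show ?thesis using z by (simp add: y_def)
        qed
        then have "2 * z * (1.03 * (1 + z)) \<le> 2 * z * R powr (1 / \<beta> - 1)" using z by (intro mult_left_mono) auto
        moreover have "(1 + z) * (0.511 * b) \<le> (1 + z) * (0.511 * (3/2 * z))"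
          using bz mult_right_mono[OF q(2), of z] z by (intro mult_left_mono) auto
        moreover have "(1 + z) * (0.511 * (3/2 * z)) \<le> 0.3755 * (2 * z * (1.03 * (1 + z)))"
          using z by (simp add: field_simps)
        ultimately show ?thesis by (simp add: mult.left_commute[of "1 - z"])
      qed
      then have "N powr \<beta> / N * ((1 + z) * (0.511 * b)) \<le> N powr \<beta> / N * ((1 - z) * (0.3755 * A))"
        using L by (intro mult_left_mono) auto
      moreover have "(1 + z) * (N powr \<beta> * (0.511 * r)) = N powr \<beta> / N * ((1 + z) * (0.511 * b))"
        unfolding r_def by algebra
      moreover have "(1 - z) * (N powr \<beta> * (0.3755 * x)) = N powr \<beta> / N * ((1 - z) * (0.3755 * A))"
        unfolding x_def by algebra
      ultimately show ?thesis by linarith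
    next
      case AL: False
      have "N powr \<beta> \<le> A powr \<beta>" using AL L \<beta> by (intro powr_mono2) auto
      moreover have "16 powr \<beta> \<le> N powr \<beta>" using L \<beta> by (intro powr_mono2) auto
      ultimately have R4: "4 \<le> R" using sixteen_powr_bounds(1)[OF \<beta>] RA(2) by simp
      then have "(1 - z) * 4 \<le> 2 * z" using Rz mult_left_mono[OF R4, of "1 - z"] z by simp
      then have z23: "2/3 \<le> z" by simp
      define x where "x = N / A"
      have x: "0 < x" "x \<le> 1" "N = A * x" using AL L by (auto simp: x_def)
      have "0.3755 * R \<le> (N + A) powr \<beta> - N powr \<beta>"
      proof -
        have "x\<^sup>2 \<le> 1" using x by (simp add: power_le_one)
        moreover have "x powr \<beta> \<le> 1 + \<beta> * (x - 1)" by (rule powr_le_young) (use x \<beta> in auto)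
        moreover have "1 + \<beta> * x - x\<^sup>2 / 8 \<le> (1 + x) powr \<beta>" by (rule powr_one_plus_ge[OF \<beta>01]) (use x in simp)
        ultimately have "0.3755 \<le> (1 + x) powr \<beta> - x powr \<beta>" unfolding \<beta> by (simp add: field_simps)
        then have "R * 0.3755 \<le> R * ((1 + x) powr \<beta> - x powr \<beta>)" using R1 by (intro mult_left_mono) auto
        also have "\<dots> = (A * (1 + x)) powr \<beta> - (A * x) powr \<beta>"
          using x A0 powr_mult[of A "1 + x" \<beta>] powr_mult[of A x \<beta>] by (simp only: RA(2) right_diff_distrib)
        also have "A * (1 + x) = N + A" by (simp add: x(3) algebra_simps)
        finally show ?thesis by (simp add: x(3))
      qed
      then have gain: "(1 - z) * (0.3755 * R) \<le> (1 - z) * ((N + A) powr \<beta> - N powr \<beta>)"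
        using z by (intro mult_left_mono) auto
      have "(1 + z) * (N powr \<beta> * (0.511 * r)) \<le> 0.5"
      proof -
        have "16 powr (1 - \<beta>) * 4.04 \<ge> (16::real)"
        proof -
          have "16 powr (1 - \<beta>) * 16 powr \<beta> = (16::real)" by (simp flip: powr_add)
          moreover have "16 powr (1 - \<beta>) * 16 powr \<beta> \<le> 16 powr (1 - \<beta>) * (4.04::real)"
            by (intro mult_left_mono sixteen_powr_bounds(2)[OF \<beta>]) auto
          ultimately show ?thesis by simp
        qed
        moreover have "16 powr (1 - \<beta>) \<le> N powr (1 - \<beta>)" using L \<beta> by (intro powr_mono2) auto
        ultimately have "3.9 \<le> N powr (1 - \<beta>)" by simp
        then have "3.9 * N powr \<beta> \<le> N powr (1 - \<beta>) * N powr \<beta>" by (intro mult_right_mono) auto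
        also have "\<dots> = N" using L by (simp flip: powr_add)
        finally have LL: "N powr \<beta> / N \<le> 1 / 3.9" using L by (simp add: field_simps)
        have "N powr \<beta> * (0.511 * r) = 0.511 * b * (N powr \<beta> / N)" by (simp add: r_def)
        also have "\<dots> \<le> 0.511 * 1 * (1 / 3.9)" using bz LL L by (intro mult_mono) auto
        finally have X: "N powr \<beta> * (0.511 * r) \<le> 0.511 * 1 * (1 / 3.9)" .
        have "(1 + z) * (N powr \<beta> * (0.511 * r)) \<le> 2 * (0.511 * 1 * (1 / 3.9))"
          by (rule mult_mono[OF _ X]) (use z r in auto)
        then show ?thesis by simp
      qed
      also have "0.5 \<le> 0.3755 * (2 * z)" using z23 by simp
      also have "\<dots> = (1 - z) * (0.3755 * R)" by (simp add: Rz[symmetric])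
      also note gain
      finally show ?thesis .
    qed
    moreover have "(1 - z) * (N + A) powr \<beta> \<le> (1 - z) * (N + (a + A)) powr \<beta>"
      using mono z by (intro mult_left_mono) auto
    moreover have "(1 + z) * (N powr \<beta> - (N - b) powr \<beta>) \<le> (1 + z) * (N powr \<beta> * (0.511 * r))"
      using lowb2 z by (intro mult_left_mono) auto
    ultimately show ?thesis by (simp add: field_simps)
  qed
  moreover have "N + (a + A) = N - log 2 (1 - z) + (2 * z / (1 - z)) powr (1 / \<beta>)" by (simp add: a_def A_def)
  ultimately show ?thesis by (simp only: b_def)
qed

text \<open>The value of the boundary functional on a subcube of density \<open>d\<close>.\<close>

definition subcube_prof :: "real \<Rightarrow> real \<Rightarrow> real" where
  "subcube_prof \<beta> d = d * log 2 (1 / d) powr \<beta>"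

lemma subcube_prof_0 [simp]: "subcube_prof \<beta> 0 = 0"
  by (simp add: subcube_prof_def)

lemma subcube_prof_nonneg: "0 \<le> d \<Longrightarrow> 0 \<le> subcube_prof \<beta> d"
  by (simp add: subcube_prof_def)

text \<open>The argument of \<open>subcube_prof\<close> is the density of the complement, so the norm acts on the value at the
smaller point, where it gains most.\<close>

lemma subcube_prof_two_point:
  assumes \<beta>: "\<beta> = beta0" and st: "0 \<le> s" "s \<le> t" "(s + t) / 2 \<le> 1 / 2 ^ 16"
  shows "2 * subcube_prof \<beta> ((s + t) / 2) \<le> subcube_prof \<beta> t + pnorm (1 / \<beta>) (subcube_prof \<beta> s) (t - s)"
proof -
  define \<rho> where "\<rho> = (s + t) / 2"
  have \<beta>': "0 < \<beta>" "1 \<le> 1 / \<beta>" unfolding \<beta> by simp_all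
  show ?thesis
  proof (cases "\<rho> = 0")
    case True
    then have "s = 0" "t = 0" using st by (auto simp: \<rho>_def)
    then show ?thesis using pnorm_nonneg by simp
  next
    case False
    then have \<rho>: "0 < \<rho>" "\<rho> \<le> 1 / 2 ^ 16" using st by (auto simp: \<rho>_def)
    define N where "N = log 2 (1 / \<rho>)"
    have "(2::real) powr 16 \<le> 1 / \<rho>" using \<rho> by (simp add: field_simps)
    then have L: "16 \<le> N" using \<rho> by (simp add: N_def le_log_iff)
    define z where "z = (t - s) / (2 * \<rho>)"
    have z: "0 \<le> z" "z \<le> 1" "s = \<rho> * (1 - z)" "t = \<rho> * (1 + z)"
      using st \<rho> by (auto simp: z_def \<rho>_def field_simps)
    have lg: "log 2 (1 / (\<rho> * u)) = N - log 2 u" if "0 < u" for u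
    proof -
      have "1 / (\<rho> * u) = (1 / \<rho>) / u" by simp
      then show ?thesis using \<rho> that unfolding N_def by (simp only: log_divide) simp
    qed
    have tt: "subcube_prof \<beta> t = \<rho> * ((1 + z) * (N - log 2 (1 + z)) powr \<beta>)"
      unfolding subcube_prof_def z(4) using z by (simp add: lg)
    have tr: "subcube_prof \<beta> \<rho> = \<rho> * N powr \<beta>" by (simp add: subcube_prof_def N_def)
    have "2 * subcube_prof \<beta> \<rho> \<le> subcube_prof \<beta> t + pnorm (1 / \<beta>) (subcube_prof \<beta> s) (t - s)"
    proof (cases "z = 1")
      case True
      have "pnorm (1 / \<beta>) ((N - 1) powr \<beta> + 0) (0 + 1) \<le> pnorm (1 / \<beta>) ((N - 1) powr \<beta>) 0 + pnorm (1 / \<beta>) 0 1"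
        by (rule pnorm_triangle) (use \<beta>' in auto)
      then have "N powr \<beta> \<le> (N - 1) powr \<beta> + 1"
        using \<beta>' L by (simp add: pnorm_0_left pnorm_0_right) (simp add: pnorm_def powr_powr)
      then have "\<rho> * (2 * N powr \<beta>) \<le> \<rho> * (2 * ((N - 1) powr \<beta> + 1))" using \<rho> by (intro mult_left_mono) auto
      then show ?thesis unfolding tt tr using True z \<rho> \<beta>'
        by (simp add: pnorm_0_left algebra_simps)
    next
      case False
      then have z1: "z < 1" using z by simp
      define A where "A = (2 * z / (1 - z)) powr (1 / \<beta>)"
      define M where "M = N - log 2 (1 - z)"
      have M: "0 \<le> M"
      proof -
        have "log 2 (1 - z) \<le> 0" using z z1 by simp
        then show ?thesis using L by (simp add: M_def)
      qed
      have c: "0 < \<rho> * (1 - z)" using \<rho> z1 by simp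
      have "subcube_prof \<beta> s = \<rho> * (1 - z) * M powr \<beta>" unfolding subcube_prof_def z(3) M_def using z1 by (simp add: lg)
      moreover have "t - s = \<rho> * (1 - z) * (2 * z / (1 - z))"
      proof -
        have "t - s = \<rho> * (2 * z)" unfolding z(3,4) by (simp add: algebra_simps)
        then show ?thesis using z1 by simp
      qed
      ultimately have "pnorm (1 / \<beta>) (subcube_prof \<beta> s) (t - s) = \<rho> * (1 - z) * pnorm (1 / \<beta>) (M powr \<beta>) (2 * z / (1 - z))"
        using c z z1 \<beta>' by (simp only:) (rule pnorm_scale, auto)
      also have "pnorm (1 / \<beta>) (M powr \<beta>) (2 * z / (1 - z)) = (M + A) powr \<beta>"
        using M \<beta>' by (simp add: pnorm_def powr_powr A_def)
      finally have pn: "pnorm (1 / \<beta>) (subcube_prof \<beta> s) (t - s) = \<rho> * ((1 - z) * (M + A) powr \<beta>)" by simp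
      have "\<rho> * (2 * N powr \<beta>) \<le> \<rho> * ((1 + z) * (N - log 2 (1 + z)) powr \<beta> + (1 - z) * (M + A) powr \<beta>)"
        using subcube_prof_two_point_normalized[OF \<beta> L z(1) z1] \<rho> unfolding M_def A_def by (intro mult_left_mono) auto
      then show ?thesis unfolding tt tr pn by (simp add: algebra_simps)
    qed
    then show ?thesis by (simp add: \<rho>_def)
  qed
qed

text \<open>Below this value the tangent would have to have slope at least \<open>-4.04\<close> in order not to cross \<open>0\<close> before
\<open>1\<close>, but with such a slope the energy identity keeps \<open>prof\<close> above \<open>0.006\<close>.\<close>

lemma prof_near_1: "4.04 / 2 ^ 15 \<le> prof (1 - 1 / 2 ^ 15)"
proof (rule ccontr)
  assume n: "\<not> ?thesis"
  define w where "w = 1 - 1 / (2::real) ^ 15"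
  have w: "1/2 < w" "0 < w" "w < 1" "1 - w = 1 / 2 ^ 15" by (simp_all add: w_def)
  have "prof 1 \<le> prof w + slope w * (1 - w)" by (rule prof_le_tangent) (use w in auto)
  then have "- slope w * (1 / 2 ^ 15) \<le> prof w" unfolding w(4) by simp
  moreover have "prof w < 4.04 / 2 ^ 15" using n by (simp add: w_def)
  ultimately have s: "- 4.04 \<le> slope w" by simp
  have "(slope w)\<^sup>2 \<le> 4.04\<^sup>2" using s slope_le[of w] w by (intro power2_le_iff_abs_le[THEN iffD2]) auto
  then have "exp ((slope w)\<^sup>2 / 4) \<le> exp 5" by (simp add: power2_eq_square)
  also have "exp (5::real) = exp 1 ^ (5::nat)" by (simp flip: exp_of_nat_mult)
  also have "\<dots> \<le> (272/100) ^ (5::nat)" using e_less_272 by (intro power_mono) auto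
  also have "\<dots> \<le> (150::real)" by (simp add: power_numeral_reduce)
  finally have "energy \<le> prof w * 150"
    using prof_energy[OF w(2,3)] prof_nonneg[of w] w by (metis mult_left_mono less_imp_le)
  then have "prof w \<ge> 0.006" using energy_bounds by simp
  with \<open>prof w < 4.04 / 2 ^ 15\<close> show False by simp
qed

text \<open>With \<open>lg\<close> for \<open>log 2 (1 / d)\<close>, twice the subcube profile is a subsolution as long as
\<open>lg powr (2 * \<beta> - 1)\<close>, which is close to \<open>1\<close>, is not too large; both functions agree at \<open>d = 1/2\<close>.\<close>

lemma subcube_prof_le_prof:
  assumes \<beta>: "\<beta> = beta0" and d: "1 / 2 ^ 16 \<le> d" "d \<le> 1/2"
  shows "2 * subcube_prof \<beta> d \<le> prof (1 - 2 * d)"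
proof -
  define q :: real where "q = 1 / ln 2"
  have q: "0 < q" "q \<le> 3/2" using ln2_ge_two_thirds by (auto simp: q_def field_simps)
  define lg where "lg = (\<lambda>w::real. 1 - ln (1 - w) * q)"
  define S where "S = (\<lambda>w::real. (1 - w) * lg w powr \<beta>)"
  define S' where "S' = (\<lambda>w. - (lg w powr \<beta>) + \<beta> * q * lg w powr (\<beta> - 1))"
  define S'' where "S'' = (\<lambda>w. - (\<beta> * q / (1 - w)) * (lg w powr (\<beta> - 1) + (1 - \<beta>) * q * lg w powr (\<beta> - 2)))"
  have ST: "2 * subcube_prof \<beta> ((1 - w) / 2) = S w" if "w < 1" for w
  proof -
    have "1 / ((1 - w) / 2) = 2 / (1 - w)" by simp
    then have "log 2 (1 / ((1 - w) / 2)) = lg w"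
      using that by (simp only:) (simp add: lg_def q_def log_def ln_div diff_divide_distrib)
    then show ?thesis by (simp add: subcube_prof_def S_def)
  qed
  define e where "e = 1 - 1 / (2::real) ^ 15"
  have e: "e < 1" "0 \<le> e" by (simp_all add: e_def)
  have l_range: "1 \<le> lg w" "lg w \<le> 16" if "0 \<le> w" "w \<le> e" for w
  proof -
    have w1: "w < 1" using that e by simp
    have "ln (1 - w) \<le> 0" using that w1 by simp
    then show "1 \<le> lg w" using q by (simp add: lg_def mult_nonpos_nonneg)
    have "ln (1 / 2 ^ 15) \<le> ln (1 - w)" using that w1 by (subst ln_le_cancel_iff) (auto simp: e_def)
    moreover have "ln (1 / (2::real) ^ 15) = - 15 * ln 2"
      using ln_realpow[of 2 15] by (subst ln_div) auto
    ultimately have "- 15 * ln 2 \<le> ln (1 - w)" by (simp only:)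
    then have "- ln (1 - w) * q \<le> 15 * ln 2 * q" using q by (intro mult_right_mono) auto
    then show "lg w \<le> 16" by (simp add: lg_def q_def)
  qed
  have dl: "(lg has_real_derivative q / (1 - w)) (at w)" if "w < 1" for w
    unfolding lg_def using that by (auto intro!: derivative_eq_intros simp: field_simps)
  have "S (1 - 2 * d) \<le> prof (1 - 2 * d)"
  proof (rule prof_ge_subsolution[of 0 e S S' S''])
    have "continuous (at w) S" if "0 \<le> w" "w \<le> e" for w
    proof -
      have "continuous (at w) lg" using dl[of w] that e by (auto dest: DERIV_isCont)
      moreover have "lg w \<noteq> 0" using l_range[OF that] by simp
      ultimately show ?thesis unfolding S_def by (intro continuous_intros) auto
    qed
    then show "continuous_on {0..e} S" by (intro continuous_at_imp_continuous_on) auto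
    show "S 0 \<le> prof 0" by (simp add: S_def lg_def)
    show "S e \<le> prof e"
    proof -
      have "lg e powr \<beta> \<le> 16 powr \<beta>" using l_range[of e] e \<beta> by (intro powr_mono2) auto
      also have "\<dots> \<le> 4.04" by (rule sixteen_powr_bounds(2)[OF \<beta>])
      finally have "S e \<le> 1 / 2 ^ 15 * 4.04" unfolding S_def by (simp add: e_def)
      also have "\<dots> \<le> prof e" using prof_near_1 by (simp add: e_def)
      finally show ?thesis .
    qed
    fix w assume w: "0 < w" "w < e"
    then have w1: "w < 1" and lw: "1 \<le> lg w" "lg w \<le> 16" using e l_range[of w] by auto
    have D: "((\<lambda>w. lg w powr r) has_real_derivative r * lg w powr (r - 1) * (q / (1 - w))) (at w)" for r
      by (rule DERIV_chain2[OF has_real_derivative_powr dl[OF w1]]) (use lw in simp)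
    show "(S has_real_derivative S' w) (at w)"
    proof -
      have "(S has_real_derivative - 1 * lg w powr \<beta> + \<beta> * lg w powr (\<beta> - 1) * (q / (1 - w)) * (1 - w)) (at w)"
        unfolding S_def using DERIV_mult[OF DERIV_diff[OF DERIV_const DERIV_ident] D[of \<beta>], of 1] by simp
      then show ?thesis using w1 by (simp add: S'_def mult_ac)
    qed
    show "(S' has_real_derivative S'' w) (at w)"
    proof -
      have "(S' has_real_derivative - (\<beta> * lg w powr (\<beta> - 1) * (q / (1 - w)))
          + \<beta> * q * ((\<beta> - 1) * lg w powr (\<beta> - 1 - 1) * (q / (1 - w)))) (at w)"
        unfolding S'_def by (intro DERIV_add DERIV_minus DERIV_cmult D)
      moreover have "- (\<beta> * lg w powr (\<beta> - 1) * (q / (1 - w)))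
          + \<beta> * q * ((\<beta> - 1) * lg w powr (\<beta> - 1 - 1) * (q / (1 - w))) = S'' w"
      proof -
        have "- (\<beta> * u * c) + \<beta> * q * ((\<beta> - 1) * v * c) = - (\<beta> * c) * (u + (1 - \<beta>) * q * v)" for u v c
          by (simp add: algebra_simps)
        from this[of "lg w powr (\<beta> - 1)" "q / (1 - w)" "lg w powr (\<beta> - 2)"] show ?thesis
          unfolding S''_def by simp
      qed
      ultimately show ?thesis by simp
    qed
    show "- 2 \<le> S w * S'' w"
    proof -
      have "lg w powr (2 * \<beta> - 1) \<le> 1 + (2 * \<beta> - 1) * (lg w - 1)" by (rule powr_le_young) (use lw \<beta> in auto)
      also have "\<dots> \<le> 1 + 0.00114 * 15" using lw unfolding \<beta> by simp
      finally have 1: "lg w powr (2 * \<beta> - 1) \<le> 1.02" by simp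
      have 2: "lg w powr (2 * \<beta> - 2) \<le> 1" using lw \<beta> powr_mono[of "2 * \<beta> - 2" 0 "lg w"] by simp
      have "S w * S'' w = - (\<beta> * q) * (lg w powr \<beta> * lg w powr (\<beta> - 1) + (1 - \<beta>) * q * (lg w powr \<beta> * lg w powr (\<beta> - 2)))"
        using w1 by (simp add: S_def S''_def field_simps)
      also have "\<dots> = - (\<beta> * q * (lg w powr (2 * \<beta> - 1) + (1 - \<beta>) * q * lg w powr (2 * \<beta> - 2)))"
        by (simp flip: powr_add)
      finally have eq: "S w * S'' w = - (\<beta> * q * (lg w powr (2 * \<beta> - 1) + (1 - \<beta>) * q * lg w powr (2 * \<beta> - 2)))" .
      have "\<beta> * q * (lg w powr (2 * \<beta> - 1) + (1 - \<beta>) * q * lg w powr (2 * \<beta> - 2))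
          \<le> \<beta> * (3/2) * (1.02 + (1 - \<beta>) * (3/2) * 1)"
        by (intro mult_mono add_mono 1 2) (use q \<beta> in auto)
      also have "\<dots> \<le> 2" unfolding \<beta> by simp
      finally show ?thesis unfolding eq by simp
    qed
  qed (use d e in \<open>auto simp: e_def\<close>)
  then show ?thesis using ST[of "1 - 2 * d"] d by simp
qed

section \<open>The Bellman function\<close>

definition bellman :: "real \<Rightarrow> real \<Rightarrow> real" where
  "bellman \<beta> x = max (arch (2 * x - 1) / 2) (if x < 1/2 then 0 else subcube_prof \<beta> (1 - x))"

lemma bellman_ge_arch: "arch (2 * x - 1) / 2 \<le> bellman \<beta> x"
  by (simp add: bellman_def)

lemma bellman_nonneg: "0 \<le> x \<Longrightarrow> x \<le> 1 \<Longrightarrow> 0 \<le> bellman \<beta> x"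
  using arch_nonneg[of "2 * x - 1"] bellman_ge_arch[of x \<beta>] by simp

text \<open>If the maximum at the midpoint is attained by the subcube profile alone, the complement of the midpoint
is below \<open>1 / 2 ^ 16\<close>. Then both points are above \<open>1/2\<close> and the inequality for the subcube
profile applies.\<close>

lemma two_point_bellman:
  assumes \<beta>: "\<beta> = beta0" and xy: "0 \<le> x" "x \<le> y" "y \<le> 1"
  shows "two_point \<beta> (bellman \<beta>) x y"
proof -
  have \<beta>': "0 < \<beta>" "1 \<le> 1 / \<beta>" unfolding \<beta> by simp_all
  have c: "0 \<le> (2::real) powr \<beta> - 1" using \<beta> by (simp add: ge_one_powr_ge_zero)
  let ?m = "(x + y) / 2"
  have mono: "max (pnorm (1 / \<beta>) u (y - x)) (y - x + (2 powr \<beta> - 1) * u)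
      \<le> max (pnorm (1 / \<beta>) (bellman \<beta> y) (y - x)) (y - x + (2 powr \<beta> - 1) * bellman \<beta> y)"
    if "0 \<le> u" "u \<le> bellman \<beta> y" for u
    using that xy \<beta>' c by (intro max.mono pnorm_mono add_left_mono mult_left_mono) auto
  show ?thesis
  proof (cases "bellman \<beta> ?m = arch (2 * ?m - 1) / 2")
    case True
    let ?X = "2 * x - 1" and ?Y = "2 * y - 1"
    have by0: "0 \<le> arch ?Y / 2" using arch_nonneg[of ?Y] xy by simp
    have "2 * arch ((?X + ?Y) / 2) \<le> arch ?X + max (pnorm (1 / \<beta>) (arch ?Y) (?Y - ?X)) (?Y - ?X + (2 powr \<beta> - 1) * arch ?Y)"
      by (rule two_point_arch[OF \<beta>]) (use xy in auto)
    moreover have "pnorm (1 / \<beta>) (arch ?Y) (?Y - ?X) = 2 * pnorm (1 / \<beta>) (arch ?Y / 2) (y - x)"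
      using pnorm_scale[of "1 / \<beta>" 2 "arch ?Y / 2" "y - x"] by0 xy \<beta>' by (simp add: right_diff_distrib)
    moreover have "?Y - ?X + (2 powr \<beta> - 1) * arch ?Y = 2 * (y - x + (2 powr \<beta> - 1) * (arch ?Y / 2))"
      by (simp add: field_simps)
    moreover have "(?X + ?Y) / 2 = 2 * ?m - 1" by (simp add: field_simps)
    moreover have "max (2 * a) (2 * b) = 2 * max a b" for a b :: real by (simp add: max_def)
    ultimately have "2 * arch (2 * ?m - 1) \<le> arch ?X +
        2 * max (pnorm (1 / \<beta>) (arch ?Y / 2) (y - x)) (y - x + (2 powr \<beta> - 1) * (arch ?Y / 2))"
      by (simp only:)
    then have "2 * (arch (2 * ?m - 1) / 2) \<le> arch ?X / 2 +
        max (pnorm (1 / \<beta>) (arch ?Y / 2) (y - x)) (y - x + (2 powr \<beta> - 1) * (arch ?Y / 2))"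
    proof -
      have "2 * (a / 2) \<le> b / 2 + c" if "2 * a \<le> b + 2 * c" for a b c :: real using that by simp
      then show ?thesis using \<open>2 * arch (2 * ?m - 1) \<le> _\<close> by blast
    qed
    also have "\<dots> \<le> bellman \<beta> x + max (pnorm (1 / \<beta>) (bellman \<beta> y) (y - x)) (y - x + (2 powr \<beta> - 1) * bellman \<beta> y)"
      by (intro add_mono mono bellman_ge_arch by0)
    finally show ?thesis unfolding two_point_def True .
  next
    case False
    have bm: "0 \<le> arch (2 * ?m - 1) / 2" using arch_nonneg[of "2 * ?m - 1"] xy by simp
    with False have m: "1/2 \<le> ?m" "bellman \<beta> ?m = subcube_prof \<beta> (1 - ?m)" "arch (2 * ?m - 1) / 2 < subcube_prof \<beta> (1 - ?m)"
      by (auto simp: bellman_def max_def split: if_splits)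
    have small: "1 - ?m \<le> 1 / 2 ^ 16"
    proof (rule ccontr)
      assume "\<not> ?thesis"
      then have "2 * subcube_prof \<beta> (1 - ?m) \<le> prof (1 - 2 * (1 - ?m))" using m by (intro subcube_prof_le_prof[OF \<beta>]) auto
      then show False using m by (simp add: arch_def)
    qed
    then have half: "1/2 \<le> x" "1/2 \<le> y" using xy by auto
    have tx: "subcube_prof \<beta> (1 - x) \<le> bellman \<beta> x" "subcube_prof \<beta> (1 - y) \<le> bellman \<beta> y"
      using half by (auto simp: bellman_def)
    have e: "((1 - y) + (1 - x)) / 2 = 1 - ?m" "(1 - x) - (1 - y) = y - x" by (simp_all add: field_simps)
    have "2 * subcube_prof \<beta> (1 - ?m) \<le> subcube_prof \<beta> (1 - x) + pnorm (1 / \<beta>) (subcube_prof \<beta> (1 - y)) (y - x)"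
      using subcube_prof_two_point[OF \<beta>, of "1 - y" "1 - x"] xy small unfolding e by simp
    also have "\<dots> \<le> bellman \<beta> x + max (pnorm (1 / \<beta>) (bellman \<beta> y) (y - x)) (y - x + (2 powr \<beta> - 1) * bellman \<beta> y)"
      using tx subcube_prof_nonneg[of "1 - y" \<beta>] xy \<beta>' by (intro add_mono max.coboundedI1 pnorm_mono) auto
    finally show ?thesis unfolding two_point_def m(2) .
  qed
qed

theorem theorem1p7:
  fixes n :: nat and A :: "bool list set" and \<beta> :: real
  assumes "\<beta> = 0.50057"
    and "n \<ge> 1"
    and "A \<subseteq> cube n"
    and "cube_density n A \<ge> 1/2"
  shows "cube_mean n (\<lambda>x. real (boundary_deg n A x) powr \<beta>) \<ge>
           max (profile_J (cube_density n A))
               ((1 - cube_density n A) * (log 2 (1 / (1 - cube_density n A))) powr \<beta>)"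
proof -
  let ?a = "cube_density n A"
  have "bellman \<beta> ?a \<le> boundary_mean \<beta> n A"
  proof (rule boundary_mean_ge_two_point)
    show "0 < \<beta>" "\<beta> \<le> 1" using assms(1) by simp_all
    show "bellman \<beta> 0 = 0" by (simp add: bellman_def arch_def left_arc_def)
    show "bellman \<beta> 1 = 0" by (simp add: bellman_def arch_def)
  qed (use assms bellman_nonneg two_point_bellman in auto)
  moreover have "bellman \<beta> ?a = max (profile_J ?a) (subcube_prof \<beta> (1 - ?a))"
    using assms(4) by (simp add: bellman_def arch_def prof_def)
  ultimately show ?thesis by (simp add: boundary_mean_def subcube_prof_def)
qed

end
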